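(* Let $\theta$ be a scalar correlation parameter. In the Universal Kriging model $\boldsymbol y\mid\boldsymbol\beta,\sigma^2,\theta\sim\mathcal N(\boldsymbol H\boldsymbol\beta,\sigma^2\boldsymbol\Sigma_\theta)$, the reference prior on $\theta$ can also be written as $$\pi(\theta)\propto\sqrt{\mathrm{Tr}\left[\left\{\frac{\partial\boldsymbol\Sigma_\theta}{\partial\theta}\boldsymbol\Sigma_\theta^{-1}\boldsymbol Q_\theta\right\}^2\right]-\frac1{n-p}\left[\mathrm{Tr}\left\{\frac{\partial\boldsymbol\Sigma_\theta}{\partial\theta}\boldsymbol\Sigma_\theta^{-1}\boldsymbol Q_\theta\right\}\right]^2},$$ where $\boldsymbol Q_\theta:=\boldsymbol I_n-\boldsymbol H(\boldsymbol H^\top\boldsymbol\Sigma_\theta^{-1}\boldsymbol H)^{-1}\boldsymbol H^\top\boldsymbol\Sigma_\theta^{-1}$ and $\propto$ means equality up to a positive factor not depending on $\theta$.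
   Context: $n>p\ge0$ are integers; $\boldsymbol H$ is a fixed real $n\times p$ matrix of rank $p$; $\boldsymbol\beta\in\mathbb R^p$, $\sigma^2>0$; $\theta$ ranges over an open interval and $\theta\mapsto\boldsymbol\Sigma_\theta$ is a differentiable family of nonsingular $n\times n$ correlation matrices. $\boldsymbol W$ is an $n\times(n-p)$ matrix of full rank whose columns span the orthogonal complement of the column space of $\boldsymbol H$ (so $\boldsymbol W^\top\boldsymbol H=0$). Let $L(\boldsymbol y\mid\boldsymbol\beta,\sigma^2,\theta)$ be the density of $\mathcal N(\boldsymbol H\boldsymbol\beta,\sigma^2\boldsymbol\Sigma_\theta)$. Conditionally on $\theta$, the reference prior on $(\boldsymbol\beta,\sigma^2)$ is $\pi(\boldsymbol\beta,\sigma^2\mid\theta)\propto1/\sigma^2$, and the integrated likelihood is $L^1(\boldsymbol y\mid\theta)=\iint L(\boldsymbol y\mid\boldsymbol\beta,\sigma^2,\theta)\,\sigma^{-2}\,d\boldsymbol\beta\,d\sigma^2$. The reference prior on the scalar $\theta$ is $\pi(\theta)\propto\sqrt{\mathrm{Var}[\partial_\theta\log L^1(\boldsymbol y\mid\theta)]}$, the variance being taken for $\boldsymbol y\sim\mathcal N(\boldsymbol H\boldsymbol\beta,\sigma^2\boldsymbol\Sigma_\theta)$ (it does not depend on $\boldsymbol\beta,\sigma^2$). The other expression of it referred to by "also" is $$\sqrt{\mathrm{Tr}\left[\left\{\boldsymbol W^\top\tfrac{\partial\boldsymbol\Sigma_\theta}{\partial\theta}\boldsymbol W(\boldsymbol W^\top\boldsymbol\Sigma_\theta\boldsymbol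 W)^{-1}\right\}^2\right]-\tfrac1{n-p}\left[\mathrm{Tr}\left\{\boldsymbol W^\top\tfrac{\partial\boldsymbol\Sigma_\theta}{\partial\theta}\boldsymbol W(\boldsymbol W^\top\boldsymbol\Sigma_\theta\boldsymbol W)^{-1}\right\}\right]^2}.$$ *)

theory Defs
  imports
    "HOL-Probability.Probability"
    "Jordan_Normal_Form.DL_Rank"
    "Jordan_Normal_Form.Gauss_Jordan_Elimination"
begin

no_notation inner (infix "\<bullet>" 70)
hide_const (open) Determinants.det Determinants.trace Finite_Cartesian_Product.vec
  Finite_Cartesian_Product.mat Finite_Cartesian_Product.transpose Cartesian_Space.rank

text \<open>Vectors and matrices carry explicit dimensions, so that \<open>p = 0\<close> (a model without
  regressors) is covered: \<open>carrier_vec 0\<close> is a single point.\<close>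

definition mtrace :: "real mat \<Rightarrow> real" where
  "mtrace A = (\<Sum>i<dim_row A. A $$ (i, i))"

text \<open>Only meaningful for invertible square matrices (\<open>mat_inverse\<close> returns \<open>None\<close> for
  singular ones).\<close>

definition minv :: "real mat \<Rightarrow> real mat" where
  "minv A = the (mat_inverse A)"

definition correlation_matrix :: "nat \<Rightarrow> real mat \<Rightarrow> bool" where
  "correlation_matrix n A \<longleftrightarrow>
     A \<in> carrier_mat n n \<and> transpose_mat A = A \<and> (\<forall>i<n. A $$ (i, i) = 1) \<and>
     (\<forall>v\<in>carrier_vec n. 0 \<le> v \<bullet> (A *\<^sub>v v))"

definition mat_differentiable_on :: "nat \<Rightarrow> (real \<Rightarrow> real mat) \<Rightarrow> real set \<Rightarrow> bool" where
  "mat_differentiable_on n \<Sigma> I \<longleftrightarrow>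
     (\<forall>\<theta>\<in>I. \<forall>i<n. \<forall>j<n. (\<lambda>t. \<Sigma> t $$ (i, j)) differentiable (at \<theta>))"

definition mat_deriv :: "nat \<Rightarrow> (real \<Rightarrow> real mat) \<Rightarrow> real \<Rightarrow> real mat" where
  "mat_deriv n \<Sigma> \<theta> = mat n n (\<lambda>(i, j). deriv (\<lambda>t. \<Sigma> t $$ (i, j)) \<theta>)"

text \<open>Lebesgue measure on the Borel sets of \<open>carrier_vec n\<close>.\<close>

definition lborel_vec :: "nat \<Rightarrow> real vec measure" where
  "lborel_vec n = embed_measure (Pi\<^sub>M {..<n} (\<lambda>_. lborel)) (vec n)"

definition mvn_density :: "nat \<Rightarrow> real vec \<Rightarrow> real mat \<Rightarrow> real vec \<Rightarrow> real" where
  "mvn_density n \<mu> V y =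
     exp (- ((y - \<mu>) \<bullet> (minv V *\<^sub>v (y - \<mu>))) / 2) / sqrt ((2 * pi) ^ n * det V)"

definition mvn :: "nat \<Rightarrow> real vec \<Rightarrow> real mat \<Rightarrow> real vec measure" where
  "mvn n \<mu> V = density (lborel_vec n) (\<lambda>y. ennreal (mvn_density n \<mu> V y))"

text \<open>In the following the real argument \<open>s\<close> stands for the variance parameter
  \<open>\<sigma>\<^sup>2\<close> (not for \<open>\<sigma>\<close>), and \<open>S\<close> for a value of the correlation matrix.\<close>

definition likelihood ::
    "nat \<Rightarrow> real mat \<Rightarrow> real mat \<Rightarrow> real vec \<Rightarrow> real vec \<Rightarrow> real \<Rightarrow> real" where
  "likelihood n H S y \<beta> s = mvn_density n (H *\<^sub>v \<beta>) (s \<cdot>\<^sub>m S) y"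

text \<open>The factor \<open>1 / s\<close> is the conditional reference prior of \<open>(\<beta>, \<sigma>\<^sup>2)\<close> given the
  correlation parameter. The integral diverges when \<open>y\<close> is in the column space of \<open>H\<close>, a null set
  not depending on the correlation matrix; there the Bochner integral is 0 by convention.\<close>

definition integrated_likelihood :: "nat \<Rightarrow> nat \<Rightarrow> real mat \<Rightarrow> real mat \<Rightarrow> real vec \<Rightarrow> real" where
  "integrated_likelihood n p H S y =
     (\<integral>(\<beta>, s). likelihood n H S y \<beta> s * (1 / s)
        \<partial>(lborel_vec p \<Otimes>\<^sub>M restrict_space lborel {0<..}))"

definition score ::
    "nat \<Rightarrow> nat \<Rightarrow> real mat \<Rightarrow> (real \<Rightarrow> real mat) \<Rightarrow> real \<Rightarrow> real vec \<Rightarrow> real" where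
  "score n p H \<Sigma> \<theta> y = deriv (\<lambda>t. ln (integrated_likelihood n p H (\<Sigma> t) y)) \<theta>"

text \<open>The reference prior is only determined up to a positive factor; this is the representative
  \<open>\<surd>(Var (score))\<close>, where \<open>y\<close> is drawn with parameters \<open>\<beta>\<close>, \<open>s\<close> and \<open>\<theta>\<close>.\<close>

definition reference_prior ::
    "nat \<Rightarrow> nat \<Rightarrow> real mat \<Rightarrow> (real \<Rightarrow> real mat) \<Rightarrow> real vec \<Rightarrow> real \<Rightarrow> real \<Rightarrow> real" where
  "reference_prior n p H \<Sigma> \<beta> s \<theta> =
     sqrt (prob_space.variance (mvn n (H *\<^sub>v \<beta>) (s \<cdot>\<^sub>m \<Sigma> \<theta>)) (score n p H \<Sigma> \<theta>))"

definition Q_mat :: "nat \<Rightarrow> real mat \<Rightarrow> real mat \<Rightarrow> real mat" where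
  "Q_mat n H S =
     1\<^sub>m n - H * minv (transpose_mat H * minv S * H) * transpose_mat H * minv S"

text \<open>The expression common to both forms of the prior, for a square matrix \<open>M\<close>.\<close>

definition prior_expr :: "nat \<Rightarrow> nat \<Rightarrow> real mat \<Rightarrow> real" where
  "prior_expr n p M = sqrt (mtrace (M * M) - 1 / real (n - p) * (mtrace M)\<^sup>2)"

definition prior_Q :: "nat \<Rightarrow> nat \<Rightarrow> real mat \<Rightarrow> (real \<Rightarrow> real mat) \<Rightarrow> real \<Rightarrow> real" where
  "prior_Q n p H \<Sigma> \<theta> =
     prior_expr n p (mat_deriv n \<Sigma> \<theta> * minv (\<Sigma> \<theta>) * Q_mat n H (\<Sigma> \<theta>))"

definition prior_W :: "nat \<Rightarrow> nat \<Rightarrow> real mat \<Rightarrow> (real \<Rightarrow> real mat) \<Rightarrow> real \<Rightarrow> real" where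
  "prior_W n p W \<Sigma> \<theta> =
     prior_expr n p (transpose_mat W * mat_deriv n \<Sigma> \<theta> * W *
                     minv (transpose_mat W * \<Sigma> \<theta> * W))"

end

theory Submission
  imports Defs
begin

text \<open>
  Put \<open>m = n - p\<close>, \<open>G = W\<^sup>T \<Sigma> W\<close>, \<open>P = W G\<^sup>-\<^sup>1 W\<^sup>T\<close> and \<open>B = P \<Sigma>' P\<close>, where
  \<open>\<Sigma>'\<close> is the derivative of \<open>\<Sigma>\<close> and all matrices depend on \<open>\<theta>\<close>.

  Completing the square in \<open>\<beta>\<close> integrates \<open>\<beta>\<close> out and leaves the quadratic form of
  \<open>\<Sigma>\<^sup>-\<^sup>1 Q\<close> in the exponent. This matrix equals \<open>P\<close> (\<open>kriging_projection_identity\<close>), because the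
  vectors orthogonal to the columns of \<open>H\<close> are exactly the vectors \<open>W a\<close>. Integrating out the variance
  gives a factor not involving \<open>y\<close> times \<open>(y\<^sup>T P y)\<close> to the power \<open>- m / 2\<close>
  (\<open>integrated_likelihood_closed_form\<close>). Since \<open>y\<^sup>T P y = z\<^sup>T G\<^sup>-\<^sup>1 z\<close> with \<open>z = W\<^sup>T y\<close> free of
  \<open>\<theta>\<close>, and the derivative of \<open>G\<^sup>-\<^sup>1\<close> is \<open>- G\<^sup>-\<^sup>1 G' G\<^sup>-\<^sup>1\<close>, the score is a constant plus \<open>m / 2\<close>
  times the ratio \<open>(y\<^sup>T B y) / (y\<^sup>T P y)\<close> (\<open>score_eq\<close>). This fails only for \<open>y\<close> in the column space of
  \<open>H\<close>, a null set.

  The variance of the ratio (\<open>gaussian_ratio_variance\<close>) rests on \<open>1 / q\<^sup>2 = \<integral> t exp (- t q) dt\<close>, over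
  \<open>t \<ge> 0\<close>. With \<open>q\<close> the quadratic form of \<open>P\<close>, the factor \<open>exp (- t q)\<close> turns the Gaussian weight into
  another one, whose covariance is shrunk by \<open>1 / (1 + 2 t)\<close> in the directions seen by \<open>P\<close>. The
  fourth moments of Gaussian vectors therefore give, for all symmetric \<open>A\<close> with
  \<open>A \<Sigma> P = A\<close>, that the mean of \<open>((y\<^sup>T A y) / (y\<^sup>T P y))\<^sup>2\<close> is \<open>K ((tr A\<Sigma>)\<^sup>2 + 2 tr (A\<Sigma>A\<Sigma>))\<close> with one constant \<open>K\<close>.
  The choice \<open>A = P\<close> determines \<open>K = 1 / (m (m + 2))\<close>, \<open>A = B\<close> gives the second moment of the ratio,
  and \<open>A = B + P\<close> its mean. The variance is \<open>2 / (m (m + 2))\<close> times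
  \<open>tr (B\<Sigma>B\<Sigma>) - (tr B\<Sigma>)\<^sup>2 / m\<close>.

  Finally \<open>B \<Sigma>\<close>, \<open>G' G\<^sup>-\<^sup>1\<close> and \<open>\<Sigma>' \<Sigma>\<^sup>-\<^sup>1 Q\<close> have the same traces, and so have their squares, by cyclicity of
  the trace. Both forms of the prior hold with the factor \<open>c = \<surd>(m / (2 (m + 2)))\<close>.
\<close>

no_notation vec_nth (infixl "$" 90)

section \<open>Lebesgue measure on vectors of explicit dimension\<close>

text \<open>Elements of the product space are undefined outside \<open>{..<n}\<close>, so their first \<open>n\<close> values
  determine them. Along this injection everything about \<open>lborel_vec n\<close> is transported from the
  product measure.\<close>

lemma inj_on_vec_PiM: "inj_on (vec n) (space (Pi\<^sub>M {..<n} (\<lambda>_. lborel)))"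
proof (rule inj_onI)
  fix x y :: "nat \<Rightarrow> 'a" assume xy: "x \<in> space (Pi\<^sub>M {..<n} (\<lambda>_. lborel))" "y \<in> space (Pi\<^sub>M {..<n} (\<lambda>_. lborel))" "vec n x = vec n y"
  show "x = y"
  proof (rule PiE_ext)
    show "x \<in> PiE {..<n} (\<lambda>_. UNIV)" "y \<in> PiE {..<n} (\<lambda>_. UNIV)" using xy by (auto simp: space_PiM)
    fix i assume "i \<in> {..<n}"
    then show "x i = y i" using xy(3) by (metis index_vec lessThan_iff)
  qed
qed

lemma space_lborel_vec: "space (lborel_vec n) = carrier_vec n"
proof -
  have "v \<in> vec n ` PiE {..<n} (\<lambda>_. UNIV)" if "v \<in> carrier_vec n" for v :: "real vec"
    using that by (intro image_eqI[of _ _ "restrict (\<lambda>i. v $ i) {..<n}"]) auto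
  then show ?thesis
    by (auto simp: lborel_vec_def space_embed_measure space_PiM)
qed

lemma measurable_vec: "vec n \<in> measurable (Pi\<^sub>M {..<n} (\<lambda>_. lborel)) (lborel_vec n)"
  unfolding lborel_vec_def by (rule measurable_embed_measure2'[OF inj_on_vec_PiM])

lemma measurable_lborel_vec:
  "f \<in> measurable (lborel_vec n) N \<longleftrightarrow> (\<lambda>x. f (vec n x)) \<in> measurable (Pi\<^sub>M {..<n} (\<lambda>_. lborel)) N"
  using measurable_compose[OF measurable_vec, of f n N]
  by (auto simp: lborel_vec_def intro: measurable_embed_measure1)

lemma nn_integral_lborel_vec:
  "f \<in> borel_measurable (lborel_vec n) \<Longrightarrow>
   (\<integral>\<^sup>+ v. f v \<partial>lborel_vec n) = (\<integral>\<^sup>+ x. f (vec n x) \<partial>Pi\<^sub>M {..<n} (\<lambda>_. lborel))"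
  unfolding lborel_vec_def by (rule nn_integral_embed_measure'[OF inj_on_vec_PiM])

lemma measurable_vec_index [measurable]:
  assumes "i < n" shows "(\<lambda>v. v $ i) \<in> borel_measurable (lborel_vec n)"
proof -
  have "(\<lambda>x. x i) \<in> borel_measurable (Pi\<^sub>M {..<n} (\<lambda>_. lborel))"
    using assms by (metis lessThan_iff measurable_component_singleton measurable_lborel1)
  then show ?thesis using assms by (simp add: measurable_lborel_vec)
qed

text \<open>Reading off the coordinates maps \<open>lborel_vec n\<close> back to the product measure, and
  \<open>\<sigma>\<close>-finiteness pulls back along measurable maps.\<close>

lemma sigma_finite_lborel_vec: "sigma_finite_measure (lborel_vec n)"
proof -
  interpret product_sigma_finite "\<lambda>_::nat. lborel :: real measure" ..
  have g: "(\<lambda>v. \<lambda>i\<in>{..<n}. v $ i) \<in> measurable (lborel_vec n) (Pi\<^sub>M {..<n} (\<lambda>_. lborel))"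
    by (rule measurable_restrict) auto
  have "distr (lborel_vec n) (Pi\<^sub>M {..<n} (\<lambda>_. lborel)) (\<lambda>v. \<lambda>i\<in>{..<n}. v $ i)
     = distr (Pi\<^sub>M {..<n} (\<lambda>_. lborel)) (Pi\<^sub>M {..<n} (\<lambda>_. lborel)) ((\<lambda>v. \<lambda>i\<in>{..<n}. v $ i) \<circ> vec n)"
    unfolding lborel_vec_def
    apply (subst embed_measure_eq_distr'[OF inj_on_vec_PiM])
    apply (rule distr_distr)
     using g measurable_vec by (auto simp: lborel_vec_def)
  also have "\<dots> = distr (Pi\<^sub>M {..<n} (\<lambda>_. lborel)) (Pi\<^sub>M {..<n} (\<lambda>_. lborel)) (\<lambda>x. x)"
    by (rule distr_cong) (auto simp: space_PiM fun_eq_iff restrict_def PiE_def extensional_def)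
  finally have "distr (lborel_vec n) (Pi\<^sub>M {..<n} (\<lambda>_. lborel)) (\<lambda>v. \<lambda>i\<in>{..<n}. v $ i) = Pi\<^sub>M {..<n} (\<lambda>_. lborel)"
    by (simp add: distr_id2)
  moreover have "sigma_finite_measure (Pi\<^sub>M {..<n} (\<lambda>_. lborel :: real measure))"
    by (rule sigma_finite) simp
  ultimately show ?thesis
    using sigma_finite_measure_distr[of "lborel_vec n", OF _ g] by simp
qed

lemma nn_integral_lborel_vec_0:
  assumes "f \<in> borel_measurable (lborel_vec 0)"
  shows "(\<integral>\<^sup>+ v. f v \<partial>lborel_vec 0) = f (0\<^sub>v 0)"
proof -
  interpret product_sigma_finite "\<lambda>_::nat. lborel :: real measure" ..
  have *: "vec 0 x = 0\<^sub>v 0" for x :: "nat \<Rightarrow> real" by (intro eq_vecI) auto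
  then show ?thesis
    using assms unfolding nn_integral_lborel_vec[OF assms] *
    by (simp add: PiM_empty nn_integral_count_space_finite max.absorb2)
qed

lemma measurable_into_lborel_vec:
  assumes "\<And>i. i < n \<Longrightarrow> (\<lambda>x. f x $ i) \<in> borel_measurable M"
    and "\<And>x. x \<in> space M \<Longrightarrow> f x \<in> carrier_vec n"
  shows "f \<in> measurable M (lborel_vec n)"
proof -
  have "(\<lambda>x. \<lambda>i\<in>{..<n}. f x $ i) \<in> measurable M (Pi\<^sub>M {..<n} (\<lambda>_. lborel))"
    by (rule measurable_restrict) (use assms in auto)
  from measurable_compose[OF this measurable_vec]
  have "(\<lambda>x. vec n (\<lambda>i\<in>{..<n}. f x $ i)) \<in> measurable M (lborel_vec n)" .
  moreover have "vec n (\<lambda>i\<in>{..<n}. f x $ i) = f x" if "x \<in> space M" for x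
    using assms(2)[OF that] by (intro eq_vecI) auto
  ultimately show ?thesis
    by (simp cong: measurable_cong)
qed

lemma measurable_scalar_prod:
  fixes f g :: "'a \<Rightarrow> real vec"
  assumes "f \<in> measurable M (lborel_vec n)" "g \<in> measurable M (lborel_vec n)"
  shows "(\<lambda>x. f x \<bullet> g x) \<in> borel_measurable M"
proof -
  have "(\<lambda>x. \<Sum>i<n. f x $ i * g x $ i) \<in> borel_measurable M"
    by (intro borel_measurable_sum borel_measurable_times)
       (use measurable_compose[OF assms(1) measurable_vec_index] measurable_compose[OF assms(2) measurable_vec_index] in auto)
  moreover have "f x \<bullet> g x = (\<Sum>i<n. f x $ i * g x $ i)" if "x \<in> space M" for x
    using measurable_space[OF assms(2) that] by (auto simp: space_lborel_vec scalar_prod_def lessThan_atLeast0)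
  ultimately show ?thesis
    by (simp cong: measurable_cong)
qed

lemma measurable_const_vec: "c \<in> carrier_vec n \<Longrightarrow> (\<lambda>_. c) \<in> measurable M (lborel_vec n)"
  by (simp add: space_lborel_vec)

lemma measurable_mult_mat_vec:
  assumes A: "A \<in> carrier_mat m n" and f: "f \<in> measurable M (lborel_vec n)"
  shows "(\<lambda>x. A *\<^sub>v f x) \<in> measurable M (lborel_vec m)"
proof (rule measurable_into_lborel_vec)
  fix i assume "i < m"
  then have "(\<lambda>x. row A i \<bullet> f x) \<in> borel_measurable M"
    using A by (intro measurable_scalar_prod[OF _ f] measurable_const_vec) auto
  then show "(\<lambda>x. (A *\<^sub>v f x) $ i) \<in> borel_measurable M"
    using A \<open>i < m\<close> by simp
qed (metis A measurable_space[OF f] space_lborel_vec mult_mat_vec_carrier)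

lemma measurable_add_vec:
  assumes f: "f \<in> measurable M (lborel_vec n)" and g: "g \<in> measurable M (lborel_vec n)"
  shows "(\<lambda>x. f x + g x) \<in> measurable M (lborel_vec n)"
proof (rule measurable_into_lborel_vec)
  fix i assume i: "i < n"
  have "(\<lambda>x. f x $ i + g x $ i) \<in> borel_measurable M"
    using measurable_compose[OF f measurable_vec_index[OF i]] measurable_compose[OF g measurable_vec_index[OF i]]
    by (rule borel_measurable_add)
  then show "(\<lambda>x. (f x + g x) $ i) \<in> borel_measurable M"
    by (rule subst[OF measurable_cong, rotated])
       (metis i measurable_space[OF g] space_lborel_vec carrier_vecD index_add_vec(1) index_minus_vec(1))
qed (metis measurable_space[OF f] measurable_space[OF g] space_lborel_vec add_carrier_vec minus_carrier_vec)

lemma measurable_minus_vec: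
  assumes f: "f \<in> measurable M (lborel_vec n)" and g: "g \<in> measurable M (lborel_vec n)"
  shows "(\<lambda>x. f x - g x) \<in> measurable M (lborel_vec n)"
proof (rule measurable_into_lborel_vec)
  fix i assume i: "i < n"
  have "(\<lambda>x. f x $ i - g x $ i) \<in> borel_measurable M"
    using measurable_compose[OF f measurable_vec_index[OF i]] measurable_compose[OF g measurable_vec_index[OF i]]
    by (rule borel_measurable_diff)
  then show "(\<lambda>x. (f x - g x) $ i) \<in> borel_measurable M"
    by (rule subst[OF measurable_cong, rotated])
       (metis i measurable_space[OF g] space_lborel_vec carrier_vecD index_add_vec(1) index_minus_vec(1))
qed (metis measurable_space[OF f] measurable_space[OF g] space_lborel_vec add_carrier_vec minus_carrier_vec)

lemma measurable_diff_const:
  "c \<in> carrier_vec n \<Longrightarrow> (\<lambda>y. y - c) \<in> measurable (lborel_vec n) (lborel_vec n)"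
  by (rule measurable_minus_vec) (auto intro: measurable_const_vec)

lemma measurable_append_vec [measurable]:
  "(\<lambda>(v, z). v @\<^sub>v vec 1 (\<lambda>_. z)) \<in> measurable (lborel_vec n \<Otimes>\<^sub>M lborel) (lborel_vec (Suc n))"
proof (rule measurable_into_lborel_vec)
  fix i assume i: "i < Suc n"
  have "(\<lambda>p. if i < n then fst p $ i else snd p) \<in> borel_measurable (lborel_vec n \<Otimes>\<^sub>M lborel)"
    by (cases "i < n") auto
  then show "(\<lambda>p. (case p of (v, z) \<Rightarrow> v @\<^sub>v vec 1 (\<lambda>_. z)) $ i) \<in> borel_measurable (lborel_vec n \<Otimes>\<^sub>M lborel)"
    by (rule subst[OF measurable_cong, rotated]) (use i in \<open>auto simp: space_pair_measure space_lborel_vec\<close>)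
qed (auto simp: space_pair_measure space_lborel_vec intro!: carrier_vecI)

text \<open>Tonelli for the last coordinate: the induction step behind translation invariance, null
  hyperplanes and triangular substitutions.\<close>

lemma nn_integral_lborel_vec_Suc:
  assumes [measurable]: "f \<in> borel_measurable (lborel_vec (Suc n))"
  shows "(\<integral>\<^sup>+ v. f v \<partial>lborel_vec (Suc n)) = (\<integral>\<^sup>+ v. \<integral>\<^sup>+ z. f (v @\<^sub>v vec 1 (\<lambda>_. z)) \<partial>lborel \<partial>lborel_vec n)"
proof -
  interpret product_sigma_finite "\<lambda>_::nat. lborel :: real measure" ..
  have f': "(\<lambda>x. f (vec (Suc n) x)) \<in> borel_measurable (Pi\<^sub>M (insert n {..<n}) (\<lambda>_. lborel))"
    using assms by (simp add: measurable_lborel_vec flip: lessThan_Suc)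
  have "(\<integral>\<^sup>+ v. f v \<partial>lborel_vec (Suc n)) = (\<integral>\<^sup>+ x. f (vec (Suc n) x) \<partial>Pi\<^sub>M (insert n {..<n}) (\<lambda>_. lborel))"
    by (simp add: nn_integral_lborel_vec lessThan_Suc)
  also have "\<dots> = (\<integral>\<^sup>+ x. \<integral>\<^sup>+ z. f (vec (Suc n) (x(n := z))) \<partial>lborel \<partial>Pi\<^sub>M {..<n} (\<lambda>_. lborel))"
    by (rule product_nn_integral_insert[OF _ _ f']) auto
  also have "\<dots> = (\<integral>\<^sup>+ x. \<integral>\<^sup>+ z. f (vec n x @\<^sub>v vec 1 (\<lambda>_. z)) \<partial>lborel \<partial>Pi\<^sub>M {..<n} (\<lambda>_. lborel))"
    by (intro nn_integral_cong arg_cong[where f=f] eq_vecI) auto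
  also have "\<dots> = (\<integral>\<^sup>+ v. \<integral>\<^sup>+ z. f (v @\<^sub>v vec 1 (\<lambda>_. z)) \<partial>lborel \<partial>lborel_vec n)"
    by (rule nn_integral_lborel_vec[symmetric]) measurable
  finally show ?thesis .
qed


lemma nn_integral_lborel_vec_translate:
  assumes "c \<in> carrier_vec n" "f \<in> borel_measurable (lborel_vec n)"
  shows "(\<integral>\<^sup>+ v. f (v + c) \<partial>lborel_vec n) = (\<integral>\<^sup>+ v. f v \<partial>lborel_vec n)"
  using assms
proof (induction n arbitrary: c f)
  case 0
  have m: "(\<lambda>v. f (v + c)) \<in> borel_measurable (lborel_vec 0)"
    by (rule measurable_compose[OF measurable_add_vec 0(2)]) (use 0 in \<open>auto intro: measurable_const_vec\<close>)
  have "0\<^sub>v 0 + c = 0\<^sub>v 0" using 0 by (intro eq_vecI) auto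
  then show ?case
    using 0 m by (simp add: nn_integral_lborel_vec_0)
next
  case (Suc n)
  define c' where "c' = vec n (\<lambda>i. c $ i)"
  have c': "c' \<in> carrier_vec n" by (simp add: c'_def)
  have c: "c = c' @\<^sub>v vec 1 (\<lambda>_. c $ n)"
    using Suc.prems(1) by (intro eq_vecI) (auto simp: c'_def less_Suc_eq)
  note [measurable] = Suc.prems(2)
  have m: "(\<lambda>v. f (v + c)) \<in> borel_measurable (lborel_vec (Suc n))"
    by (rule measurable_compose[OF measurable_add_vec Suc.prems(2)]) (use Suc.prems in \<open>auto intro: measurable_const_vec\<close>)
  have app: "(v @\<^sub>v vec 1 (\<lambda>_. z)) + c = (v + c') @\<^sub>v vec 1 (\<lambda>_. c $ n + 1 * z)" if "v \<in> carrier_vec n" for v z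
    by (rule eq_vecI) (use that c' Suc.prems(1) in \<open>auto simp: less_Suc_eq c'_def\<close>)
  have meas: "(\<lambda>v. \<integral>\<^sup>+ z. f (v @\<^sub>v vec 1 (\<lambda>_. z)) \<partial>lborel) \<in> borel_measurable (lborel_vec n)"
    by measurable
  have "(\<integral>\<^sup>+ v. f (v + c) \<partial>lborel_vec (Suc n)) = (\<integral>\<^sup>+ v. \<integral>\<^sup>+ z. f ((v + c') @\<^sub>v vec 1 (\<lambda>_. c $ n + 1 * z)) \<partial>lborel \<partial>lborel_vec n)"
    unfolding nn_integral_lborel_vec_Suc[OF m]
    by (intro nn_integral_cong) (simp add: space_lborel_vec app del: One_nat_def)
  also have "\<dots> = (\<integral>\<^sup>+ v. \<integral>\<^sup>+ z. f ((v + c') @\<^sub>v vec 1 (\<lambda>_. z)) \<partial>lborel \<partial>lborel_vec n)"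
  proof (rule nn_integral_cong)
    fix v assume "v \<in> space (lborel_vec n)"
    then have "v + c' \<in> space (lborel_vec n)" using c' by (simp add: space_lborel_vec)
    then have "(\<lambda>z. f ((v + c') @\<^sub>v vec 1 (\<lambda>_. z))) \<in> borel_measurable borel"
      using measurable_compose[OF measurable_Pair1' measurable_compose[OF measurable_append_vec Suc.prems(2)]]
      by simp
    from nn_integral_real_affine[OF this, of 1 "c $ n"]
    show "(\<integral>\<^sup>+ z. f ((v + c') @\<^sub>v vec 1 (\<lambda>_. c $ n + 1 * z)) \<partial>lborel) = (\<integral>\<^sup>+ z. f ((v + c') @\<^sub>v vec 1 (\<lambda>_. z)) \<partial>lborel)"
      by simp
  qed
  also have "\<dots> = (\<integral>\<^sup>+ v. \<integral>\<^sup>+ z. f (v @\<^sub>v vec 1 (\<lambda>_. z)) \<partial>lborel \<partial>lborel_vec n)"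
    by (rule Suc.IH[OF c' meas])
  also have "\<dots> = (\<integral>\<^sup>+ v. f v \<partial>lborel_vec (Suc n))"
    by (rule nn_integral_lborel_vec_Suc[symmetric]) measurable
  finally show ?case .
qed

text \<open>If the last coordinate of \<open>w\<close> is nonzero, every line parallel to the last axis meets the
  hyperplane in a single point; otherwise membership depends on the other coordinates only, and the
  induction hypothesis applies.\<close>

lemma AE_lborel_vec_scalar_prod_nonzero:
  assumes "w \<in> carrier_vec n" "w \<noteq> 0\<^sub>v n"
  shows "AE v in lborel_vec n. w \<bullet> v \<noteq> 0"
  using assms
proof (induction n arbitrary: w)
  case 0
  then show ?case by (metis carrier_vecD eq_vecI index_zero_vec(2) less_nat_zero_code)
next
  case (Suc n)
  define w' where "w' = vec n (\<lambda>i. w $ i)"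
  have w': "w' \<in> carrier_vec n" by (simp add: w'_def)
  have prod: "w \<bullet> (v @\<^sub>v vec 1 (\<lambda>_. z)) = w' \<bullet> v + w $ n * z" if "v \<in> carrier_vec n" for v z
    using that Suc.prems(1) by (simp add: scalar_prod_def w'_def)
  have m: "(\<lambda>v. w \<bullet> v) \<in> borel_measurable (lborel_vec (Suc n))"
    using Suc.prems(1) by (intro measurable_scalar_prod measurable_const_vec) auto
  then have [measurable]: "Measurable.pred (lborel_vec (Suc n)) (\<lambda>v. w \<bullet> v = 0)"
    by measurable
  have "(\<integral>\<^sup>+ v. indicator {v. w \<bullet> v = 0} v \<partial>lborel_vec (Suc n)) =
     (\<integral>\<^sup>+ v. \<integral>\<^sup>+ z. indicator {v. w \<bullet> v = 0} (v @\<^sub>v vec 1 (\<lambda>_. z)) \<partial>lborel \<partial>lborel_vec n)"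
    by (rule nn_integral_lborel_vec_Suc) measurable
  also have "\<dots> = (\<integral>\<^sup>+ v. \<integral>\<^sup>+ z. indicator {z. w' \<bullet> v + w $ n * z = 0} z \<partial>lborel \<partial>lborel_vec n)"
    by (intro nn_integral_cong) (simp add: space_lborel_vec prod indicator_def del: One_nat_def)
  also have "\<dots> = 0"
  proof (cases "w $ n = 0")
    case False
    have "{z. w' \<bullet> v + w $ n * z = 0} = {- (w' \<bullet> v) / w $ n}" for v
      using False by (auto simp: field_simps eq_neg_iff_add_eq_0)
    then show ?thesis by simp
  next
    case True
    have "w' \<noteq> 0\<^sub>v n"
    proof
      assume *: "w' = 0\<^sub>v n"
      have "w $ i = 0" if "i < Suc n" for i
        using that True * by (cases "i = n") (auto simp: w'_def vec_eq_iff less_Suc_eq)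
      then show False using Suc.prems by (auto simp: vec_eq_iff)
    qed
    from Suc.IH[OF w' this]
    have "AE v in lborel_vec n. (\<integral>\<^sup>+ z. indicator {z. w' \<bullet> v + w $ n * z = 0} z \<partial>lborel) = 0"
      by eventually_elim (simp add: True)
    then show ?thesis by (subst nn_integral_cong_AE) auto
  qed
  finally have "(\<integral>\<^sup>+ v. indicator {v. w \<bullet> v = 0} v \<partial>lborel_vec (Suc n)) = 0" .
  then have "AE v in lborel_vec (Suc n). (indicator {v. w \<bullet> v = 0} v :: ennreal) = 0"
    by (subst (asm) nn_integral_0_iff_AE) auto
  then show ?case by eventually_elim (auto simp: indicator_def)
qed

section \<open>Positive definite matrices and triangular substitutions\<close>

definition positive_definite :: "nat \<Rightarrow> real mat \<Rightarrow> bool" where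
  "positive_definite n A \<longleftrightarrow> A \<in> carrier_mat n n \<and> A\<^sup>T = A \<and>
     (\<forall>v\<in>carrier_vec n. v \<noteq> 0\<^sub>v n \<longrightarrow> 0 < v \<bullet> (A *\<^sub>v v))"

text \<open>The substitution rule is part of the property so that it can be built up row by row together
  with a Cholesky factor.\<close>

definition scales_lebesgue :: "nat \<Rightarrow> real mat \<Rightarrow> bool" where
  "scales_lebesgue n L \<longleftrightarrow> L \<in> carrier_mat n n \<and> 0 < det L \<and>
     (\<forall>f \<in> borel_measurable (lborel_vec n).
        (\<integral>\<^sup>+ v. f v \<partial>lborel_vec n) = ennreal (det L) * (\<integral>\<^sup>+ v. f (L *\<^sub>v v) \<partial>lborel_vec n))"

lemma det_nonzero_imp_inverse:
  fixes A :: "real mat"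
  assumes A: "A \<in> carrier_mat n n" and "det A \<noteq> 0"
  shows "A * minv A = 1\<^sub>m n" "minv A * A = 1\<^sub>m n" "minv A \<in> carrier_mat n n"
proof -
  have "A \<in> Units (ring_mat TYPE(real) n ())"
    using det_non_zero_imp_unit[OF A] assms by auto
  with mat_inverse(1)[OF A, of "()"] obtain B where "mat_inverse A = Some B"
    by (cases "mat_inverse A") auto
  with mat_inverse(2)[OF A this] show "A * minv A = 1\<^sub>m n" "minv A * A = 1\<^sub>m n" "minv A \<in> carrier_mat n n"
    by (auto simp: minv_def)
qed

text \<open>With the first \<open>n\<close> coordinates fixed, the last one undergoes an affine map of slope \<open>d\<close>.\<close>

lemma scales_lebesgue_border:
  assumes L: "scales_lebesgue n L" and l: "l \<in> carrier_vec n" and d: "0 < d"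
  shows "scales_lebesgue (Suc n) (four_block_mat L (0\<^sub>m n 1) (mat_of_row l) (mat 1 1 (\<lambda>_. d)))"
proof -
  define M where "M = four_block_mat L (0\<^sub>m n 1) (mat_of_row l) (mat 1 1 (\<lambda>_. d))"
  have Lc: "L \<in> carrier_mat n n" and dL: "0 < det L" using L by (auto simp: scales_lebesgue_def)
  have M: "M \<in> carrier_mat (Suc n) (Suc n)"
    using Lc four_block_carrier_mat[of L n n "mat 1 1 (\<lambda>_. d)" 1 1] by (simp add: M_def)
  have det1: "det (mat 1 1 (\<lambda>_. d)) = d" by (simp add: det_single)
  have detM: "det M = det L * d"
    unfolding M_def using l by (subst det_four_block_mat_upper_right_zero[OF Lc]) (auto simp: det1 simp del: One_nat_def)
  have Mv: "M *\<^sub>v (v @\<^sub>v vec 1 (\<lambda>_. z)) = (L *\<^sub>v v) @\<^sub>v vec 1 (\<lambda>_. l \<bullet> v + d * z)"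
    if "v \<in> carrier_vec n" for v z
  proof (rule eq_vecI)
    fix i assume "i < dim_vec ((L *\<^sub>v v) @\<^sub>v vec 1 (\<lambda>_. l \<bullet> v + d * z))"
    then have i: "i < Suc n" using Lc by auto
    show "(M *\<^sub>v (v @\<^sub>v vec 1 (\<lambda>_. z))) $ i = ((L *\<^sub>v v) @\<^sub>v vec 1 (\<lambda>_. l \<bullet> v + d * z)) $ i"
      using i that Lc l M
      by (auto simp: scalar_prod_def M_def less_Suc_eq)
  qed (use M Lc in auto)
  have "(\<integral>\<^sup>+ v. f v \<partial>lborel_vec (Suc n)) = ennreal (det M) * (\<integral>\<^sup>+ v. f (M *\<^sub>v v) \<partial>lborel_vec (Suc n))"
    if f [measurable]: "f \<in> borel_measurable (lborel_vec (Suc n))" for f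
  proof -
    have sec: "(\<lambda>z. f (v @\<^sub>v vec 1 (\<lambda>_. z))) \<in> borel_measurable borel" if "v \<in> carrier_vec n" for v
      using measurable_compose[OF measurable_Pair1' measurable_compose[OF measurable_append_vec f], of v] that
      by (simp add: space_lborel_vec)
    have fM: "(\<lambda>v. f (M *\<^sub>v v)) \<in> borel_measurable (lborel_vec (Suc n))"
      by (rule measurable_compose[OF measurable_mult_mat_vec[OF M measurable_ident_sets[OF refl]] f])
    have "(\<integral>\<^sup>+ v. f v \<partial>lborel_vec (Suc n)) = (\<integral>\<^sup>+ v. \<integral>\<^sup>+ z. f (v @\<^sub>v vec 1 (\<lambda>_. z)) \<partial>lborel \<partial>lborel_vec n)"
      by (rule nn_integral_lborel_vec_Suc[OF f])
    also have "\<dots> = ennreal (det L) * (\<integral>\<^sup>+ v. \<integral>\<^sup>+ z. f ((L *\<^sub>v v) @\<^sub>v vec 1 (\<lambda>_. z)) \<partial>lborel \<partial>lborel_vec n)"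
    proof -
      have "(\<lambda>v. \<integral>\<^sup>+ z. f (v @\<^sub>v vec 1 (\<lambda>_. z)) \<partial>lborel) \<in> borel_measurable (lborel_vec n)"
        by measurable
      then show ?thesis using L by (auto simp: scales_lebesgue_def)
    qed
    also have "(\<integral>\<^sup>+ v. \<integral>\<^sup>+ z. f ((L *\<^sub>v v) @\<^sub>v vec 1 (\<lambda>_. z)) \<partial>lborel \<partial>lborel_vec n)
       = (\<integral>\<^sup>+ v. ennreal d * \<integral>\<^sup>+ z. f ((L *\<^sub>v v) @\<^sub>v vec 1 (\<lambda>_. l \<bullet> v + d * z)) \<partial>lborel \<partial>lborel_vec n)"
    proof (rule nn_integral_cong)
      fix v assume "v \<in> space (lborel_vec n)"
      then have "L *\<^sub>v v \<in> carrier_vec n" using Lc by (auto simp: space_lborel_vec intro: mult_mat_vec_carrier)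
      from nn_integral_real_affine[OF sec[OF this], of d "l \<bullet> v"] d
      show "(\<integral>\<^sup>+ z. f ((L *\<^sub>v v) @\<^sub>v vec 1 (\<lambda>_. z)) \<partial>lborel) =
          ennreal d * \<integral>\<^sup>+ z. f ((L *\<^sub>v v) @\<^sub>v vec 1 (\<lambda>_. l \<bullet> v + d * z)) \<partial>lborel"
        by simp
    qed
    also have "\<dots> = (\<integral>\<^sup>+ v. ennreal d * \<integral>\<^sup>+ z. f (M *\<^sub>v (v @\<^sub>v vec 1 (\<lambda>_. z))) \<partial>lborel \<partial>lborel_vec n)"
      by (rule nn_integral_cong) (simp add: Mv space_lborel_vec del: One_nat_def)
    also have "\<dots> = ennreal d * (\<integral>\<^sup>+ v. \<integral>\<^sup>+ z. f (M *\<^sub>v (v @\<^sub>v vec 1 (\<lambda>_. z))) \<partial>lborel \<partial>lborel_vec n)"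
    proof (rule nn_integral_cmult)
      note [measurable] = fM
      show "(\<lambda>v. \<integral>\<^sup>+ z. f (M *\<^sub>v (v @\<^sub>v vec 1 (\<lambda>_. z))) \<partial>lborel) \<in> borel_measurable (lborel_vec n)"
        by measurable
    qed
    also have "\<dots> = ennreal d * (\<integral>\<^sup>+ v. f (M *\<^sub>v v) \<partial>lborel_vec (Suc n))"
      by (simp add: nn_integral_lborel_vec_Suc[OF fM])
    finally show ?thesis
      using d dL by (simp add: detM ennreal_mult mult.assoc)
  qed
  then show ?thesis
    using M d dL unfolding scales_lebesgue_def M_def[symmetric] by (simp add: detM)
qed

text \<open>The last row \<open>(l, d)\<close> of the factor solves \<open>L l = b\<close> and \<open>d\<^sup>2 = c - l \<bullet> l\<close>, where \<open>(b, c)\<close> is the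
  last column of \<open>A\<close>. The right-hand side is positive: it is the value of the quadratic form at
  \<open>(u, -1)\<close>, where \<open>u\<close> solves \<open>A' u = b\<close> for the leading block \<open>A'\<close>.\<close>

lemma positive_definite_cholesky:
  assumes "positive_definite n A"
  shows "\<exists>L. scales_lebesgue n L \<and> L * L\<^sup>T = A"
  using assms
proof (induction n arbitrary: A)
  case 0
  have [simp]: "det (1\<^sub>m 0) = (1 :: real)" by simp
  have "(\<integral>\<^sup>+ v. f v \<partial>lborel_vec 0) = (\<integral>\<^sup>+ v. f (1\<^sub>m 0 *\<^sub>v v) \<partial>lborel_vec 0)" for f :: "real vec \<Rightarrow> ennreal"
    by (rule nn_integral_cong) (simp add: space_lborel_vec)
  then have "scales_lebesgue 0 (1\<^sub>m 0)"
    by (simp add: scales_lebesgue_def)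
  moreover have "1\<^sub>m 0 * transpose_mat (1\<^sub>m 0) = A"
    using 0 by (intro eq_matI) (auto simp: positive_definite_def)
  ultimately show ?case by blast
next
  case (Suc n)
  have A: "A \<in> carrier_mat (Suc n) (Suc n)" and sym: "A\<^sup>T = A"
    and pos: "\<And>v. v \<in> carrier_vec (Suc n) \<Longrightarrow> v \<noteq> 0\<^sub>v (Suc n) \<Longrightarrow> 0 < v \<bullet> (A *\<^sub>v v)"
    using Suc.prems by (auto simp: positive_definite_def)
  have symi: "A $$ (i, j) = A $$ (j, i)" if "i < Suc n" "j < Suc n" for i j
    using sym that A by (metis index_transpose_mat(1) carrier_matD)
  have symn: "A $$ (n, i) = A $$ (i, n)" if "i < n" for i
    using symi[of n i] that by simp
  define A' where "A' = mat n n (\<lambda>(i, j). A $$ (i, j))"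
  define b where "b = vec n (\<lambda>i. A $$ (i, n))"
  define c where "c = A $$ (n, n)"
  have A': "A' \<in> carrier_mat n n" and b: "b \<in> carrier_vec n" by (simp_all add: A'_def b_def)
  have A'sym: "A'\<^sup>T = A'"
    by (intro eq_matI) (auto simp: A'_def symi)
  have ext: "v @\<^sub>v vec 1 (\<lambda>_. z) \<in> carrier_vec (Suc n)" if "v \<in> carrier_vec n" for v :: "real vec" and z
    using that by (intro carrier_vecI) simp
  have quad: "(v @\<^sub>v vec 1 (\<lambda>_. z)) \<bullet> (A *\<^sub>v (v @\<^sub>v vec 1 (\<lambda>_. z)))
      = v \<bullet> (A' *\<^sub>v v) + 2 * z * (b \<bullet> v) + c * z\<^sup>2" if v: "v \<in> carrier_vec n" for v z
  proof -
    have *: "A *\<^sub>v (v @\<^sub>v vec 1 (\<lambda>_. z)) = (A' *\<^sub>v v + z \<cdot>\<^sub>v b) @\<^sub>v vec 1 (\<lambda>_. b \<bullet> v + c * z)"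
    proof (rule eq_vecI)
      fix i assume "i < dim_vec ((A' *\<^sub>v v + z \<cdot>\<^sub>v b) @\<^sub>v vec 1 (\<lambda>_. b \<bullet> v + c * z))"
      then have i: "i < Suc n" by (auto simp: b_def)
      then show "(A *\<^sub>v (v @\<^sub>v vec 1 (\<lambda>_. z))) $ i = ((A' *\<^sub>v v + z \<cdot>\<^sub>v b) @\<^sub>v vec 1 (\<lambda>_. b \<bullet> v + c * z)) $ i"
        using v A by (auto simp: scalar_prod_def A'_def b_def c_def less_Suc_eq symn)
    qed (use A in \<open>auto simp: b_def\<close>)
    have "(v @\<^sub>v vec 1 (\<lambda>_. z)) \<bullet> (A *\<^sub>v (v @\<^sub>v vec 1 (\<lambda>_. z))) = v \<bullet> (A' *\<^sub>v v + z \<cdot>\<^sub>v b) + z * (b \<bullet> v + c * z)"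
      unfolding * by (subst scalar_prod_append[OF v]) (use v A' b in \<open>auto simp: scalar_prod_def\<close>)
    also have "v \<bullet> (A' *\<^sub>v v + z \<cdot>\<^sub>v b) = v \<bullet> (A' *\<^sub>v v) + z * (v \<bullet> b)"
      using v A' b by (subst scalar_prod_add_distrib[OF v]) (auto intro: mult_mat_vec_carrier)
    also have "v \<bullet> b = b \<bullet> v" by (rule comm_scalar_prod[OF v b])
    finally show ?thesis by (simp add: power2_eq_square algebra_simps)
  qed
  have "positive_definite n A'"
    unfolding positive_definite_def
  proof (intro conjI ballI impI A' A'sym)
    fix v :: "real vec" assume v: "v \<in> carrier_vec n" "v \<noteq> 0\<^sub>v n"
    have "(v @\<^sub>v vec 1 (\<lambda>_. 0)) \<noteq> 0\<^sub>v (Suc n)"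
    proof
      assume *: "v @\<^sub>v vec 1 (\<lambda>_. 0) = 0\<^sub>v (Suc n)"
      have "v $ i = 0" if "i < n" for i
        using arg_cong[OF *, of "\<lambda>w. w $ i"] that v by simp
      then show False using v by (auto simp: vec_eq_iff)
    qed
    from pos[OF ext[OF v(1)] this] show "0 < v \<bullet> (A' *\<^sub>v v)"
      unfolding quad[OF v(1)] by simp
  qed
  from Suc.IH[OF this] obtain L where L: "scales_lebesgue n L" and LL: "L * L\<^sup>T = A'"
    by blast
  have Lc: "L \<in> carrier_mat n n" and dL: "det L \<noteq> 0" using L by (auto simp: scales_lebesgue_def)
  note Li = det_nonzero_imp_inverse[OF Lc dL]
  define l where "l = minv L *\<^sub>v b"
  \<comment> \<open>the solution of \<open>A' u = b\<close>, which makes \<open>c - l \<bullet> l\<close> a value of the quadratic form\<close>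
  define u where "u = transpose_mat (minv L) *\<^sub>v l"
  have l: "l \<in> carrier_vec n" and u: "u \<in> carrier_vec n" using Li b by (auto simp: l_def u_def)
  have Ll: "L *\<^sub>v l = b"
    using Lc Li b by (simp add: l_def flip: assoc_mult_mat_vec)
  have "L\<^sup>T * transpose_mat (minv L) = 1\<^sub>m n"
    using transpose_mult[OF Li(3) Lc] Li by simp
  then have Ltu: "L\<^sup>T *\<^sub>v u = l"
    using Lc Li l by (simp add: u_def flip: assoc_mult_mat_vec[of _ n n _ n])
  have A'u: "A' *\<^sub>v u = b"
    using Lc u Ltu Ll by (simp flip: LL)
  have bu: "b \<bullet> u = l \<bullet> l"
    using transpose_vec_mult_scalar[OF Lc l u] Ll Ltu comm_scalar_prod[OF u b]
      transpose_vec_mult_scalar[of "L\<^sup>T" n n u l] Lc l u b comm_scalar_prod[OF l l]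
    by (metis comm_scalar_prod)
  have "0 < c - l \<bullet> l"
  proof -
    have "(u @\<^sub>v vec 1 (\<lambda>_. - 1)) \<noteq> 0\<^sub>v (Suc n)"
    proof
      assume *: "u @\<^sub>v vec 1 (\<lambda>_. - 1) = 0\<^sub>v (Suc n)"
      show False using arg_cong[OF *, of "\<lambda>w. w $ n"] u by simp
    qed
    from pos[OF ext[OF u] this] have "0 < u \<bullet> b - 2 * (b \<bullet> u) + c"
      unfolding quad[OF u] A'u by simp
    then show ?thesis using bu comm_scalar_prod[OF u b] by simp
  qed
  define d where "d = sqrt (c - l \<bullet> l)"
  have d: "0 < d" "d * d = c - l \<bullet> l" using \<open>0 < c - l \<bullet> l\<close> by (auto simp: d_def)
  define M where "M = four_block_mat L (0\<^sub>m n 1) (mat_of_row l) (mat 1 1 (\<lambda>_. d))"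
  have M: "M \<in> carrier_mat (Suc n) (Suc n)"
    using Lc four_block_carrier_mat[of L n n "mat 1 1 (\<lambda>_. d)" 1 1] by (simp add: M_def)
  have LLi: "(\<Sum>k<n. L $$ (i, k) * L $$ (j, k)) = A $$ (i, j)" if "i < n" "j < n" for i j
    using arg_cong[OF LL, of "\<lambda>B. B $$ (i, j)"] that Lc
    by (simp add: A'_def scalar_prod_def lessThan_atLeast0)
  have Lli: "(\<Sum>k<n. L $$ (i, k) * l $ k) = A $$ (i, n)" if "i < n" for i
    using arg_cong[OF Ll, of "\<lambda>v. v $ i"] that Lc l
    by (simp add: b_def scalar_prod_def lessThan_atLeast0)
  have lli: "(\<Sum>k<n. l $ k * l $ k) + d * d = A $$ (n, n)"
    using d l by (simp add: c_def scalar_prod_def lessThan_atLeast0)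
  have "M * M\<^sup>T = A"
  proof (rule eq_matI)
    fix i j assume "i < dim_row A" "j < dim_col A"
    then have ij: "i < Suc n" "j < Suc n" using A by auto
    have "(M * M\<^sup>T) $$ (i, j) = (\<Sum>k<Suc n. M $$ (i, k) * M $$ (j, k))"
      using M ij by (simp add: scalar_prod_def lessThan_atLeast0)
    also have "\<dots> = A $$ (i, j)"
      using ij Lc l LLi Lli lli by (auto simp: M_def less_Suc_eq symn mult.commute)
    finally show "(M * M\<^sup>T) $$ (i, j) = A $$ (i, j)" .
  qed (use M A in auto)
  moreover have "scales_lebesgue (Suc n) M"
    unfolding M_def by (rule scales_lebesgue_border[OF L l d(1)])
  ultimately show ?case by blast
qed

section \<open>Gaussian integrals of quadratic forms\<close>

lemma mtrace_mult_comm: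
  assumes "A \<in> carrier_mat n m" "B \<in> carrier_mat m n"
  shows "mtrace (A * B) = mtrace (B * A)"
proof -
  have "mtrace (A * B) = (\<Sum>i<n. \<Sum>j<m. A $$ (i, j) * B $$ (j, i))"
    using assms by (simp add: mtrace_def scalar_prod_def lessThan_atLeast0)
  also have "\<dots> = (\<Sum>j<m. \<Sum>i<n. B $$ (j, i) * A $$ (i, j))"
    by (subst sum.swap) (simp add: mult.commute)
  also have "\<dots> = mtrace (B * A)"
    using assms by (simp add: mtrace_def scalar_prod_def lessThan_atLeast0)
  finally show ?thesis .
qed

lemma mtrace_add: "A \<in> carrier_mat n n \<Longrightarrow> B \<in> carrier_mat n n \<Longrightarrow> mtrace (A + B) = mtrace A + mtrace B"
  by (simp add: mtrace_def sum.distrib)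

lemma mtrace_smult: "A \<in> carrier_mat n n \<Longrightarrow> mtrace (c \<cdot>\<^sub>m A) = c * mtrace A"
  by (simp add: mtrace_def sum_distrib_left)

definition qform :: "real mat \<Rightarrow> real vec \<Rightarrow> real" where
  "qform A v = v \<bullet> (A *\<^sub>v v)"

lemma qform_eq_sum:
  assumes "A \<in> carrier_mat n n" "v \<in> carrier_vec n"
  shows "qform A v = (\<Sum>i<n. \<Sum>j<n. A $$ (i, j) * (v $ i * v $ j))"
  using assms by (simp add: qform_def scalar_prod_def lessThan_atLeast0 sum_distrib_left mult_ac)

lemma measurable_qform:
  "A \<in> carrier_mat n n \<Longrightarrow> f \<in> measurable M (lborel_vec n) \<Longrightarrow> (\<lambda>x. qform A (f x)) \<in> borel_measurable M"
  unfolding qform_def by (intro measurable_scalar_prod measurable_mult_mat_vec)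

lemma measurable_qform_id: "A \<in> carrier_mat n n \<Longrightarrow> qform A \<in> borel_measurable (lborel_vec n)"
  using measurable_qform[OF _ measurable_ident_sets[OF refl]] by simp

lemma qform_add: "A \<in> carrier_mat n n \<Longrightarrow> B \<in> carrier_mat n n \<Longrightarrow> v \<in> carrier_vec n \<Longrightarrow>
    qform (A + B) v = qform A v + qform B v"
  by (simp add: qform_eq_sum[of _ n] sum.distrib distrib_right)

lemma qform_smult: "A \<in> carrier_mat n n \<Longrightarrow> v \<in> carrier_vec n \<Longrightarrow> qform (c \<cdot>\<^sub>m A) v = c * qform A v"
  by (simp add: qform_eq_sum[of _ n] sum_distrib_left mult.assoc)

lemma qform_congruence:
  assumes A: "A \<in> carrier_mat n n" and L: "L \<in> carrier_mat n k" and v: "v \<in> carrier_vec k"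
  shows "qform (L\<^sup>T * A * L) v = qform A (L *\<^sub>v v)"
proof -
  have "(L\<^sup>T * A * L) *\<^sub>v v = L\<^sup>T *\<^sub>v (A *\<^sub>v (L *\<^sub>v v))"
    using assms by (simp add: assoc_mult_mat_vec[of _ k n _ k] assoc_mult_mat_vec[of _ k n _ n] assoc_mult_mat_vec[of _ n n _ k])
  moreover have "v \<bullet> (L\<^sup>T *\<^sub>v (A *\<^sub>v (L *\<^sub>v v))) = (L *\<^sub>v v) \<bullet> (A *\<^sub>v (L *\<^sub>v v))"
    using transpose_vec_mult_scalar[OF L v, of "A *\<^sub>v (L *\<^sub>v v)"] A L v
      comm_scalar_prod[of v k "L\<^sup>T *\<^sub>v (A *\<^sub>v (L *\<^sub>v v))"] comm_scalar_prod[of "L *\<^sub>v v" n "A *\<^sub>v (L *\<^sub>v v)"]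
    by (metis mult_mat_vec_carrier transpose_carrier_mat)
  ultimately show ?thesis by (simp add: qform_def)
qed

lemma positive_definite_det_nonzero:
  assumes "positive_definite n A" shows "det A \<noteq> 0"
proof
  assume "det A = 0"
  then obtain v where "v \<in> carrier_vec n" "v \<noteq> 0\<^sub>v n" "A *\<^sub>v v = 0\<^sub>v n"
    using det_0_iff_vec_prod_zero[of A n] assms by (auto simp: positive_definite_def)
  then show False using assms by (force simp: positive_definite_def)
qed

lemma positive_definite_inverse:
  assumes A: "positive_definite n A" and B: "B \<in> carrier_mat n n" and AB: "A * B = 1\<^sub>m n"
  shows "positive_definite n B"
proof -
  have Ac: "A \<in> carrier_mat n n" and At: "A\<^sup>T = A" using A by (auto simp: positive_definite_def)
  have "B\<^sup>T * A = 1\<^sub>m n" using transpose_mult[OF Ac B] AB At by simp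
  then have Bt: "B\<^sup>T = B"
    using AB Ac B assoc_mult_mat[of "B\<^sup>T" n n A n B n] by simp
  have "0 < v \<bullet> (B *\<^sub>v v)" if v: "v \<in> carrier_vec n" "v \<noteq> 0\<^sub>v n" for v
  proof -
    have Bv: "B *\<^sub>v v \<in> carrier_vec n" using B v by simp
    have ABv: "A *\<^sub>v (B *\<^sub>v v) = v" using Ac B v AB by (simp flip: assoc_mult_mat_vec)
    moreover have "A *\<^sub>v 0\<^sub>v n = 0\<^sub>v n" using Ac by (intro eq_vecI) auto
    ultimately have "B *\<^sub>v v \<noteq> 0\<^sub>v n" using v by metis
    then have "0 < (B *\<^sub>v v) \<bullet> (A *\<^sub>v (B *\<^sub>v v))" using A Bv by (auto simp: positive_definite_def)
    then show ?thesis unfolding ABv using comm_scalar_prod[OF Bv v(1)] by simp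
  qed
  then show ?thesis using B Bt by (simp add: positive_definite_def)
qed

lemma std_normal_moment_small:
  "integral\<^sup>L lborel (\<lambda>x. std_normal_density x * x ^ 0) = 1"
  "integral\<^sup>L lborel (\<lambda>x. std_normal_density x * x ^ 1) = 0"
  "integral\<^sup>L lborel (\<lambda>x. std_normal_density x * x ^ 2) = 1"
  "integral\<^sup>L lborel (\<lambda>x. std_normal_density x * x ^ 3) = 0"
  "integral\<^sup>L lborel (\<lambda>x. std_normal_density x * x ^ 4) = 3"
  using integral_std_normal_moment_even[of 0] integral_std_normal_moment_odd[of 0]
    integral_std_normal_moment_even[of 1] integral_std_normal_moment_odd[of 1]
    integral_std_normal_moment_even[of 2]
  by (simp_all add: fact_numeral eval_nat_numeral)

text \<open>The number \<open>e r\<close> counts how often \<open>r\<close> occurs among the four indices, and the three summands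
  are the three ways of pairing them.\<close>

lemma isserlis_even:
  fixes i j k l :: nat
  assumes e: "\<And>r. e r = (of_bool (r = i) + of_bool (r = j) + of_bool (r = k) + of_bool (r = l) :: nat)"
  and F: "\<not> (\<exists>r\<in>{i, j, k, l}. e r = 1 \<or> e r = 3)" and neq: "\<not> (i = j \<and> j = k \<and> k = l)"
  shows "of_bool (i = j \<and> k = l) + of_bool (i = k \<and> j = l) + of_bool (i = l \<and> j = k) = (1::real)"
proof -
  have F': "e i \<noteq> 1" "e j \<noteq> 1" "e k \<noteq> 1" "e i \<noteq> 3" using F by auto
  have "(i = j \<and> k = l \<and> i \<noteq> k) \<or> (i = k \<and> j = l \<and> i \<noteq> j) \<or> (i = l \<and> j = k \<and> i \<noteq> j)"
  proof (cases "i = j")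
    case True
    have "k = l"
    proof (rule ccontr)
      assume "k \<noteq> l"
      moreover from this have "k \<noteq> i" "l \<noteq> i" using F' True by (auto simp: e)
      ultimately show False using F' True by (auto simp: e)
    qed
    then show ?thesis using True neq by auto
  next
    case ij: False
    show ?thesis
    proof (cases "i = k")
      case True
      have "l \<noteq> i" using F' ij True by (auto simp: e)
      then have "j = l" using F' ij True by (auto simp: e)
      then show ?thesis using True ij by auto
    next
      case False
      have il: "i = l" using F' ij False by (auto simp: e)
      then have "j = k" using F' ij False by (auto simp: e)
      then show ?thesis using il ij by auto
    qed
  qed
  then show ?thesis by (elim disjE conjE; simp only: simp_thms of_bool_eq; simp)
qed

lemma isserlis_odd:
  fixes i j k l :: nat
  assumes e: "\<And>r. e r = (of_bool (r = i) + of_bool (r = j) + of_bool (r = k) + of_bool (r = l) :: nat)"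
  and F: "(\<exists>r\<in>{i, j, k, l}. e r = 1 \<or> e r = 3)"
  shows "of_bool (i = j \<and> k = l) + of_bool (i = k \<and> j = l) + of_bool (i = l \<and> j = k) = (0::real)"
proof -
  have F: "e i = 1 \<or> e j = 1 \<or> e k = 1 \<or> e l = 1 \<or> e i = 3 \<or> e j = 3 \<or> e k = 3 \<or> e l = 3" using F by auto
  have no_pairing: "\<not> (a = b \<and> c = d)"
    if "\<And>r. e r = of_bool (r = a) + of_bool (r = b) + of_bool (r = c) + of_bool (r = d)"
      and "e a = 1 \<or> e b = 1 \<or> e c = 1 \<or> e d = 1 \<or> e a = 3 \<or> e b = 3 \<or> e c = 3 \<or> e d = 3" for a b c d
  proof
    assume "a = b \<and> c = d"
    then have "e b = e a" "e d = e c" "e a = (if a = c then 4 else 2)" "e c = (if a = c then 4 else 2)" using that(1) by auto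
    then show False using that(2) by (auto split: if_splits)
  qed
  have "\<not> (i = j \<and> k = l)" by (rule no_pairing[OF e F])
  moreover have "\<not> (i = k \<and> j = l)" by (rule no_pairing) (use F in \<open>auto simp: e\<close>)
  moreover have "\<not> (i = l \<and> j = k)" by (rule no_pairing) (use F in \<open>auto simp: e\<close>)
  ultimately show ?thesis by (simp only: of_bool_eq)
qed

text \<open>Isserlis' formula for four factors: \<open>M\<close> holds the moments of a standard normal variable, and
  the argument of \<open>M\<close> is the exponent of the \<open>r\<close>-th variable in the monomial. An odd exponent makes
  the product vanish; otherwise the indices pair up, in three ways if they all coincide and in one
  way if they do not.\<close>

lemma isserlis_exponents:
  fixes M :: "nat \<Rightarrow> real" and i j k l n :: nat
  assumes M: "M 0 = 1" "M 1 = 0" "M 2 = 1" "M 3 = 0" "M 4 = 3"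
    and "i < n" "j < n" "k < n" "l < n"
  shows "(\<Prod>r<n. M (of_bool (r = i) + of_bool (r = j) + of_bool (r = k) + of_bool (r = l)))
     = of_bool (i = j \<and> k = l) + of_bool (i = k \<and> j = l) + of_bool (i = l \<and> j = k)"
    (is "?P = ?R")
proof -
  define e where "e r = (of_bool (r = i) + of_bool (r = j) + of_bool (r = k) + of_bool (r = l) :: nat)" for r
  have "(\<Prod>r<n. M (e r)) = ?R"
  proof (cases "\<exists>r\<in>{i, j, k, l}. e r = 1 \<or> e r = 3")
    case True
    then have "\<exists>r\<in>{..<n}. M (e r) = 0"
      using assms by (metis insertE singletonD lessThan_iff)
    then have "(\<Prod>r<n. M (e r)) = 0"
      by (intro prod_zero) auto
    moreover have "?R = 0"
      by (rule isserlis_odd[OF e_def True])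
    ultimately show ?thesis by (simp only:)
  next
    case False
    show ?thesis
    proof (cases "i = j \<and> j = k \<and> k = l")
      case True
      then have "(\<Prod>r<n. M (e r)) = (\<Prod>r<n. if r = i then 3 else 1)"
        using M by (intro prod.cong) (auto simp: e_def numeral_eq_Suc)
      moreover have "?R = 3" using True by simp
      moreover have "(\<Prod>r<n. if r = i then 3 else (1::real)) = 3" using assms by simp
      ultimately show ?thesis by (simp only:)
    next
      case neq: False
      have "M (e r) = 1" for r
      proof -
        have "e r \<le> 4" by (simp add: e_def of_bool_def)
        moreover have "e r \<noteq> 4"
        proof
          assume "e r = 4"
          then have "r = i \<and> r = j \<and> r = k \<and> r = l" by (simp add: e_def of_bool_def split: if_splits)
          then show False using neq by metis
        qed
        moreover have "e r \<noteq> 1 \<and> e r \<noteq> 3"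
        proof (cases "r \<in> {i, j, k, l}")
          case True
          then show ?thesis using False by blast
        next
          case False
          then show ?thesis by (simp add: e_def)
        qed
        ultimately have "e r = 0 \<or> e r = 2" by linarith
        then show ?thesis using M by auto
      qed
      moreover have "?R = 1"
        by (rule isserlis_even[OF e_def False neq])
      ultimately show ?thesis by (simp only: prod.neutral_const)
    qed
  qed
  then show ?thesis by (simp only: e_def)
qed

lemma std_gaussian_monomial:
  fixes i j k l n :: nat
  assumes "i < n" "j < n" "k < n" "l < n"
  shows "has_bochner_integral (Pi\<^sub>M {..<n} (\<lambda>_. lborel))
     (\<lambda>x. (\<Prod>r<n. std_normal_density (x r)) * (x i * x j * (x k * x l)))
     (of_bool (i = j \<and> k = l) + of_bool (i = k \<and> j = l) + of_bool (i = l \<and> j = k))"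
proof -
  interpret product_sigma_finite "\<lambda>_::nat. lborel :: real measure" ..
  define e where "e r = (of_bool (r = i) + of_bool (r = j) + of_bool (r = k) + of_bool (r = l) :: nat)" for r
  have single: "(\<Prod>r<n. x r ^ of_bool (r = q)) = x q" if "q < n" for x :: "nat \<Rightarrow> real" and q :: nat
  proof -
    have "(\<Prod>r<n. x r ^ of_bool (r = q)) = (\<Prod>r<n. if r = q then x r else 1)"
      by (intro prod.cong) auto
    then show ?thesis using that by simp
  qed
  have eq: "(\<Prod>r<n. std_normal_density (x r)) * (x i * x j * (x k * x l)) = (\<Prod>r<n. std_normal_density (x r) * x r ^ e r)" for x
    using assms by (simp add: e_def prod.distrib power_add single mult_ac)
  have "integrable (Pi\<^sub>M {..<n} (\<lambda>_. lborel)) (\<lambda>x. \<Prod>r<n. std_normal_density (x r) * x r ^ e r)"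
    by (rule product_integrable_prod) (auto intro: integrable_std_normal_moment)
  moreover have "(\<integral>x. (\<Prod>r<n. std_normal_density (x r) * x r ^ e r) \<partial>Pi\<^sub>M {..<n} (\<lambda>_. lborel))
     = (\<Prod>r<n. integral\<^sup>L lborel (\<lambda>x. std_normal_density x * x ^ e r))"
    by (rule product_integral_prod) (auto intro: integrable_std_normal_moment)
  moreover have "\<dots> = of_bool (i = j \<and> k = l) + of_bool (i = k \<and> j = l) + of_bool (i = l \<and> j = k)"
    unfolding e_def
    by (rule isserlis_exponents[OF std_normal_moment_small assms])
  ultimately show ?thesis
    unfolding eq has_bochner_integral_iff by (simp only: simp_thms)
qed

lemma std_gaussian_density_vec:
  "(\<Prod>r<n. std_normal_density (x r)) = exp (- (vec n x \<bullet> vec n x) / 2) / sqrt ((2 * pi) ^ n)"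
proof -
  have "(\<Prod>r<n. std_normal_density (x r)) = (\<Prod>r<n. exp (- (x r)\<^sup>2 / 2)) / sqrt (2 * pi) ^ n"
    unfolding std_normal_density_def prod.distrib by (simp add: power_divide)
  also have "(\<Prod>r<n. exp (- (x r)\<^sup>2 / 2)) = exp (\<Sum>r<n. - (x r)\<^sup>2 / 2)"
    by (simp add: exp_sum)
  also have "(\<Sum>r<n. - (x r)\<^sup>2 / 2) = - (vec n x \<bullet> vec n x) / 2"
    by (simp add: scalar_prod_def lessThan_atLeast0 power2_eq_square sum_negf flip: sum_divide_distrib)
  finally show ?thesis unfolding real_sqrt_power .
qed

lemma std_gaussian_total:
  "(\<integral>\<^sup>+ v. ennreal (exp (- (v \<bullet> v) / 2)) \<partial>lborel_vec n) = ennreal (sqrt ((2 * pi) ^ n))"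
proof -
  interpret product_sigma_finite "\<lambda>_::nat. lborel :: real measure" ..
  have *: "exp (- (vec n x \<bullet> vec n x) / 2) = sqrt ((2 * pi) ^ n) * (\<Prod>r<n. std_normal_density (x r))" for x
    by (simp add: std_gaussian_density_vec)
  have "(\<lambda>v. ennreal (exp (- (v \<bullet> v) / 2))) \<in> borel_measurable (lborel_vec n)"
    using measurable_scalar_prod[OF measurable_ident_sets[OF refl] measurable_ident_sets[OF refl], of n] by measurable
  from nn_integral_lborel_vec[OF this]
  have "(\<integral>\<^sup>+ v. ennreal (exp (- (v \<bullet> v) / 2)) \<partial>lborel_vec n) =
      (\<integral>\<^sup>+ x. ennreal (sqrt ((2 * pi) ^ n)) * (\<Prod>r<n. ennreal (std_normal_density (x r))) \<partial>Pi\<^sub>M {..<n} (\<lambda>_. lborel))"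
    unfolding * by (simp add: ennreal_mult prod_nonneg prod_ennreal)
  also have "\<dots> = ennreal (sqrt ((2 * pi) ^ n)) * (\<integral>\<^sup>+ x. (\<Prod>r<n. ennreal (std_normal_density (x r))) \<partial>Pi\<^sub>M {..<n} (\<lambda>_. lborel))"
    by (rule nn_integral_cmult) measurable
  also have "(\<integral>\<^sup>+ x. (\<Prod>r<n. ennreal (std_normal_density (x r))) \<partial>Pi\<^sub>M {..<n} (\<lambda>_. lborel)) = (\<Prod>r<n. \<integral>\<^sup>+ x. ennreal (std_normal_density x) \<partial>lborel)"
    by (rule product_nn_integral_prod) auto
  also have "(\<integral>\<^sup>+ x. ennreal (std_normal_density x) \<partial>lborel) = 1"
    using std_normal_moment_even[of 0] by (subst nn_integral_eq_integral) (auto simp: has_bochner_integral_iff)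
  finally show ?thesis by simp
qed

text \<open>Expanding the square gives a fourfold sum of fourth moments. The three pairings contribute
  \<open>(tr A)\<^sup>2\<close>, \<open>tr (A A\<^sup>T)\<close> and \<open>tr (A A)\<close>.\<close>

lemma std_gaussian_quadratic_form_square:
  assumes A: "A \<in> carrier_mat n n" and sym: "A\<^sup>T = A"
  shows "(\<integral>\<^sup>+ v. ennreal (exp (- (v \<bullet> v) / 2) * (qform A v)\<^sup>2) \<partial>lborel_vec n) =
    ennreal (((mtrace A)\<^sup>2 + 2 * mtrace (A * A)) * sqrt ((2 * pi) ^ n))"
proof -
  let ?P = "Pi\<^sub>M {..<n} (\<lambda>_. lborel :: real measure)"
  let ?f = "\<lambda>x. \<Prod>r<n. std_normal_density (x r)"
  let ?\<delta> = "\<lambda>i j k l. of_bool (i = j \<and> k = l) + of_bool (i = k \<and> j = l) + of_bool (i = l \<and> j = k) :: real"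
  have symi: "A $$ (i, j) = A $$ (j, i)" if "i < n" "j < n" for i j
    using sym that A by (metis index_transpose_mat(1) carrier_matD)
  have sq: "?f x * (qform A (vec n x))\<^sup>2 =
      (\<Sum>i<n. \<Sum>j<n. \<Sum>k<n. \<Sum>l<n. (A $$ (i, j) * A $$ (k, l)) * (?f x * (x i * x j * (x k * x l))))" for x
  proof -
    have "(\<Sum>i<n. \<Sum>j<n. u i j)\<^sup>2 = (\<Sum>i<n. \<Sum>j<n. \<Sum>k<n. \<Sum>l<n. u i j * u k l)" for u :: "nat \<Rightarrow> nat \<Rightarrow> real"
      unfolding power2_eq_square sum_distrib_right unfolding sum_distrib_left ..
    note sq = this
    have "qform A (vec n x) = (\<Sum>i<n. \<Sum>j<n. A $$ (i, j) * (x i * x j))"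
      by (simp add: qform_eq_sum[OF A])
    then have "?f x * (qform A (vec n x))\<^sup>2 =
      (\<Sum>i<n. \<Sum>j<n. \<Sum>k<n. \<Sum>l<n. ?f x * (A $$ (i, j) * (x i * x j) * (A $$ (k, l) * (x k * x l))))"
      by (simp only: sq sum_distrib_left)
    also have "\<dots> = (\<Sum>i<n. \<Sum>j<n. \<Sum>k<n. \<Sum>l<n. (A $$ (i, j) * A $$ (k, l)) * (?f x * (x i * x j * (x k * x l))))"
      by (intro sum.cong refl) (simp only: mult_ac)
    finally show ?thesis .
  qed
  define T where "T = (\<Sum>i<n. \<Sum>j<n. \<Sum>k<n. \<Sum>l<n. (A $$ (i, j) * A $$ (k, l)) * ?\<delta> i j k l)"
  have intT: "has_bochner_integral ?P (\<lambda>x. \<Sum>i<n. \<Sum>j<n. \<Sum>k<n. \<Sum>l<n. (A $$ (i, j) * A $$ (k, l)) * (?f x * (x i * x j * (x k * x l)))) T"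
    unfolding T_def
    by (rule has_bochner_integral_sum, rule has_bochner_integral_sum, rule has_bochner_integral_sum,
        rule has_bochner_integral_sum, rule has_bochner_integral_mult_right, rule std_gaussian_monomial) auto
  have Teq: "T = (mtrace A)\<^sup>2 + 2 * mtrace (A * A)"
  proof -
    have delta: "(\<Sum>l<n. of_bool (k = l) * f l) = f k" if "k < n" for k and f :: "nat \<Rightarrow> real"
    proof -
      have "(\<Sum>l<n. of_bool (k = l) * f l) = (\<Sum>l<n. if k = l then f l else 0)"
        by (rule sum.cong) auto
      then show ?thesis using that by simp
    qed
    have tr: "mtrace A = (\<Sum>i<n. A $$ (i, i))" using A by (simp add: mtrace_def)
    have trA: "mtrace (A * A) = (\<Sum>i<n. \<Sum>j<n. A $$ (i, j) * A $$ (j, i))"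
      using A by (simp add: mtrace_def scalar_prod_def lessThan_atLeast0)
    have inner: "(\<Sum>l<n. (A $$ (i, j) * A $$ (k, l)) * ?\<delta> i j k l) =
        of_bool (i = j) * (A $$ (i, j) * A $$ (k, k)) + of_bool (i = k) * (A $$ (i, j) * A $$ (k, j)) +
        of_bool (j = k) * (A $$ (i, j) * A $$ (k, i))" if ij: "i < n" "j < n" "k < n" for i j k
    proof -
      have "(\<Sum>l<n. (A $$ (i, j) * A $$ (k, l)) * ?\<delta> i j k l) =
         (\<Sum>l<n. of_bool (k = l) * (of_bool (i = j) * (A $$ (i, j) * A $$ (k, l)))) +
         (\<Sum>l<n. of_bool (j = l) * (of_bool (i = k) * (A $$ (i, j) * A $$ (k, l)))) +
         (\<Sum>l<n. of_bool (i = l) * (of_bool (j = k) * (A $$ (i, j) * A $$ (k, l))))"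
        unfolding sum.distrib[symmetric] of_bool_conj by (intro sum.cong refl) (simp only: algebra_simps)
      then show ?thesis by (simp only: delta ij)
    qed
    have "(\<Sum>k<n. \<Sum>l<n. (A $$ (i, j) * A $$ (k, l)) * ?\<delta> i j k l) =
        of_bool (i = j) * (A $$ (i, j) * mtrace A) + 2 * (A $$ (i, j) * A $$ (j, i))"
      if ij: "i < n" "j < n" for i j
    proof -
      have "(\<Sum>k<n. \<Sum>l<n. (A $$ (i, j) * A $$ (k, l)) * ?\<delta> i j k l) =
          (\<Sum>k<n. of_bool (i = j) * (A $$ (i, j) * A $$ (k, k))) + (\<Sum>k<n. of_bool (i = k) * (A $$ (i, j) * A $$ (k, j))) +
          (\<Sum>k<n. of_bool (j = k) * (A $$ (i, j) * A $$ (k, i)))"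
        unfolding sum.distrib[symmetric] by (intro sum.cong refl) (simp only: inner ij lessThan_iff)
      also have "(\<Sum>k<n. of_bool (i = j) * (A $$ (i, j) * A $$ (k, k))) = of_bool (i = j) * (A $$ (i, j) * mtrace A)"
        unfolding tr by (simp only: sum_distrib_left)
      finally show ?thesis
        unfolding delta[OF ij(1)] delta[OF ij(2)] by (simp only: mult_2 add.assoc symi[OF ij])
    qed
    then have "T = (\<Sum>i<n. \<Sum>j<n. of_bool (i = j) * (A $$ (i, j) * mtrace A) + 2 * (A $$ (i, j) * A $$ (j, i)))"
      unfolding T_def by (intro sum.cong refl) (simp only: lessThan_iff)
    also have "\<dots> = (\<Sum>i<n. A $$ (i, i) * mtrace A) + 2 * mtrace (A * A)"
      unfolding sum.distrib trA sum_distrib_left by (simp add: delta)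
    also have "\<dots> = (mtrace A)\<^sup>2 + 2 * mtrace (A * A)"
      by (simp add: tr power2_eq_square sum_distrib_right)
    finally show ?thesis .
  qed
  have int: "has_bochner_integral ?P (\<lambda>x. ?f x * (qform A (vec n x))\<^sup>2) ((mtrace A)\<^sup>2 + 2 * mtrace (A * A))"
    unfolding sq using intT unfolding Teq .
  have *: "exp (- (vec n x \<bullet> vec n x) / 2) * (qform A (vec n x))\<^sup>2 = (?f x * (qform A (vec n x))\<^sup>2) * sqrt ((2 * pi) ^ n)" for x
    by (simp add: std_gaussian_density_vec)
  have "(\<lambda>v. ennreal (exp (- (v \<bullet> v) / 2) * (qform A v)\<^sup>2)) \<in> borel_measurable (lborel_vec n)"
    using measurable_scalar_prod[OF measurable_ident_sets[OF refl] measurable_ident_sets[OF refl], of n]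
      measurable_qform_id[OF A] by measurable
  from nn_integral_lborel_vec[OF this]
  have "(\<integral>\<^sup>+ v. ennreal (exp (- (v \<bullet> v) / 2) * (qform A v)\<^sup>2) \<partial>lborel_vec n) =
     (\<integral>\<^sup>+ x. ennreal ((?f x * (qform A (vec n x))\<^sup>2) * sqrt ((2 * pi) ^ n)) \<partial>?P)"
    unfolding * .
  also have "\<dots> = ennreal (((mtrace A)\<^sup>2 + 2 * mtrace (A * A)) * sqrt ((2 * pi) ^ n))"
    using has_bochner_integral_mult_left[OF int, of "sqrt ((2 * pi) ^ n)"]
    by (subst nn_integral_eq_integral) (auto simp: has_bochner_integral_iff prod_nonneg)
  finally show ?thesis .
qed

text \<open>The unnormalised density of the centred normal distribution with precision matrix \<open>A\<close>.\<close>

abbreviation gaussian_weight :: "real mat \<Rightarrow> real vec \<Rightarrow> ennreal" where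
  "gaussian_weight A v \<equiv> ennreal (exp (- qform A v / 2))"

text \<open>The substitution \<open>v = L x\<close> turns the quadratic form of the precision matrix \<open>V\<^sup>-\<^sup>1\<close> into \<open>x \<bullet> x\<close>.\<close>

lemma gaussian_change_of_variables:
  assumes L: "scales_lebesgue n L" and LV: "L * L\<^sup>T = V"
    and La: "La \<in> carrier_mat n n" and LaV: "La * V = 1\<^sub>m n"
    and g: "g \<in> borel_measurable (lborel_vec n)"
  shows "(\<integral>\<^sup>+ v. gaussian_weight La v * g v \<partial>lborel_vec n) =
     ennreal (det L) * (\<integral>\<^sup>+ v. ennreal (exp (- (v \<bullet> v) / 2)) * g (L *\<^sub>v v) \<partial>lborel_vec n)"
proof -
  have Lc: "L \<in> carrier_mat n n" using L by (simp add: scales_lebesgue_def)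
  have "(La * L) * L\<^sup>T = 1\<^sub>m n" using LaV LV La Lc by (simp add: assoc_mult_mat[of _ n n _ n _ n])
  from mat_mult_left_right_inverse[OF _ _ this] have "L\<^sup>T * La * L = 1\<^sub>m n"
    using La Lc by (simp add: assoc_mult_mat[of _ n n _ n _ n])
  then have q: "qform La (L *\<^sub>v v) = v \<bullet> v" if "v \<in> carrier_vec n" for v
    using qform_congruence[OF La Lc that] that by (simp add: qform_def)
  have "(\<lambda>v. gaussian_weight La v * g v) \<in> borel_measurable (lborel_vec n)"
    using measurable_qform_id[OF La] g by measurable
  then have "(\<integral>\<^sup>+ v. gaussian_weight La v * g v \<partial>lborel_vec n) =
     ennreal (det L) * (\<integral>\<^sup>+ v. ennreal (exp (- qform La (L *\<^sub>v v) / 2)) * g (L *\<^sub>v v) \<partial>lborel_vec n)"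
    using L by (auto simp: scales_lebesgue_def)
  also have "(\<integral>\<^sup>+ v. ennreal (exp (- qform La (L *\<^sub>v v) / 2)) * g (L *\<^sub>v v) \<partial>lborel_vec n) =
     (\<integral>\<^sup>+ v. ennreal (exp (- (v \<bullet> v) / 2)) * g (L *\<^sub>v v) \<partial>lborel_vec n)"
    by (rule nn_integral_cong) (simp add: space_lborel_vec q)
  finally show ?thesis .
qed

lemma gaussian_total:
  assumes V: "positive_definite n V" and La: "La \<in> carrier_mat n n" and LaV: "La * V = 1\<^sub>m n"
  shows "(\<integral>\<^sup>+ v. gaussian_weight La v \<partial>lborel_vec n) = ennreal (sqrt ((2 * pi) ^ n * det V))"
    and "0 < det V"
proof -
  obtain L where L: "scales_lebesgue n L" and LV: "L * L\<^sup>T = V"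
    using positive_definite_cholesky[OF V] by blast
  have Lc: "L \<in> carrier_mat n n" and dL: "0 < det L" using L by (auto simp: scales_lebesgue_def)
  have detV: "det V = (det L)\<^sup>2"
    using det_mult[OF Lc, of "L\<^sup>T"] det_transpose[OF Lc] Lc LV by (simp add: power2_eq_square)
  then show "0 < det V" using dL by simp
  from gaussian_change_of_variables[OF L LV La LaV, of "\<lambda>_. 1"] dL
  show "(\<integral>\<^sup>+ v. gaussian_weight La v \<partial>lborel_vec n) = ennreal (sqrt ((2 * pi) ^ n * det V))"
    unfolding std_gaussian_total mult_1_right
    by (simp add: detV real_sqrt_mult mult.commute flip: ennreal_mult)
qed

text \<open>The substitution \<open>v = L x\<close> replaces \<open>A\<close> by \<open>L\<^sup>T A L\<close>, which is symmetric and has the traces of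
  \<open>A V\<close> by cyclicity.\<close>

lemma cholesky_congruence:
  assumes Lc: "L \<in> carrier_mat n n" and LV: "L * L\<^sup>T = V"
    and A: "A \<in> carrier_mat n n" and sym: "A\<^sup>T = A"
  shows "L\<^sup>T * A * L \<in> carrier_mat n n"
    and "transpose_mat (L\<^sup>T * A * L) = L\<^sup>T * A * L"
    and "mtrace (L\<^sup>T * A * L) = mtrace (A * V)"
    and "mtrace (L\<^sup>T * A * L * (L\<^sup>T * A * L)) = mtrace (A * V * (A * V))"
proof -
  show "L\<^sup>T * A * L \<in> carrier_mat n n" using A Lc by simp
  show "transpose_mat (L\<^sup>T * A * L) = L\<^sup>T * A * L"
    using A Lc sym by (simp add: transpose_mult[of _ n n _ n] assoc_mult_mat[of _ n n _ n _ n])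
  show "mtrace (L\<^sup>T * A * L) = mtrace (A * V)"
    using mtrace_mult_comm[of "L\<^sup>T" n n "A * L"] A Lc
    by (simp add: assoc_mult_mat[of _ n n _ n _ n] flip: LV)
  show "mtrace (L\<^sup>T * A * L * (L\<^sup>T * A * L)) = mtrace (A * V * (A * V))"
    using mtrace_mult_comm[of "L\<^sup>T" n n "A * (L * (L\<^sup>T * (A * L)))"] A Lc
    by (simp add: assoc_mult_mat[of _ n n _ n _ n] flip: LV)
qed

lemma gaussian_quadratic_form_square:
  assumes V: "positive_definite n V" and La: "La \<in> carrier_mat n n" and LaV: "La * V = 1\<^sub>m n"
    and A: "A \<in> carrier_mat n n" and sym: "A\<^sup>T = A"
  shows "(\<integral>\<^sup>+ v. gaussian_weight La v * ennreal ((qform A v)\<^sup>2) \<partial>lborel_vec n) =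
     ennreal ((mtrace (A * V))\<^sup>2 + 2 * mtrace (A * V * (A * V))) *
       (\<integral>\<^sup>+ v. gaussian_weight La v \<partial>lborel_vec n)"
proof -
  obtain L where L: "scales_lebesgue n L" and LV: "L * L\<^sup>T = V"
    using positive_definite_cholesky[OF V] by blast
  have Lc: "L \<in> carrier_mat n n" using L by (auto simp: scales_lebesgue_def)
  define B where "B = L\<^sup>T * A * L"
  have total: "(\<integral>\<^sup>+ v. gaussian_weight La v \<partial>lborel_vec n) = ennreal (det L) * ennreal (sqrt ((2 * pi) ^ n))"
    using gaussian_change_of_variables[OF L LV La LaV borel_measurable_const[of 1]] by (simp only: mult_1_right std_gaussian_total)
  note B = cholesky_congruence[OF Lc LV A sym, folded B_def]
  have "(\<lambda>v. ennreal ((qform A v)\<^sup>2)) \<in> borel_measurable (lborel_vec n)"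
    using measurable_qform_id[OF A] by measurable
  from gaussian_change_of_variables[OF L LV La LaV this]
  have "(\<integral>\<^sup>+ v. gaussian_weight La v * ennreal ((qform A v)\<^sup>2) \<partial>lborel_vec n) =
     ennreal (det L) * (\<integral>\<^sup>+ v. ennreal (exp (- (v \<bullet> v) / 2)) * ennreal ((qform A (L *\<^sub>v v))\<^sup>2) \<partial>lborel_vec n)" .
  also have "(\<integral>\<^sup>+ v. ennreal (exp (- (v \<bullet> v) / 2)) * ennreal ((qform A (L *\<^sub>v v))\<^sup>2) \<partial>lborel_vec n) =
     (\<integral>\<^sup>+ v. ennreal (exp (- (v \<bullet> v) / 2) * (qform B v)\<^sup>2) \<partial>lborel_vec n)"
    by (rule nn_integral_cong) (simp add: space_lborel_vec B_def qform_congruence[OF A Lc] ennreal_mult)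
  also have "\<dots> = ennreal (((mtrace B)\<^sup>2 + 2 * mtrace (B * B)) * sqrt ((2 * pi) ^ n))"
    by (rule std_gaussian_quadratic_form_square[OF B(1,2)])
  also have "\<dots> = ennreal ((mtrace B)\<^sup>2 + 2 * mtrace (B * B)) * ennreal (sqrt ((2 * pi) ^ n))"
    by (rule ennreal_mult'') simp
  finally show ?thesis
    unfolding total B(3,4) by (simp only: mult_ac)
qed

section \<open>Ratios of quadratic forms of Gaussian vectors\<close>

text \<open>Represents \<open>1 / q\<^sup>2\<close> as a mixture of exponentials of \<open>- q\<close>.\<close>

lemma nn_integral_power_times_exp_scaled:
  assumes q: "0 < (q::real)"
  shows "(\<integral>\<^sup>+ t. ennreal (t * exp (- t * q)) * indicator {0..} t \<partial>lborel) = ennreal (1 / q\<^sup>2)"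
proof -
  have "1 = (\<integral>\<^sup>+ x. ennreal (x ^ 1 * exp (- x)) * indicator {0..} x \<partial>lborel)"
    using nn_intergal_power_times_exp_Ici[of 1] by simp
  also have "\<dots> = ennreal q * (\<integral>\<^sup>+ t. ennreal ((0 + q * t) ^ 1 * exp (- (0 + q * t))) * indicator {0..} (0 + q * t) \<partial>lborel)"
    using q by (subst nn_integral_real_affine[where c = q and t = 0]) auto
  also have "(\<integral>\<^sup>+ t. ennreal ((0 + q * t) ^ 1 * exp (- (0 + q * t))) * indicator {0..} (0 + q * t) \<partial>lborel)
     = (\<integral>\<^sup>+ t. ennreal q * (ennreal (t * exp (- t * q)) * indicator {0..} t) \<partial>lborel)"
    using q by (intro nn_integral_cong) (auto simp: indicator_def ennreal_mult' zero_le_mult_iff mult_ac split: if_splits)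
  also have "\<dots> = ennreal q * (\<integral>\<^sup>+ t. ennreal (t * exp (- t * q)) * indicator {0..} t \<partial>lborel)"
    by (rule nn_integral_cmult) measurable
  finally have "ennreal q * (ennreal q * (\<integral>\<^sup>+ t. ennreal (t * exp (- t * q)) * indicator {0..} t \<partial>lborel)) = 1"
    by simp
  then have "ennreal (1 / q\<^sup>2) * (ennreal q * (ennreal q * (\<integral>\<^sup>+ t. ennreal (t * exp (- t * q)) * indicator {0..} t \<partial>lborel))) = ennreal (1 / q\<^sup>2)"
    by simp
  moreover have "ennreal (1 / q\<^sup>2) * (ennreal q * (ennreal q * x)) = x" for x
  proof -
    have "ennreal (1 / q\<^sup>2) * ennreal q * ennreal q = ennreal (1 / q\<^sup>2 * q * q)"
      using q by (simp only: ennreal_mult'' less_imp_le)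
    then have "ennreal (1 / q\<^sup>2) * (ennreal q * (ennreal q * x)) = ennreal (1 / q\<^sup>2 * q * q) * x"
      by (simp only: mult.assoc[symmetric])
    also have "1 / q\<^sup>2 * q * q = 1" using q by (simp add: power2_eq_square)
    finally show ?thesis by simp
  qed
  ultimately show ?thesis by simp
qed

lemma mtrace_square_nonneg:
  assumes "C \<in> carrier_mat n n" "C\<^sup>T = C"
  shows "0 \<le> mtrace (C * C)"
proof -
  have "C $$ (i, j) = C $$ (j, i)" if "i < n" "j < n" for i j
    using assms that by (metis index_transpose_mat(1) carrier_matD)
  then have "mtrace (C * C) = (\<Sum>i<n. \<Sum>j<n. C $$ (i, j) * C $$ (i, j))"
    using assms by (simp add: mtrace_def scalar_prod_def lessThan_atLeast0)
  also have "0 \<le> \<dots>" by (intro sum_nonneg) simp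
  finally show ?thesis .
qed

lemma mtrace_congruence_square_nonneg:
  assumes V: "positive_definite n V" and A: "A \<in> carrier_mat n n" and sym: "A\<^sup>T = A"
  shows "0 \<le> mtrace (A * V * (A * V))"
proof -
  obtain L where L: "scales_lebesgue n L" and LV: "L * L\<^sup>T = V"
    using positive_definite_cholesky[OF V] by blast
  have Lc: "L \<in> carrier_mat n n" using L by (auto simp: scales_lebesgue_def)
  note B = cholesky_congruence[OF Lc LV A sym]
  show ?thesis using mtrace_square_nonneg[OF B(1,2)] B(4) by simp
qed

text \<open>The hypothesis \<open>R * V * R = R\<close> turns the quadratic form of \<open>R\<close> into that of \<open>V\<close> at \<open>R v\<close>,
  which yields its sign and its zeros.\<close>

lemma qform_projection:
  assumes V: "positive_definite n V" and R: "R \<in> carrier_mat n n" "R\<^sup>T = R" "R * V * R = R"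
    and v: "v \<in> carrier_vec n"
  shows "qform R v = qform V (R *\<^sub>v v)" "0 \<le> qform R v" "qform R v = 0 \<longleftrightarrow> R *\<^sub>v v = 0\<^sub>v n"
proof -
  have Vc: "V \<in> carrier_mat n n" using V by (simp add: positive_definite_def)
  show eq: "qform R v = qform V (R *\<^sub>v v)"
    using qform_congruence[OF Vc R(1) v] R by simp
  have "qform V (0\<^sub>v n) = 0"
    using Vc by (simp add: qform_def scalar_prod_left_zero[OF mult_mat_vec_carrier[OF Vc zero_carrier_vec]])
  moreover have "R *\<^sub>v v \<in> carrier_vec n" using R v by simp
  ultimately show "0 \<le> qform R v" "qform R v = 0 \<longleftrightarrow> R *\<^sub>v v = 0\<^sub>v n"
    using V unfolding eq by (auto simp: positive_definite_def qform_def less_imp_le dest: bspec)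
qed

lemma AE_qform_projection_pos:
  assumes V: "positive_definite n V" and R: "R \<in> carrier_mat n n" "R\<^sup>T = R" "R * V * R = R"
    and nz: "R \<noteq> 0\<^sub>m n n"
  shows "AE v in lborel_vec n. 0 < qform R v"
proof -
  obtain i j where ij: "i < n" "j < n" "R $$ (i, j) \<noteq> 0"
    using nz R(1) by (metis eq_matI carrier_matD index_zero_mat)
  have "row R i \<noteq> 0\<^sub>v n"
  proof
    assume "row R i = 0\<^sub>v n"
    then have "row R i $ j = 0" using ij by simp
    then show False using ij R by simp
  qed
  from AE_lborel_vec_scalar_prod_nonzero[OF row_carrier_vec[OF _ R(1)] this] ij
  have "AE v in lborel_vec n. row R i \<bullet> v \<noteq> 0" by simp
  then show ?thesis
  proof (rule AE_mp, intro AE_I2 impI)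
    fix v assume "v \<in> space (lborel_vec n)" and nz: "row R i \<bullet> v \<noteq> 0"
    then have v: "v \<in> carrier_vec n" by (simp add: space_lborel_vec)
    have "(R *\<^sub>v v) $ i \<noteq> 0" using nz ij R by simp
    then have "R *\<^sub>v v \<noteq> 0\<^sub>v n" using ij by auto
    then show "0 < qform R v"
      using qform_projection[OF V R v] by (metis less_eq_real_def)
  qed
qed

text \<open>Since \<open>R V\<close> is idempotent, the inverse of \<open>V\<^sup>-\<^sup>1 + 2 t R\<close> has the form \<open>V + a V R V\<close>, where \<open>a\<close>
  solves the scalar equation \<open>2 t + a + 2 t a = 0\<close>.\<close>

lemma perturbed_precision_inverse:
  assumes V: "positive_definite n V" and La: "La \<in> carrier_mat n n" and LaV: "La * V = 1\<^sub>m n"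
    and R: "R \<in> carrier_mat n n" "R\<^sup>T = R" "R * V * R = R" and t: "0 \<le> t"
  shows "(La + (2 * t) \<cdot>\<^sub>m R) * (V + (- (2 * t / (1 + 2 * t))) \<cdot>\<^sub>m (V * R * V)) = 1\<^sub>m n"
    and "positive_definite n (V + (- (2 * t / (1 + 2 * t))) \<cdot>\<^sub>m (V * R * V))"
proof -
  define a where "a = - (2 * t / (1 + 2 * t))"
  have a: "2 * t + a + 2 * t * a = 0" using t by (simp add: a_def field_simps)
  have Vc: "V \<in> carrier_mat n n" using V by (simp add: positive_definite_def)
  have RV: "R * V \<in> carrier_mat n n" using R Vc by simp
  have 1: "La * (V * R * V) = R * V"
  proof -
    have "La * (V * R * V) = (La * V) * R * V" using La Vc R(1) by (simp add: assoc_mult_mat[of _ n n _ n _ n])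
    then show ?thesis using LaV R by simp
  qed
  have 2: "R * (V * R * V) = R * V"
  proof -
    have "R * (V * R * V) = (R * V * R) * V" using Vc R(1) by (simp add: assoc_mult_mat[of _ n n _ n _ n])
    then show ?thesis using R by simp
  qed
  have VRV: "V * R * V \<in> carrier_mat n n" using Vc R by simp
  have "(La + (2 * t) \<cdot>\<^sub>m R) * (V + a \<cdot>\<^sub>m (V * R * V)) =
      (La * V + (2 * t) \<cdot>\<^sub>m (R * V)) + (a \<cdot>\<^sub>m (La * (V * R * V)) + a \<cdot>\<^sub>m ((2 * t) \<cdot>\<^sub>m (R * (V * R * V))))"
    using La Vc R VRV
    by (simp add: add_mult_distrib_mat[of _ n n _ _ n] mult_add_distrib_mat[of _ n n _ n]
        mult_smult_distrib[of _ n n _ n] mult_smult_assoc_mat[of _ n n _ n] add_smult_distrib_left_mat[of _ n n])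
  also have "\<dots> = 1\<^sub>m n"
    unfolding 1 2 LaV
  proof -
    have "x + 2 * t * r + (a * r + a * (2 * t * r)) = x" for x r :: real
    proof -
      have "x + 2 * t * r + (a * r + a * (2 * t * r)) = x + (2 * t + a + 2 * t * a) * r"
        by (simp add: algebra_simps)
      then show ?thesis by (simp add: a)
    qed
    then have "(X + (2 * t) \<cdot>\<^sub>m Y) + (a \<cdot>\<^sub>m Y + a \<cdot>\<^sub>m ((2 * t) \<cdot>\<^sub>m Y)) = X"
      if "X \<in> carrier_mat n n" "Y \<in> carrier_mat n n" for X Y
      using that by (intro eq_matI) auto
    from this[OF one_carrier_mat RV]
    show "(1\<^sub>m n + (2 * t) \<cdot>\<^sub>m (R * V)) + (a \<cdot>\<^sub>m (R * V) + a \<cdot>\<^sub>m ((2 * t) \<cdot>\<^sub>m (R * V))) = 1\<^sub>m n" .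
  qed
  finally show eq: "(La + (2 * t) \<cdot>\<^sub>m R) * (V + (- (2 * t / (1 + 2 * t))) \<cdot>\<^sub>m (V * R * V)) = 1\<^sub>m n"
    unfolding a_def .
  have VLa: "V * La = 1\<^sub>m n" by (rule mat_mult_left_right_inverse[OF La Vc LaV])
  have pdLa: "positive_definite n La" by (rule positive_definite_inverse[OF V La VLa])
  have "positive_definite n (La + (2 * t) \<cdot>\<^sub>m R)"
    unfolding positive_definite_def
  proof (intro conjI ballI impI)
    show "La + (2 * t) \<cdot>\<^sub>m R \<in> carrier_mat n n" using La R by simp
    show "transpose_mat (La + (2 * t) \<cdot>\<^sub>m R) = La + (2 * t) \<cdot>\<^sub>m R"
    proof -
      have "transpose_mat ((2 * t) \<cdot>\<^sub>m R) = (2 * t) \<cdot>\<^sub>m R\<^sup>T" by (rule eq_matI) auto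
      then show ?thesis using pdLa La R by (simp add: transpose_add[of _ n n] positive_definite_def)
    qed
    fix v :: "real vec" assume v: "v \<in> carrier_vec n" "v \<noteq> 0\<^sub>v n"
    have "0 < qform La v" using pdLa v by (simp add: positive_definite_def qform_def)
    then have "0 < qform (La + (2 * t) \<cdot>\<^sub>m R) v"
      using qform_projection(2)[OF V R v(1)] t La R v
      by (simp add: qform_add[of _ n] qform_smult[of _ n] add_pos_nonneg)
    then show "0 < v \<bullet> ((La + (2 * t) \<cdot>\<^sub>m R) *\<^sub>v v)" by (simp add: qform_def)
  qed
  then show "positive_definite n (V + (- (2 * t / (1 + 2 * t))) \<cdot>\<^sub>m (V * R * V))"
    by (rule positive_definite_inverse[OF _ _ eq]) (use Vc VRV in simp)
qed

text \<open>Write \<open>1 / q\<^sup>2 = \<integral> t exp (- t q) dt\<close> for \<open>q = qform R v\<close> and exchange the integrals. The factor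
  \<open>exp (- t q)\<close> changes the precision matrix to \<open>La + 2 t R\<close>, and \<open>A V R = A\<close> implies that \<open>A\<close>
  times the new covariance matrix is \<open>A V / (1 + 2 t)\<close>. So the fourth moment formula gives
  the same expression in \<open>A V\<close> for every \<open>t\<close>, up to the factor \<open>(1 + 2 t)\<^sup>-\<^sup>2\<close>, and \<open>A\<close> drops out of
  what remains to be integrated.\<close>

lemma gaussian_ratio_second_moment:
  fixes K :: ennreal
  assumes V: "positive_definite n V" and La: "La \<in> carrier_mat n n" and LaV: "La * V = 1\<^sub>m n"
    and R: "R \<in> carrier_mat n n" "R\<^sup>T = R" "R * V * R = R" and nz: "R \<noteq> 0\<^sub>m n n"
    and A: "A \<in> carrier_mat n n" "A\<^sup>T = A" "A * V * R = A"
  defines "K \<equiv> \<integral>\<^sup>+ t. ennreal t * ennreal (1 / (1 + 2 * t)\<^sup>2) *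
      (\<integral>\<^sup>+ v. gaussian_weight (La + (2 * t) \<cdot>\<^sub>m R) v \<partial>lborel_vec n) * indicator {0..} t \<partial>lborel"
  shows "(\<integral>\<^sup>+ v. gaussian_weight La v * ennreal ((qform A v / qform R v)\<^sup>2) \<partial>lborel_vec n) =
     ennreal ((mtrace (A * V))\<^sup>2 + 2 * mtrace (A * V * (A * V))) * K"
proof -
  define S where "S = (mtrace (A * V))\<^sup>2 + 2 * mtrace (A * V * (A * V))"
  have Vc: "V \<in> carrier_mat n n" using V by (simp add: positive_definite_def)
  interpret L: sigma_finite_measure "lborel_vec n" by (rule sigma_finite_lborel_vec)
  interpret pair_sigma_finite "lborel_vec n" "lborel :: real measure" ..
  have id: "(\<lambda>v. v) \<in> measurable (lborel_vec n) (lborel_vec n)" by simp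
  have fst: "fst \<in> measurable (lborel_vec n \<Otimes>\<^sub>M (lborel :: real measure)) (lborel_vec n)" by simp
  note [measurable] = measurable_qform[OF La id] measurable_qform[OF A(1) id] measurable_qform[OF R(1) id]
  note [measurable] = measurable_qform[OF La fst] measurable_qform[OF A(1) fst] measurable_qform[OF R(1) fst]
  define F where "F v t = gaussian_weight La v * ennreal ((qform A v)\<^sup>2) *
      (ennreal (t * exp (- t * qform R v)) * indicator {0..} t)" for v t
  have F: "case_prod F \<in> borel_measurable (lborel_vec n \<Otimes>\<^sub>M lborel)"
    unfolding F_def case_prod_beta by measurable
  have "(\<integral>\<^sup>+ v. gaussian_weight La v * ennreal ((qform A v / qform R v)\<^sup>2) \<partial>lborel_vec n) =
      (\<integral>\<^sup>+ v. \<integral>\<^sup>+ t. F v t \<partial>lborel \<partial>lborel_vec n)"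
  proof (rule nn_integral_cong_AE)
    show "AE v in lborel_vec n. gaussian_weight La v * ennreal ((qform A v / qform R v)\<^sup>2) = (\<integral>\<^sup>+ t. F v t \<partial>lborel)"
      using AE_qform_projection_pos[OF V R nz]
    proof eventually_elim
      fix v assume q: "0 < qform R v"
      have "(\<integral>\<^sup>+ t. F v t \<partial>lborel) = gaussian_weight La v * ennreal ((qform A v)\<^sup>2) * ennreal (1 / (qform R v)\<^sup>2)"
        unfolding F_def nn_integral_power_times_exp_scaled[OF q, symmetric] by (rule nn_integral_cmult) measurable
      also have "\<dots> = gaussian_weight La v * ennreal ((qform A v / qform R v)\<^sup>2)"
        by (simp add: power_divide mult.assoc flip: ennreal_mult)
      finally show "gaussian_weight La v * ennreal ((qform A v / qform R v)\<^sup>2) = (\<integral>\<^sup>+ t. F v t \<partial>lborel)" ..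
    qed
  qed
  also have "\<dots> = (\<integral>\<^sup>+ t. \<integral>\<^sup>+ v. F v t \<partial>lborel_vec n \<partial>lborel)"
    by (rule Fubini'[OF F, symmetric])
  also have "\<dots> = (\<integral>\<^sup>+ t. ennreal S * (ennreal t * ennreal (1 / (1 + 2 * t)\<^sup>2) *
      (\<integral>\<^sup>+ v. gaussian_weight (La + (2 * t) \<cdot>\<^sub>m R) v \<partial>lborel_vec n) * indicator {0..} t) \<partial>lborel)"
  proof (rule nn_integral_cong)
    fix t :: real
    show "(\<integral>\<^sup>+ v. F v t \<partial>lborel_vec n) = ennreal S * (ennreal t * ennreal (1 / (1 + 2 * t)\<^sup>2) *
      (\<integral>\<^sup>+ v. gaussian_weight (La + (2 * t) \<cdot>\<^sub>m R) v \<partial>lborel_vec n) * indicator {0..} t)"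
    proof (cases "0 \<le> t")
      case False
      then show ?thesis by (simp add: F_def)
    next
      case t: True
      define a where "a = - (2 * t / (1 + 2 * t))"
      define Vt where "Vt = V + a \<cdot>\<^sub>m (V * R * V)"
      define Lt where "Lt = La + (2 * t) \<cdot>\<^sub>m R"
      have Lt: "Lt \<in> carrier_mat n n" using La R by (simp add: Lt_def)
      have LtVt: "Lt * Vt = 1\<^sub>m n" and Vt: "positive_definite n Vt"
        using perturbed_precision_inverse[OF V La LaV R t] by (simp_all add: Lt_def Vt_def a_def)
      have VRV: "V * R * V \<in> carrier_mat n n" using Vc R by simp
      have AV: "A * V \<in> carrier_mat n n" using A Vc by simp
      have "A * (V * R * V) = (A * V * R) * V"
        using A(1) Vc R(1) by (simp add: assoc_mult_mat[of _ n n _ n _ n])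
      then have "A * (V * R * V) = A * V" using A by simp
      then have "A * Vt = A * V + a \<cdot>\<^sub>m (A * V)"
        unfolding Vt_def using A Vc VRV by (simp add: mult_add_distrib_mat[of _ n n _ n] mult_smult_distrib[of _ n n _ n])
      also have "\<dots> = (1 / (1 + 2 * t)) \<cdot>\<^sub>m (A * V)"
        by (rule eq_matI) (use t in \<open>simp_all add: a_def field_simps del: index_mult_mat(1)\<close>)
      finally have AVt: "A * Vt = (1 / (1 + 2 * t)) \<cdot>\<^sub>m (A * V)" .
      have "(mtrace (A * Vt))\<^sup>2 + 2 * mtrace (A * Vt * (A * Vt)) = S * (1 / (1 + 2 * t)\<^sup>2)"
      proof -
        define c where "c = 1 / (1 + 2 * t)"
        have "(mtrace (c \<cdot>\<^sub>m (A * V)))\<^sup>2 + 2 * mtrace (c \<cdot>\<^sub>m (A * V) * (c \<cdot>\<^sub>m (A * V))) = S * c\<^sup>2"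
          unfolding S_def using AV
          by (simp add: mtrace_smult[of _ n] mult_smult_distrib[of _ n n _ n] mult_smult_assoc_mat[of _ n n _ n]
              power2_eq_square algebra_simps)
        then show ?thesis unfolding AVt c_def power_one_over .
      qed
      with gaussian_quadratic_form_square[OF Vt Lt LtVt A(1,2)]
      have "(\<integral>\<^sup>+ v. gaussian_weight Lt v * ennreal ((qform A v)\<^sup>2) \<partial>lborel_vec n) =
          ennreal S * ennreal (1 / (1 + 2 * t)\<^sup>2) * (\<integral>\<^sup>+ v. gaussian_weight Lt v \<partial>lborel_vec n)"
        by (simp only: ennreal_mult'' zero_le_divide_1_iff zero_le_power2)
      moreover have "(\<integral>\<^sup>+ v. F v t \<partial>lborel_vec n) = (\<integral>\<^sup>+ v. ennreal t * (gaussian_weight Lt v * ennreal ((qform A v)\<^sup>2)) \<partial>lborel_vec n)"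
      proof (rule nn_integral_cong)
        fix v assume "v \<in> space (lborel_vec n)"
        then have v: "v \<in> carrier_vec n" by (simp add: space_lborel_vec)
        have "exp (- qform Lt v / 2) = exp (- qform La v / 2) * exp (- t * qform R v)"
          using La R v by (simp add: Lt_def qform_add[of _ n] qform_smult[of _ n] add_divide_distrib flip: exp_add)
        then show "F v t = ennreal t * (gaussian_weight Lt v * ennreal ((qform A v)\<^sup>2))"
          using t by (simp add: F_def ennreal_mult mult_ac)
      qed
      moreover have "\<dots> = ennreal t * (\<integral>\<^sup>+ v. gaussian_weight Lt v * ennreal ((qform A v)\<^sup>2) \<partial>lborel_vec n)"
        by (rule nn_integral_cmult) (use measurable_qform[OF Lt id] in measurable)
      ultimately show ?thesis
        using t unfolding Lt_def by (simp only: mult_ac indicator_simps atLeast_iff mult_1_right mult_1_left)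
    qed
  qed
  also have "\<dots> = ennreal S * K"
    unfolding K_def
  proof (rule nn_integral_cmult)
    have snd: "snd \<in> measurable ((lborel :: real measure) \<Otimes>\<^sub>M lborel_vec n) (lborel_vec n)" by simp
    note [measurable] = measurable_qform[OF La snd] measurable_qform[OF R(1) snd]
    have "(\<lambda>t. \<integral>\<^sup>+ v. ennreal (exp (- (qform La v + (2 * t) * qform R v) / 2)) \<partial>lborel_vec n) \<in> borel_measurable lborel"
      by (rule L.borel_measurable_nn_integral) (unfold case_prod_beta, measurable)
    moreover have "(\<integral>\<^sup>+ v. ennreal (exp (- (qform La v + (2 * t) * qform R v) / 2)) \<partial>lborel_vec n) =
        (\<integral>\<^sup>+ v. gaussian_weight (La + (2 * t) \<cdot>\<^sub>m R) v \<partial>lborel_vec n)" for t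
      by (rule nn_integral_cong) (use La R in \<open>simp add: space_lborel_vec qform_add[of _ n] qform_smult[of _ n]\<close>)
    ultimately have [measurable]: "(\<lambda>t. \<integral>\<^sup>+ v. gaussian_weight (La + (2 * t) \<cdot>\<^sub>m R) v \<partial>lborel_vec n) \<in> borel_measurable lborel"
      by (simp only:)
    show "(\<lambda>t. ennreal t * ennreal (1 / (1 + 2 * t)\<^sup>2) *
      (\<integral>\<^sup>+ v. gaussian_weight (La + (2 * t) \<cdot>\<^sub>m R) v \<partial>lborel_vec n) * indicator {0..} t) \<in> borel_measurable lborel"
      by measurable
  qed
  finally show ?thesis unfolding S_def .
qed

lemma minv_positive_definite:
  assumes "positive_definite n V"
  shows "V * minv V = 1\<^sub>m n" "minv V * V = 1\<^sub>m n" "minv V \<in> carrier_mat n n" "positive_definite n (minv V)"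
proof -
  have V: "V \<in> carrier_mat n n" using assms by (simp add: positive_definite_def)
  note inv = det_nonzero_imp_inverse[OF V positive_definite_det_nonzero[OF assms]]
  then show "V * minv V = 1\<^sub>m n" "minv V * V = 1\<^sub>m n" "minv V \<in> carrier_mat n n" by auto
  then show "positive_definite n (minv V)" using positive_definite_inverse[OF assms] by blast
qed

lemma mvn_density_eq: "mvn_density n \<mu> V y = exp (- qform (minv V) (y - \<mu>) / 2) / sqrt ((2 * pi) ^ n * det V)"
  by (simp add: mvn_density_def qform_def)

lemma measurable_mvn_density:
  assumes "positive_definite n V" "\<mu> \<in> carrier_vec n"
  shows "mvn_density n \<mu> V \<in> borel_measurable (lborel_vec n)"
proof -
  have "(\<lambda>y. y - \<mu>) \<in> measurable (lborel_vec n) (lborel_vec n)"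
    by (rule measurable_minus_vec) (use assms in \<open>auto intro: measurable_const_vec\<close>)
  note [measurable] = measurable_qform[OF minv_positive_definite(3)[OF assms(1)] this]
  show ?thesis unfolding mvn_density_eq by measurable
qed

lemma nn_integral_mvn:
  assumes V: "positive_definite n V" and \<mu>: "\<mu> \<in> carrier_vec n" and f: "f \<in> borel_measurable (lborel_vec n)"
  shows "(\<integral>\<^sup>+ y. f (y - \<mu>) \<partial>mvn n \<mu> V) =
     ennreal (1 / sqrt ((2 * pi) ^ n * det V)) * (\<integral>\<^sup>+ v. gaussian_weight (minv V) v * f v \<partial>lborel_vec n)"
proof -
  note La = minv_positive_definite[OF V]
  have detV: "0 < det V" by (rule gaussian_total(2)[OF V La(3) La(2)])
  note shift = measurable_diff_const[OF \<mu>]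
  note [measurable] = measurable_mvn_density[OF V \<mu>] measurable_compose[OF shift f]
    measurable_qform_id[OF La(3)] f
  define h where "h v = ennreal (exp (- qform (minv V) v / 2) / sqrt ((2 * pi) ^ n * det V)) * f v" for v
  have h: "h \<in> borel_measurable (lborel_vec n)" unfolding h_def by measurable
  have "(\<integral>\<^sup>+ y. f (y - \<mu>) \<partial>mvn n \<mu> V) = (\<integral>\<^sup>+ y. ennreal (mvn_density n \<mu> V y) * f (y - \<mu>) \<partial>lborel_vec n)"
    unfolding mvn_def by (rule nn_integral_density) measurable
  also have "\<dots> = (\<integral>\<^sup>+ y. h (y - \<mu>) \<partial>lborel_vec n)"
    unfolding mvn_density_eq h_def ..
  also have "\<dots> = (\<integral>\<^sup>+ y. h (y + \<mu> - \<mu>) \<partial>lborel_vec n)"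
    by (rule nn_integral_lborel_vec_translate[OF \<mu> measurable_compose[OF shift h], symmetric])
  also have "\<dots> = (\<integral>\<^sup>+ v. ennreal (1 / sqrt ((2 * pi) ^ n * det V)) * (gaussian_weight (minv V) v * f v) \<partial>lborel_vec n)"
  proof (rule nn_integral_cong)
    fix v assume "v \<in> space (lborel_vec n)"
    then have "v + \<mu> - \<mu> = v" using \<mu> by (intro eq_vecI) (auto simp: space_lborel_vec)
    moreover have "ennreal (exp (- qform (minv V) v / 2) / sqrt ((2 * pi) ^ n * det V)) =
        ennreal (1 / sqrt ((2 * pi) ^ n * det V)) * gaussian_weight (minv V) v"
      using detV by (subst ennreal_mult[symmetric]) auto
    ultimately show "h (v + \<mu> - \<mu>) = ennreal (1 / sqrt ((2 * pi) ^ n * det V)) * (gaussian_weight (minv V) v * f v)"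
      by (simp only: h_def mult.assoc)
  qed
  also have "\<dots> = ennreal (1 / sqrt ((2 * pi) ^ n * det V)) * (\<integral>\<^sup>+ v. gaussian_weight (minv V) v * f v \<partial>lborel_vec n)"
    by (rule nn_integral_cmult) measurable
  finally show ?thesis .
qed

lemma prob_space_mvn:
  assumes V: "positive_definite n V" and \<mu>: "\<mu> \<in> carrier_vec n"
  shows "prob_space (mvn n \<mu> V)"
proof
  note La = minv_positive_definite[OF V]
  have detV: "0 < det V" by (rule gaussian_total(2)[OF V La(3) La(2)])
  have "emeasure (mvn n \<mu> V) (space (mvn n \<mu> V)) = (\<integral>\<^sup>+ y. 1 \<partial>mvn n \<mu> V)"
    by simp
  also have "\<dots> = ennreal (1 / sqrt ((2 * pi) ^ n * det V)) * ennreal (sqrt ((2 * pi) ^ n * det V))"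
    using nn_integral_mvn[OF V \<mu>, of "\<lambda>_. 1"] gaussian_total(1)[OF V La(3) La(2)] by simp
  also have "\<dots> = 1"
    using detV by (subst ennreal_mult[symmetric]) auto
  finally show "emeasure (mvn n \<mu> V) (space (mvn n \<mu> V)) = 1" .
qed

lemma AE_mvn:
  assumes V: "positive_definite n V" and \<mu>: "\<mu> \<in> carrier_vec n" and P: "AE y in lborel_vec n. P y"
  shows "AE y in mvn n \<mu> V. P y"
  unfolding mvn_def using measurable_mvn_density[OF V \<mu>] P
  by (subst AE_density) (auto elim: eventually_mono)

lemma sets_mvn [measurable_cong]: "sets (mvn n \<mu> V) = sets (lborel_vec n)"
  by (simp add: mvn_def)

lemma AE_lborel_vec_shift:
  assumes \<mu>: "\<mu> \<in> carrier_vec n" and P: "AE v in lborel_vec n. P v" and m: "Measurable.pred (lborel_vec n) P"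
  shows "AE y in lborel_vec n. P (y - \<mu>)"
proof -
  note shift = measurable_diff_const[OF \<mu>]
  define f where "f v = (indicator {v. \<not> P v} v :: ennreal)" for v
  have f [measurable]: "f \<in> borel_measurable (lborel_vec n)" unfolding f_def using m by measurable
  have f': "(\<lambda>y. f (y - \<mu>)) \<in> borel_measurable (lborel_vec n)" by (rule measurable_compose[OF shift f])
  have "(\<integral>\<^sup>+ y. f (y - \<mu>) \<partial>lborel_vec n) = (\<integral>\<^sup>+ y. f (y + \<mu> - \<mu>) \<partial>lborel_vec n)"
    by (rule nn_integral_lborel_vec_translate[OF \<mu> f', symmetric])
  also have "\<dots> = (\<integral>\<^sup>+ y. f y \<partial>lborel_vec n)"
  proof (rule nn_integral_cong)
    fix v assume "v \<in> space (lborel_vec n)"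
    then have "v + \<mu> - \<mu> = v" using \<mu> by (intro eq_vecI) (auto simp: space_lborel_vec)
    then show "f (v + \<mu> - \<mu>) = f v" by simp
  qed
  also have "\<dots> = 0"
    using P by (subst nn_integral_0_iff_AE) (auto simp: f_def indicator_def elim: eventually_mono)
  finally have "AE y in lborel_vec n. f (y - \<mu>) = 0"
    using f' by (subst (asm) nn_integral_0_iff_AE) auto
  then show ?thesis by eventually_elim (auto simp: f_def indicator_def split: if_splits)
qed

text \<open>The constant \<open>K\<close> of \<open>gaussian_ratio_second_moment\<close> is found indirectly: for \<open>A = R\<close> the ratio
  is \<open>1\<close>, which forces \<open>K\<close>, up to the normalisation of the density, to be \<open>1 / (m (m + 2))\<close>. The ratio of \<open>B + R\<close>
  is that of \<open>B\<close> plus one, so the difference of their second moments gives the mean, and only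
  nonnegative functions have to be integrated explicitly.\<close>

theorem gaussian_ratio_variance:
  fixes m :: real
  assumes V: "positive_definite n V" and \<mu>: "\<mu> \<in> carrier_vec n"
    and R: "R \<in> carrier_mat n n" "R\<^sup>T = R" "R * V * R = R"
    and B: "B \<in> carrier_mat n n" "B\<^sup>T = B" "B * V * R = B"
    and tr: "mtrace (R * V) = m" and m: "0 < m"
    and Y: "Y \<in> borel_measurable (lborel_vec n)"
    and Y_eq: "AE y in lborel_vec n. Y y = a + b * (qform B (y - \<mu>) / qform R (y - \<mu>))"
  shows "prob_space.variance (mvn n \<mu> V) Y =
     b\<^sup>2 * (2 / (m * (m + 2)) * (mtrace (B * V * (B * V)) - (mtrace (B * V))\<^sup>2 / m))"
proof -
  note La = minv_positive_definite[OF V]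
  have Vc: "V \<in> carrier_mat n n" using V by (simp add: positive_definite_def)
  interpret prob_space "mvn n \<mu> V" by (rule prob_space_mvn[OF V \<mu>])
  note shift = measurable_diff_const[OF \<mu>]
  have nz: "R \<noteq> 0\<^sub>m n n"
  proof
    assume "R = 0\<^sub>m n n"
    then have "mtrace (R * V) = 0" using Vc by (simp add: mtrace_def)
    then show False using tr m by simp
  qed
  define c where "c = ennreal (1 / sqrt ((2 * pi) ^ n * det V))"
  define K where "K = (\<integral>\<^sup>+ t. ennreal t * ennreal (1 / (1 + 2 * t)\<^sup>2) *
      (\<integral>\<^sup>+ v. gaussian_weight (minv V + (2 * t) \<cdot>\<^sub>m R) v \<partial>lborel_vec n) * indicator {0..} t \<partial>lborel)"
  define S where "S A = (mtrace (A * V))\<^sup>2 + 2 * mtrace (A * V * (A * V))" for A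
  have second: "(\<integral>\<^sup>+ y. ennreal ((qform A (y - \<mu>) / qform R (y - \<mu>))\<^sup>2) \<partial>mvn n \<mu> V) = c * (ennreal (S A) * K)"
    if A: "A \<in> carrier_mat n n" "A\<^sup>T = A" "A * V * R = A" for A
  proof -
    note [measurable] = measurable_qform_id[OF A(1)] measurable_qform_id[OF R(1)]
    have "(\<lambda>v. ennreal ((qform A v / qform R v)\<^sup>2)) \<in> borel_measurable (lborel_vec n)" by measurable
    from nn_integral_mvn[OF V \<mu> this]
    show ?thesis
      unfolding c_def S_def K_def gaussian_ratio_second_moment[OF V La(3,2) R nz A] .
  qed
  have AEpos: "AE y in mvn n \<mu> V. 0 < qform R (y - \<mu>)"
  proof (rule AE_mvn[OF V \<mu> AE_lborel_vec_shift[OF \<mu> AE_qform_projection_pos[OF V R nz]]])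
    note [measurable] = measurable_qform_id[OF R(1)]
    show "Measurable.pred (lborel_vec n) (\<lambda>v. 0 < qform R v)" by measurable
  qed
  have "R * V * (R * V) = R * V"
  proof -
    have "R * V * (R * V) = (R * V * R) * V" using R(1) Vc by (simp add: assoc_mult_mat[of _ n n _ n _ n])
    then show ?thesis using R by simp
  qed
  then have SR: "S R = m * (m + 2)" by (simp add: S_def tr power2_eq_square algebra_simps)
  have "c * (ennreal (S R) * K) = (\<integral>\<^sup>+ y. ennreal ((qform R (y - \<mu>) / qform R (y - \<mu>))\<^sup>2) \<partial>mvn n \<mu> V)"
    by (rule second[OF R, symmetric])
  also have "\<dots> = (\<integral>\<^sup>+ y. 1 \<partial>mvn n \<mu> V)"
    by (rule nn_integral_cong_AE) (use AEpos in eventually_elim, simp)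
  also have "\<dots> = 1" using emeasure_space_1 by simp
  finally have one: "ennreal (m * (m + 2)) * (c * K) = 1"
    by (simp add: SR mult_ac)
  have cK: "c * K = ennreal (1 / (m * (m + 2)))"
  proof -
    have "c * K = ennreal (1 / (m * (m + 2))) * (ennreal (m * (m + 2)) * (c * K))"
      unfolding mult.assoc[symmetric] using m by (subst ennreal_mult[symmetric]) auto
    then show ?thesis unfolding one by simp
  qed
  have second': "(\<integral>\<^sup>+ y. ennreal ((qform A (y - \<mu>) / qform R (y - \<mu>))\<^sup>2) \<partial>mvn n \<mu> V) = ennreal (S A / (m * (m + 2)))"
    and Snn: "0 \<le> S A"
    if A: "A \<in> carrier_mat n n" "A\<^sup>T = A" "A * V * R = A" for A
  proof -
    show "0 \<le> S A" unfolding S_def using mtrace_congruence_square_nonneg[OF V A(1,2)] by simp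
    have "c * (ennreal (S A) * K) = ennreal (S A) * (c * K)" by (simp add: mult_ac)
    also have "\<dots> = ennreal (S A / (m * (m + 2)))"
      unfolding cK using m by (subst ennreal_mult''[symmetric]) auto
    finally show "(\<integral>\<^sup>+ y. ennreal ((qform A (y - \<mu>) / qform R (y - \<mu>))\<^sup>2) \<partial>mvn n \<mu> V) = ennreal (S A / (m * (m + 2)))"
      using second[OF A] by simp
  qed
  define X where "X y = qform B (y - \<mu>) / qform R (y - \<mu>)" for y
  note [measurable] = measurable_qform[OF B(1) shift] measurable_qform[OF R(1) shift]
  have X [measurable]: "X \<in> borel_measurable (lborel_vec n)" unfolding X_def by measurable
  have sq: "integrable (mvn n \<mu> V) (\<lambda>y. (X y)\<^sup>2) \<and> expectation (\<lambda>y. (X y)\<^sup>2) = S B / (m * (m + 2))"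
    using second'[OF B] Snn[OF B] m by (subst nn_integral_eq_integrable[symmetric]) (auto simp: X_def)
  have intX: "integrable (mvn n \<mu> V) X"
    by (rule square_integrable_imp_integrable) (use sq in \<open>auto simp: power2_eq_square\<close>)
  \<comment> \<open>comparing \<open>B + R\<close> with \<open>B\<close> isolates the mean of \<open>X\<close>\<close>
  have BR: "B + R \<in> carrier_mat n n" "transpose_mat (B + R) = B + R" "(B + R) * V * R = B + R"
    using B R Vc by (simp_all add: transpose_add[of _ n n] add_mult_distrib_mat[of _ n n _ _ n])
  have SBR: "S (B + R) = S B + 2 * (m + 2) * mtrace (B * V) + m * (m + 2)"
  proof -
    have BV: "B * V \<in> carrier_mat n n" and RV: "R * V \<in> carrier_mat n n" using B R Vc by auto
    have 1: "B * V * (R * V) = B * V"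
    proof -
      have "B * V * (R * V) = (B * V * R) * V" using B(1) R(1) Vc by (simp add: assoc_mult_mat[of _ n n _ n _ n])
      then show ?thesis using B by simp
    qed
    have 2: "mtrace (R * V * (B * V)) = mtrace (B * V)"
      using mtrace_mult_comm[OF RV BV] 1 by simp
    have "(B + R) * V = B * V + R * V" using B R Vc by (simp add: add_mult_distrib_mat[of _ n n])
    moreover have "(B * V + R * V) * (B * V + R * V) = (B * V * (B * V) + R * V * (B * V)) + (B * V * (R * V) + R * V * (R * V))"
    proof -
      have "(P + Q) * (P + Q) = (P * P + Q * P) + (P * Q + Q * Q)" if "P \<in> carrier_mat n n" "Q \<in> carrier_mat n n" for P Q :: "real mat"
        using that by (simp add: add_mult_distrib_mat[of _ n n _ _ n] mult_add_distrib_mat[of _ n n _ n])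
      then show ?thesis using BV RV by blast
    qed
    ultimately show ?thesis
      using BV RV SR 2
      by (simp add: S_def 1 mtrace_add[of _ n] tr power2_eq_square algebra_simps)
  qed
  have "expectation (\<lambda>y. (X y + 1)\<^sup>2) = S (B + R) / (m * (m + 2))"
  proof -
    have "(\<integral>\<^sup>+ y. ennreal ((X y + 1)\<^sup>2) \<partial>mvn n \<mu> V) = (\<integral>\<^sup>+ y. ennreal ((qform (B + R) (y - \<mu>) / qform R (y - \<mu>))\<^sup>2) \<partial>mvn n \<mu> V)"
    proof (rule nn_integral_cong_AE)
      have "AE y in mvn n \<mu> V. y \<in> carrier_vec n"
        by (rule AE_I2) (simp add: mvn_def space_lborel_vec)
      with AEpos show "AE y in mvn n \<mu> V. ennreal ((X y + 1)\<^sup>2) = ennreal ((qform (B + R) (y - \<mu>) / qform R (y - \<mu>))\<^sup>2)"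
        by eventually_elim (use B(1) R(1) \<mu> in \<open>simp add: X_def qform_add[of _ n] add_divide_distrib\<close>)
    qed
    also have "\<dots> = ennreal (S (B + R) / (m * (m + 2)))" by (rule second'[OF BR])
    finally have "integrable (mvn n \<mu> V) (\<lambda>y. (X y + 1)\<^sup>2) \<and> expectation (\<lambda>y. (X y + 1)\<^sup>2) = S (B + R) / (m * (m + 2))"
      using Snn[OF BR] m by (subst nn_integral_eq_integrable[symmetric]) auto
    then show ?thesis ..
  qed
  moreover have "expectation (\<lambda>y. (X y + 1)\<^sup>2) = S B / (m * (m + 2)) + 2 * expectation X + 1"
  proof -
    have "expectation (\<lambda>y. (X y + 1)\<^sup>2) = expectation (\<lambda>y. (X y)\<^sup>2 + 2 * X y + 1)"
      by (simp add: power2_eq_square algebra_simps)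
    also have "\<dots> = expectation (\<lambda>y. (X y)\<^sup>2) + 2 * expectation X + 1"
      using sq intX prob_space by simp
    finally show ?thesis using sq by simp
  qed
  ultimately have EX: "expectation X = mtrace (B * V) / m"
  proof -
    assume "expectation (\<lambda>y. (X y + 1)\<^sup>2) = S (B + R) / (m * (m + 2))"
      and "expectation (\<lambda>y. (X y + 1)\<^sup>2) = S B / (m * (m + 2)) + 2 * expectation X + 1"
    then have "S B / (m * (m + 2)) + 2 * expectation X + 1 = (S B + 2 * (m + 2) * mtrace (B * V) + m * (m + 2)) / (m * (m + 2))"
      unfolding SBR by (simp only:)
    also have "\<dots> = S B / (m * (m + 2)) + 2 * (mtrace (B * V) / m) + 1"
    proof -
      have *: "2 * k * x / (m * k) = 2 * (x / m)" if "k \<noteq> 0" for k x using that by simp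
      have "m * (m + 2) \<noteq> 0" "m + 2 \<noteq> 0" using m by auto
      then show ?thesis by (simp only: add_divide_distrib * divide_self simp_thms)
    qed
    finally show ?thesis by simp
  qed
  have "variance Y = variance (\<lambda>y. a + b * X y)"
  proof -
    have AEY: "AE y in mvn n \<mu> V. Y y = a + b * X y"
      unfolding X_def by (rule AE_mvn[OF V \<mu> Y_eq])
    then have "expectation Y = expectation (\<lambda>y. a + b * X y)"
      using Y by (intro integral_cong_AE) auto
    then show ?thesis
      using Y AEY by (intro integral_cong_AE) auto
  qed
  also have "\<dots> = b\<^sup>2 * variance X"
  proof -
    have "expectation (\<lambda>y. a + b * X y) = a + b * expectation X"
      using intX prob_space by simp
    then have "variance (\<lambda>y. a + b * X y) = expectation (\<lambda>y. b\<^sup>2 * (X y - expectation X)\<^sup>2)"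
      by (simp add: power2_eq_square algebra_simps)
    then show ?thesis by simp
  qed
  also have "variance X = S B / (m * (m + 2)) - (mtrace (B * V) / m)\<^sup>2"
    using variance_eq[OF intX conjunct1[OF sq]] sq EX by simp
  also have "\<dots> = 2 / (m * (m + 2)) * (mtrace (B * V * (B * V)) - (mtrace (B * V))\<^sup>2 / m)"
  proof -
    have "(T\<^sup>2 + 2 * u) / (m * k) - (T / m)\<^sup>2 = 2 / (m * k) * (u - T\<^sup>2 / m)" if "k = m + 2" for T u k :: real
    proof -
      have "k \<noteq> 0" "m \<noteq> 0" using that m by auto
      then have "(T\<^sup>2 + 2 * u) / (m * k) - (T / m)\<^sup>2 = ((T\<^sup>2 + 2 * u) * m - T\<^sup>2 * k) / (m\<^sup>2 * k)"
        by (simp add: field_simps power2_eq_square)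
      also have "(T\<^sup>2 + 2 * u) * m - T\<^sup>2 * k = 2 * (u * m - T\<^sup>2)"
        unfolding that by (simp add: algebra_simps)
      also have "2 * (u * m - T\<^sup>2) / (m\<^sup>2 * k) = 2 / (m * k) * (u - T\<^sup>2 / m)"
        using \<open>k \<noteq> 0\<close> \<open>m \<noteq> 0\<close> by (simp add: field_simps power2_eq_square)
      finally show ?thesis .
    qed
    then show ?thesis unfolding S_def by blast
  qed
  finally show ?thesis .
qed

section \<open>Integrating out the regression coefficients and the variance\<close>

lemma qform_diff:
  assumes A: "A \<in> carrier_mat n n" and sym: "A\<^sup>T = A" and u: "u \<in> carrier_vec n" and v: "v \<in> carrier_vec n"
  shows "qform A (u - v) = qform A u - 2 * (v \<bullet> (A *\<^sub>v u)) + qform A v"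
proof -
  have Au: "A *\<^sub>v u \<in> carrier_vec n" and Av: "A *\<^sub>v v \<in> carrier_vec n" using A u v by auto
  have cross: "u \<bullet> (A *\<^sub>v v) = v \<bullet> (A *\<^sub>v u)"
    using transpose_vec_mult_scalar[OF A v u] sym comm_scalar_prod[OF v Au] comm_scalar_prod[OF u Av] by simp
  have "A *\<^sub>v (u - v) = A *\<^sub>v u - A *\<^sub>v v" by (rule mult_minus_distrib_mat_vec[OF A u v])
  then show ?thesis
    using u v Au Av
    by (simp add: qform_def minus_scalar_prod_distrib[of _ n] scalar_prod_minus_distrib[of _ n] cross)
qed

text \<open>With \<open>w = H\<^sup>T La y\<close> and \<open>b = M\<^sup>-\<^sup>1 w\<close> both sides equal \<open>y\<^sup>T La y - 2 (\<beta> \<bullet> w) + \<beta>\<^sup>T M \<beta>\<close>: the term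
  \<open>b \<bullet> w\<close> of the completed square is what the matrix on the right subtracts from \<open>La\<close>.\<close>

lemma complete_square:
  assumes La: "La \<in> carrier_mat n n" "La\<^sup>T = La" and H: "H \<in> carrier_mat n p"
    and M: "positive_definite p (H\<^sup>T * La * H)"
    and y: "y \<in> carrier_vec n" and \<beta>: "\<beta> \<in> carrier_vec p"
  defines "M \<equiv> H\<^sup>T * La * H"
  shows "qform La (y - H *\<^sub>v \<beta>) =
     qform (La - La * H * minv M * H\<^sup>T * La) y + qform M (\<beta> - minv M *\<^sub>v (H\<^sup>T *\<^sub>v (La *\<^sub>v y)))"
proof -
  note Mi = minv_positive_definite[OF M, folded M_def]
  have Mc: "M \<in> carrier_mat p p" and Msym: "M\<^sup>T = M"
    using M by (simp_all add: M_def positive_definite_def)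
  define w where "w = H\<^sup>T *\<^sub>v (La *\<^sub>v y)"
  have Lay: "La *\<^sub>v y \<in> carrier_vec n" using La y by simp
  have w: "w \<in> carrier_vec p" using H Lay by (simp add: w_def)
  define b where "b = minv M *\<^sub>v w"
  have b: "b \<in> carrier_vec p" using Mi w by (simp add: b_def)
  have Mb: "M *\<^sub>v b = w"
    using Mi Mc w by (simp add: b_def flip: assoc_mult_mat_vec[of _ p p _ p])
  have H\<beta>: "H *\<^sub>v \<beta> \<in> carrier_vec n" using H \<beta> by simp
  have qH: "qform La (H *\<^sub>v \<beta>) = qform M \<beta>" unfolding M_def by (rule qform_congruence[OF La(1) H \<beta>, symmetric])
  have cross: "(H *\<^sub>v \<beta>) \<bullet> (La *\<^sub>v y) = \<beta> \<bullet> w"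
    using transpose_vec_mult_scalar[OF H \<beta> Lay] comm_scalar_prod[OF \<beta> w] comm_scalar_prod[OF H\<beta> Lay] by (simp add: w_def)
  have bM: "b \<bullet> (M *\<^sub>v \<beta>) = \<beta> \<bullet> w"
    using transpose_vec_mult_scalar[OF Mc b \<beta>] Msym Mb comm_scalar_prod[of \<beta> p w] comm_scalar_prod[of b p "M *\<^sub>v \<beta>"] Mc w b \<beta>
    by (metis mult_mat_vec_carrier)
  have P: "qform (La - La * H * minv M * H\<^sup>T * La) y = qform La y - b \<bullet> w"
  proof -
    have X: "La * H * minv M * H\<^sup>T * La \<in> carrier_mat n n" using La H Mi by auto
    have "(La * H * minv M * H\<^sup>T * La) *\<^sub>v y = La *\<^sub>v (H *\<^sub>v (minv M *\<^sub>v (H\<^sup>T *\<^sub>v (La *\<^sub>v y))))"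
    proof -
      have 1: "La * H \<in> carrier_mat n p" "La * H * minv M \<in> carrier_mat n p" "La * H * minv M * H\<^sup>T \<in> carrier_mat n n"
        using La H Mi by auto
      have Ht: "H\<^sup>T \<in> carrier_mat p n" using H by simp
      have 2: "H\<^sup>T *\<^sub>v (La *\<^sub>v y) \<in> carrier_vec p" using w unfolding w_def .
      then have 3: "minv M *\<^sub>v (H\<^sup>T *\<^sub>v (La *\<^sub>v y)) \<in> carrier_vec p" using Mi by simp
      show ?thesis
        unfolding assoc_mult_mat_vec[OF 1(3) La(1) y] assoc_mult_mat_vec[OF 1(2) Ht Lay]
          assoc_mult_mat_vec[OF 1(1) Mi(3) 2] assoc_mult_mat_vec[OF La(1) H 3] ..
    qed
    also have "\<dots> = La *\<^sub>v (H *\<^sub>v b)" by (simp add: b_def w_def)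
    finally have eq: "(La * H * minv M * H\<^sup>T * La) *\<^sub>v y = La *\<^sub>v (H *\<^sub>v b)" .
    have Hb: "H *\<^sub>v b \<in> carrier_vec n" using H b by simp
    have LHb: "La *\<^sub>v (H *\<^sub>v b) \<in> carrier_vec n" using La Hb by simp
    have "y \<bullet> (La *\<^sub>v (H *\<^sub>v b)) = (H *\<^sub>v b) \<bullet> (La *\<^sub>v y)"
      using transpose_vec_mult_scalar[OF La(1) Hb y] La(2) comm_scalar_prod[OF Hb Lay] comm_scalar_prod[OF y LHb] by simp
    also have "\<dots> = b \<bullet> w"
      using transpose_vec_mult_scalar[OF H b Lay] comm_scalar_prod[OF b w] comm_scalar_prod[OF Hb Lay] by (simp add: w_def)
    finally have "y \<bullet> (La *\<^sub>v (H *\<^sub>v b)) = b \<bullet> w" .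
    moreover have "(La - La * H * minv M * H\<^sup>T * La) *\<^sub>v y = La *\<^sub>v y - La *\<^sub>v (H *\<^sub>v b)"
      unfolding eq[symmetric] by (rule minus_mult_distrib_mat_vec[OF La(1) X y])
    ultimately show ?thesis
      unfolding qform_def using y Lay LHb by (simp add: scalar_prod_minus_distrib[of _ n])
  qed
  have "qform M (\<beta> - b) = qform M \<beta> - 2 * (\<beta> \<bullet> w) + b \<bullet> w"
    unfolding qform_diff[OF Mc Msym \<beta> b] bM by (simp add: qform_def Mb)
  then show ?thesis
    unfolding qform_diff[OF La y H\<beta>] cross qH P w_def[symmetric] b_def[symmetric] by simp
qed

text \<open>What is left to be integrated over the variance \<open>s\<close> once \<open>\<beta>\<close> is gone; \<open>Q\<close> is the generalised
  residual sum of squares.\<close>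

definition scale_integral :: "nat \<Rightarrow> real \<Rightarrow> ennreal" where
  "scale_integral m Q = (\<integral>\<^sup>+ s. ennreal (1 / (sqrt (s ^ m) * s) * exp (- Q / (2 * s))) * indicator {0<..} s \<partial>lborel)"

text \<open>Substitute \<open>s = Q r\<close>.\<close>

lemma scale_integral_homogeneous:
  assumes Q: "0 < Q"
  shows "scale_integral m Q = ennreal (1 / sqrt (Q ^ m)) * scale_integral m 1"
proof -
  have "scale_integral m Q = ennreal Q * (\<integral>\<^sup>+ r. ennreal (1 / (sqrt ((0 + Q * r) ^ m) * (0 + Q * r)) * exp (- Q / (2 * (0 + Q * r)))) * indicator {0<..} (0 + Q * r) \<partial>lborel)"
    unfolding scale_integral_def using Q by (subst nn_integral_real_affine[where c = Q and t = 0]) auto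
  also have "\<dots> = (\<integral>\<^sup>+ r. ennreal Q * (ennreal (1 / (sqrt ((0 + Q * r) ^ m) * (0 + Q * r)) * exp (- Q / (2 * (0 + Q * r)))) * indicator {0<..} (0 + Q * r)) \<partial>lborel)"
    by (rule nn_integral_cmult[symmetric]) measurable
  also have "\<dots> = (\<integral>\<^sup>+ r. ennreal (1 / sqrt (Q ^ m)) * (ennreal (1 / (sqrt (r ^ m) * r) * exp (- 1 / (2 * r))) * indicator {0<..} r) \<partial>lborel)"
  proof (rule nn_integral_cong)
    fix r :: real
    have "Q * (1 / (sqrt ((0 + Q * r) ^ m) * (0 + Q * r)) * exp (- Q / (2 * (0 + Q * r)))) = 1 / sqrt (Q ^ m) * (1 / (sqrt (r ^ m) * r) * exp (- 1 / (2 * r)))"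
      if "0 < r"
    proof -
      have "sqrt ((Q * r) ^ m) = sqrt (Q ^ m) * sqrt (r ^ m)" by (simp add: power_mult_distrib real_sqrt_mult)
      then show ?thesis using Q that by (simp add: field_simps)
    qed
    then show "ennreal Q * (ennreal (1 / (sqrt ((0 + Q * r) ^ m) * (0 + Q * r)) * exp (- Q / (2 * (0 + Q * r)))) * indicator {0<..} (0 + Q * r)) =
       ennreal (1 / sqrt (Q ^ m)) * (ennreal (1 / (sqrt (r ^ m) * r) * exp (- 1 / (2 * r))) * indicator {0<..} r)"
      using Q by (cases "0 < r") (simp_all add: zero_less_mult_iff flip: mult.assoc ennreal_mult)
  qed
  also have "\<dots> = ennreal (1 / sqrt (Q ^ m)) * scale_integral m 1"
    unfolding scale_integral_def by (rule nn_integral_cmult) measurable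
  finally show ?thesis .
qed

text \<open>Near \<open>0\<close> the exponential beats every power of \<open>s\<close>; for \<open>s \<ge> 1\<close> the integrand is at most
  \<open>1 / (s \<surd>s)\<close>.\<close>

lemma scale_integral_finite:
  assumes m: "0 < m"
  shows "scale_integral m 1 < \<infinity>"
proof -
  \<comment> \<open>the exponent with which \<open>s ^ k\<close> outweighs the singularity at \<open>0\<close>, via \<open>(1 + x / k) ^ k \<le> exp x\<close>\<close>
  define k where "k = m + 1"
  define C where "C = (2 * real k) ^ k"
  define g where "g s = ennreal C * indicator {0..1} s + ennreal (1 / (s * sqrt s)) * indicator {1..} s" for s :: real
  have "scale_integral m 1 \<le> (\<integral>\<^sup>+ s. g s \<partial>lborel)"
    unfolding scale_integral_def
  proof (rule nn_integral_mono)
    fix s :: real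
    consider "s \<le> 0" | "0 < s" "s \<le> 1" | "1 < s" by linarith
    then show "ennreal (1 / (sqrt (s ^ m) * s) * exp (- 1 / (2 * s))) * indicator {0<..} s \<le> g s"
    proof cases
      case 1 then show ?thesis by simp
    next
      case 2
      have "(1 + (1 / (2 * s)) / real k) ^ k \<le> exp (1 / (2 * s))"
      proof (rule exp_ge_one_plus_x_over_n_power_n)
        have "- real k \<le> 0" by simp
        also have "0 \<le> 1 / (2 * s)" using 2 by simp
        finally show "- real k \<le> 1 / (2 * s)" .
      qed (simp add: k_def)
      moreover have "((1 / (2 * s)) / real k) ^ k \<le> (1 + (1 / (2 * s)) / real k) ^ k"
        using 2 by (intro power_mono) auto
      moreover have "((1 / (2 * s)) / real k) ^ k = 1 / (C * s ^ k)"
      proof -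
        have "(1 / (2 * s)) / real k = 1 / ((2 * real k) * s)" by (simp add: mult_ac)
        then show ?thesis by (simp only: power_one_over power_mult_distrib C_def)
      qed
      ultimately have "1 / (C * s ^ k) \<le> exp (1 / (2 * s))" by linarith
      then have e: "exp (- 1 / (2 * s)) \<le> C * s ^ k"
      proof -
        have "1 / E \<le> D" if "1 / D \<le> E" "0 < D" "0 < E" for D E :: real
          using that by (simp add: field_simps)
        from this[OF \<open>1 / (C * s ^ k) \<le> exp (1 / (2 * s))\<close>] show ?thesis
          using 2 by (simp add: exp_minus inverse_eq_divide C_def k_def)
      qed
      have "s ^ m \<le> sqrt (s ^ m)"
      proof (rule real_le_rsqrt)
        have "0 \<le> s ^ m" "s ^ m \<le> 1" using 2 by (auto intro: power_le_one)
        then show "(s ^ m)\<^sup>2 \<le> s ^ m" unfolding power2_eq_square by (rule mult_left_le[rotated])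
      qed
      then have "s ^ k \<le> sqrt (s ^ m) * s" using 2 by (simp add: k_def mult_right_mono)
      then have "1 / (sqrt (s ^ m) * s) \<le> 1 / s ^ k" using 2 by (intro divide_left_mono) auto
      then have "1 / (sqrt (s ^ m) * s) * exp (- 1 / (2 * s)) \<le> 1 / s ^ k * (C * s ^ k)"
        using e 2 by (intro mult_mono) (auto simp: C_def)
      also have "\<dots> = C" using 2 by simp
      finally have "ennreal (1 / (sqrt (s ^ m) * s) * exp (- 1 / (2 * s))) \<le> ennreal C" by (rule ennreal_leI)
      then show ?thesis using 2 by (simp add: g_def add_increasing2)
    next
      case 3
      have "s \<le> s ^ m" using 3 m by (intro self_le_power) auto
      then have "sqrt s \<le> sqrt (s ^ m)" by simp
      then have "1 / (sqrt (s ^ m) * s) \<le> 1 / (sqrt s * s)" using 3 by (intro divide_left_mono mult_right_mono) auto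
      moreover have "exp (- 1 / (2 * s)) \<le> 1" using 3 by simp
      ultimately have "1 / (sqrt (s ^ m) * s) * exp (- 1 / (2 * s)) \<le> 1 / (sqrt s * s) * 1"
        using 3 by (intro mult_mono) auto
      then show ?thesis using 3 by (auto simp: g_def mult.commute intro!: ennreal_leI)
    qed
  qed
  also have "\<dots> = ennreal C + (\<integral>\<^sup>+ s. ennreal (1 / (s * sqrt s)) * indicator {1..} s \<partial>lborel)"
    unfolding g_def by (subst nn_integral_add) (auto simp: nn_integral_cmult)
  also have "(\<integral>\<^sup>+ s. ennreal (1 / (s * sqrt s)) * indicator {1..} s \<partial>lborel) = ennreal (0 - (- 2 / sqrt 1))"
  proof (rule nn_integral_FTC_atLeast)
    fix x :: real assume x: "1 \<le> x"
    have "((\<lambda>s. - 2 * inverse (sqrt s)) has_real_derivative (- 2 * (- (inverse (sqrt x) * (inverse (sqrt x) / 2) * inverse (sqrt x))))) (at x)"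
      by (rule derivative_eq_intros refl | use x in simp)+
    moreover have "- 2 * (- (inverse (sqrt x) * (inverse (sqrt x) / 2) * inverse (sqrt x))) = 1 / (x * sqrt x)"
      using x by (simp add: field_simps)
    moreover have "(\<lambda>s. - 2 / sqrt s) = (\<lambda>s. - 2 * inverse (sqrt s))" by (simp add: divide_inverse)
    ultimately show "((\<lambda>s. - 2 / sqrt s) has_real_derivative 1 / (x * sqrt x)) (at x)"
      by (simp only:)
    show "0 \<le> 1 / (x * sqrt x)" using x by simp
  next
    show "((\<lambda>s. - 2 / sqrt s) \<longlongrightarrow> 0) at_top"
      by (intro tendsto_divide_0[OF tendsto_const] filterlim_at_top_imp_at_infinity sqrt_at_top)
  qed measurable
  also have "ennreal C + ennreal (0 - (- 2 / sqrt 1)) < \<infinity>" by simp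
  finally show ?thesis .
qed

lemma scale_integral_pos: "0 < scale_integral m 1"
proof (rule ccontr)
  assume "\<not> ?thesis"
  then have "(\<integral>\<^sup>+ s. ennreal (1 / (sqrt (s ^ m) * s) * exp (- 1 / (2 * s))) * indicator {0<..} s \<partial>lborel) = 0"
    by (simp add: scale_integral_def)
  then have "AE s in lborel. ennreal (1 / (sqrt (s ^ m) * s) * exp (- 1 / (2 * s))) * indicator {0<..} s = 0"
    by (subst (asm) nn_integral_0_iff_AE) auto
  then have "AE s::real in lborel. \<not> (s \<in> {0<..<1})"
  proof eventually_elim
    fix s :: real assume *: "ennreal (1 / (sqrt (s ^ m) * s) * exp (- 1 / (2 * s))) * indicator {0<..} s = 0"
    show "s \<notin> {0<..<1}"
    proof
      assume s: "s \<in> {0<..<1}"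
      then have "0 < 1 / (sqrt (s ^ m) * s) * exp (- 1 / (2 * s))" by simp
      then show False using * s by (simp del: mult_pos_pos)
    qed
  qed
  then have "emeasure lborel {0<..<1::real} = 0"
    by (subst (asm) AE_iff_measurable[where N="{0<..<1}"]) auto
  then show False by simp
qed

lemma enn2real_scale_integral:
  assumes m: "0 < m"
  shows "0 < enn2real (scale_integral m 1)"
    and "0 < Q \<Longrightarrow> enn2real (scale_integral m Q) = enn2real (scale_integral m 1) / sqrt (Q ^ m)"
proof -
  show "0 < enn2real (scale_integral m 1)"
    using scale_integral_finite[OF m] scale_integral_pos[of m] by (simp add: enn2real_positive_iff)
  assume Q: "0 < Q"
  show "enn2real (scale_integral m Q) = enn2real (scale_integral m 1) / sqrt (Q ^ m)"
    unfolding scale_integral_homogeneous[OF Q] enn2real_mult using Q by simp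
qed

lemma minv_unique:
  assumes A: "A \<in> carrier_mat n n" and B: "B \<in> carrier_mat n n" and AB: "A * B = 1\<^sub>m n"
  shows "minv A = B"
proof -
  have "det A * det B = 1" using det_mult[OF A B] AB by simp
  then have "det A \<noteq> 0" by auto
  note inv = det_nonzero_imp_inverse[OF A this]
  have "minv A * (A * B) = (minv A * A) * B" using A B inv(3) by (simp add: assoc_mult_mat[of _ n n _ n _ n])
  then show ?thesis using AB inv B by simp
qed

lemma positive_definite_smult:
  assumes A: "positive_definite n A" and s: "0 < s"
  shows "positive_definite n (s \<cdot>\<^sub>m A)"
proof -
  have Ac: "A \<in> carrier_mat n n" and At: "A\<^sup>T = A" using A by (auto simp: positive_definite_def)
  have "transpose_mat (s \<cdot>\<^sub>m A) = s \<cdot>\<^sub>m A\<^sup>T" by (rule eq_matI) auto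
  moreover have "0 < v \<bullet> ((s \<cdot>\<^sub>m A) *\<^sub>v v)" if v: "v \<in> carrier_vec n" "v \<noteq> 0\<^sub>v n" for v
  proof -
    have "0 < qform A v" using A v by (simp add: positive_definite_def qform_def)
    then have "0 < qform (s \<cdot>\<^sub>m A) v" unfolding qform_smult[OF Ac v(1)] using s by simp
    then show ?thesis by (simp only: qform_def)
  qed
  ultimately show ?thesis using Ac At by (simp add: positive_definite_def)
qed

lemma minv_smult:
  assumes A: "positive_definite n A" and s: "0 < s"
  shows "minv (s \<cdot>\<^sub>m A) = (1 / s) \<cdot>\<^sub>m minv A"
proof (rule minv_unique)
  note Ai = minv_positive_definite[OF A]
  have Ac: "A \<in> carrier_mat n n" using A by (auto simp: positive_definite_def)
  show "s \<cdot>\<^sub>m A \<in> carrier_mat n n" "(1 / s) \<cdot>\<^sub>m minv A \<in> carrier_mat n n" using Ac Ai by auto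
  have "s \<cdot>\<^sub>m A * ((1 / s) \<cdot>\<^sub>m minv A) = (1 / s) \<cdot>\<^sub>m (s \<cdot>\<^sub>m (A * minv A))"
    using Ac Ai(3) by (simp add: mult_smult_distrib[of _ n n _ n] mult_smult_assoc_mat[of _ n n _ n])
  also have "\<dots> = 1\<^sub>m n" unfolding Ai(1) using s by (intro eq_matI) auto
  finally show "s \<cdot>\<^sub>m A * ((1 / s) \<cdot>\<^sub>m minv A) = 1\<^sub>m n" .
qed

text \<open>For fixed \<open>s\<close>, completing the square makes the integral over \<open>\<beta>\<close> a Gaussian one with precision
  matrix \<open>M / s\<close>; Tonelli leaves the integral over \<open>s\<close>. If the quadratic form vanishes at \<open>y\<close>, the
  integral over \<open>s\<close> diverges and both sides are \<open>0\<close>.\<close>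

lemma integrated_likelihood_closed_form:
  assumes S: "positive_definite n S" and H: "H \<in> carrier_mat n p"
    and M: "positive_definite p (H\<^sup>T * minv S * H)"
    and n: "n = p + m" and y: "y \<in> carrier_vec n"
  shows "integrated_likelihood n p H S y =
     sqrt ((2 * pi) ^ p / det (H\<^sup>T * minv S * H)) / sqrt ((2 * pi) ^ n * det S) *
     enn2real (scale_integral m (qform (minv S - minv S * H * minv (H\<^sup>T * minv S * H) * H\<^sup>T * minv S) y))"
proof -
  define M where "M = H\<^sup>T * minv S * H"
  define P where "P = minv S - minv S * H * minv M * H\<^sup>T * minv S"
  define Q where "Q = qform P y"
  define C where "C = sqrt ((2 * pi) ^ p / det M) / sqrt ((2 * pi) ^ n * det S)"
  define b where "b = minv M *\<^sub>v (H\<^sup>T *\<^sub>v (minv S *\<^sub>v y))"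
  have pdM: "positive_definite p M" using assms by (simp add: M_def)
  note Si = minv_positive_definite[OF S] and Mi = minv_positive_definite[OF pdM]
  have Sc: "S \<in> carrier_mat n n" using S by (simp add: positive_definite_def)
  have Mc: "M \<in> carrier_mat p p" using pdM by (simp add: positive_definite_def)
  have Sisym: "transpose_mat (minv S) = minv S" using Si(4) by (simp add: positive_definite_def)
  have detS: "0 < det S" by (rule gaussian_total(2)[OF S Si(3) Si(2)])
  have detM: "0 < det M" by (rule gaussian_total(2)[OF pdM Mi(3) Mi(2)])
  have b: "b \<in> carrier_vec p" using Mi H Si y by (simp add: b_def)
  have C0: "0 \<le> C" using detS detM by (simp add: C_def)
  have square: "qform (minv S) (y - H *\<^sub>v \<beta>) = Q + qform M (\<beta> - b)" if "\<beta> \<in> carrier_vec p" for \<beta>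
    using complete_square[OF Si(3) Sisym H M[folded M_def, unfolded M_def] y that]
    by (simp add: Q_def P_def b_def flip: M_def)
  define f where "f \<beta> s = exp (- qform (minv S) (y - H *\<^sub>v \<beta>) / (2 * s)) / sqrt ((2 * pi) ^ n * (s ^ n * det S)) * (1 / s)" for \<beta> s
  have lik: "likelihood n H S y \<beta> s * (1 / s) = f \<beta> s" if "0 < s" "\<beta> \<in> carrier_vec p" for \<beta> s
  proof -
    have "y - H *\<^sub>v \<beta> \<in> carrier_vec n" using y H that by simp
    then show ?thesis
      using that Sc by (simp add: likelihood_def mvn_density_eq minv_smult[OF S] qform_smult[OF Si(3)] f_def mult.commute)
  qed
  let ?B = "restrict_space lborel {0<..} :: real measure"
  let ?N = "lborel_vec p \<Otimes>\<^sub>M ?B" and ?l = "\<lambda>(\<beta>, s). likelihood n H S y \<beta> s * (1 / s)"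
  interpret B: sigma_finite_measure ?B
    by (rule sigma_finite_measure_restrict_space) (auto intro: sigma_finite_lborel)
  interpret L: sigma_finite_measure "lborel_vec p" by (rule sigma_finite_lborel_vec)
  interpret pair_sigma_finite "lborel_vec p" ?B ..
  have fm: "(\<lambda>(\<beta>, s). f \<beta> s) \<in> borel_measurable ?N"
  proof -
    have snd [measurable]: "snd \<in> borel_measurable ?N"
      by (rule measurable_compose[OF measurable_snd]) (rule measurable_restrict_space1, simp)
    have "(\<lambda>x. y - H *\<^sub>v fst x) \<in> measurable ?N (lborel_vec n)"
      by (intro measurable_minus_vec measurable_mult_mat_vec[OF H] measurable_const_vec[OF y] measurable_fst)
    note [measurable] = measurable_qform[OF Si(3) this]
    show ?thesis unfolding f_def case_prod_beta by measurable
  qed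
  have lm: "?l \<in> borel_measurable ?N"
  proof -
    have "?l x = (\<lambda>(\<beta>, s). f \<beta> s) x"
      if "x \<in> space ?N" for x
      using that by (cases x) (simp only: space_pair_measure space_lborel_vec space_restrict_space mem_Times_iff fst_conv snd_conv prod.case,
        rule lik, auto)
    from measurable_cong[OF this] fm show ?thesis by (rule iffD2)
  qed
  have f0: "0 \<le> f \<beta> s" if "0 < s" for \<beta> s using that detS by (simp add: f_def)
  have "integrated_likelihood n p H S y =
      enn2real (\<integral>\<^sup>+ x. ennreal (?l x) \<partial>?N)"
    unfolding integrated_likelihood_def
  proof (rule integral_eq_nn_integral[OF lm])
    show "AE x in ?N. 0 \<le> ?l x"
    proof (rule AE_I2)
      fix x assume "x \<in> space ?N"
      then show "0 \<le> ?l x"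
        by (cases x) (simp add: space_pair_measure space_lborel_vec space_restrict_space lik f0 del: times_divide_eq_right mult_1_right)
    qed
  qed
  also have "(\<integral>\<^sup>+ x. ennreal (?l x) \<partial>?N) =
      (\<integral>\<^sup>+ x. ennreal (case x of (\<beta>, s) \<Rightarrow> f \<beta> s) \<partial>?N)"
  proof (rule nn_integral_cong)
    fix x assume "x \<in> space ?N"
    then show "ennreal (?l x) = ennreal (case x of (\<beta>, s) \<Rightarrow> f \<beta> s)"
      by (cases x) (simp add: space_pair_measure space_lborel_vec space_restrict_space lik del: times_divide_eq_right mult_1_right)
  qed
  also have "\<dots> = (\<integral>\<^sup>+ s. \<integral>\<^sup>+ \<beta>. ennreal (case (\<beta>, s) of (\<beta>, s) \<Rightarrow> f \<beta> s) \<partial>lborel_vec p \<partial>?B)"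
    by (rule nn_integral_snd[symmetric]) (use fm in measurable)
  also have "\<dots> = (\<integral>\<^sup>+ s. ennreal C * ennreal (1 / (sqrt (s ^ m) * s) * exp (- Q / (2 * s))) \<partial>?B)"
  proof (rule nn_integral_cong)
    fix s assume "s \<in> space ?B"
    then have s: "0 < s" by (simp add: space_restrict_space)
    define c where "c = exp (- Q / (2 * s)) / sqrt ((2 * pi) ^ n * (s ^ n * det S)) * (1 / s)"
    have c0: "0 \<le> c" using s detS by (simp add: c_def)
    have pdV: "positive_definite p (s \<cdot>\<^sub>m minv M)" by (rule positive_definite_smult[OF Mi(4) s])
    have inv: "((1 / s) \<cdot>\<^sub>m M) * (s \<cdot>\<^sub>m minv M) = 1\<^sub>m p"
    proof -
      have "((1 / s) \<cdot>\<^sub>m M) * (s \<cdot>\<^sub>m minv M) = s \<cdot>\<^sub>m ((1 / s) \<cdot>\<^sub>m (M * minv M))"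
        using Mc Mi(3) by (simp add: mult_smult_distrib[of _ p p _ p] mult_smult_assoc_mat[of _ p p _ p])
      also have "\<dots> = 1\<^sub>m p" unfolding Mi(1) using s by (intro eq_matI) auto
      finally show ?thesis .
    qed
    have sM: "(1 / s) \<cdot>\<^sub>m M \<in> carrier_mat p p" using Mc by simp
    have detMi: "det (minv M) = 1 / det M"
      using det_mult[OF Mc Mi(3)] Mi(1) detM by (simp add: field_simps)
    note [measurable] = measurable_qform_id[OF sM]
    have shift: "(\<lambda>\<beta>. \<beta> - b) \<in> measurable (lborel_vec p) (lborel_vec p)"
      by (rule measurable_minus_vec) (use b in \<open>auto intro: measurable_const_vec\<close>)
    have gm: "(\<lambda>v. gaussian_weight ((1 / s) \<cdot>\<^sub>m M) v) \<in> borel_measurable (lborel_vec p)" by measurable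
    have "(\<integral>\<^sup>+ \<beta>. ennreal (f \<beta> s) \<partial>lborel_vec p) =
        (\<integral>\<^sup>+ \<beta>. ennreal c * gaussian_weight ((1 / s) \<cdot>\<^sub>m M) (\<beta> - b) \<partial>lborel_vec p)"
    proof (rule nn_integral_cong)
      fix \<beta> assume "\<beta> \<in> space (lborel_vec p)"
      then have \<beta>: "\<beta> \<in> carrier_vec p" by (simp add: space_lborel_vec)
      have \<beta>b: "\<beta> - b \<in> carrier_vec p" using \<beta> b by simp
      have "- qform (minv S) (y - H *\<^sub>v \<beta>) / (2 * s) = - Q / (2 * s) + - qform ((1 / s) \<cdot>\<^sub>m M) (\<beta> - b) / 2"
        unfolding square[OF \<beta>] qform_smult[OF Mc \<beta>b] using s by (simp add: field_simps)
      then have "f \<beta> s = c * exp (- qform ((1 / s) \<cdot>\<^sub>m M) (\<beta> - b) / 2)"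
        unfolding f_def c_def by (simp only: exp_add) simp
      then show "ennreal (f \<beta> s) = ennreal c * gaussian_weight ((1 / s) \<cdot>\<^sub>m M) (\<beta> - b)"
        using c0 by (simp only: ennreal_mult'' exp_ge_zero)
    qed
    also have "\<dots> = ennreal c * (\<integral>\<^sup>+ \<beta>. gaussian_weight ((1 / s) \<cdot>\<^sub>m M) (\<beta> - b) \<partial>lborel_vec p)"
      by (rule nn_integral_cmult) (rule measurable_compose[OF shift gm])
    also have "(\<integral>\<^sup>+ \<beta>. gaussian_weight ((1 / s) \<cdot>\<^sub>m M) (\<beta> - b) \<partial>lborel_vec p) =
        (\<integral>\<^sup>+ \<beta>. gaussian_weight ((1 / s) \<cdot>\<^sub>m M) (\<beta> + b - b) \<partial>lborel_vec p)"
      by (rule nn_integral_lborel_vec_translate[OF b measurable_compose[OF shift gm], symmetric])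
    also have "\<dots> = (\<integral>\<^sup>+ \<beta>. gaussian_weight ((1 / s) \<cdot>\<^sub>m M) \<beta> \<partial>lborel_vec p)"
    proof (rule nn_integral_cong)
      fix \<beta> assume "\<beta> \<in> space (lborel_vec p)"
      then have "\<beta> + b - b = \<beta>" using b by (intro eq_vecI) (auto simp: space_lborel_vec)
      then show "gaussian_weight ((1 / s) \<cdot>\<^sub>m M) (\<beta> + b - b) = gaussian_weight ((1 / s) \<cdot>\<^sub>m M) \<beta>"
        by (simp only:)
    qed
    also have "\<dots> = ennreal (sqrt ((2 * pi) ^ p * (s ^ p * (1 / det M))))"
      using gaussian_total(1)[OF pdV sM inv] Mi(3) by (simp only: det_smult carrier_matD detMi)
    also have "ennreal c * \<dots> = ennreal (c * sqrt ((2 * pi) ^ p * (s ^ p * (1 / det M))))"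
      using s detM by (subst ennreal_mult''[symmetric]) auto
    also have "c * sqrt ((2 * pi) ^ p * (s ^ p * (1 / det M))) = C * (1 / (sqrt (s ^ m) * s) * exp (- Q / (2 * s)))"
    proof -
      have "sqrt ((2 * pi) ^ p * (s ^ p * (1 / det M))) = sqrt (s ^ p) * sqrt ((2 * pi) ^ p / det M)"
        by (simp only: real_sqrt_mult[symmetric]) (simp add: mult_ac)
      moreover have "sqrt ((2 * pi) ^ n * (s ^ n * det S)) = sqrt (s ^ p) * sqrt (s ^ m) * sqrt ((2 * pi) ^ n * det S)"
        by (simp only: real_sqrt_mult[symmetric]) (simp add: n power_add mult_ac)
      moreover have "sqrt (s ^ p) \<noteq> 0" using s by simp
      ultimately show ?thesis
        unfolding c_def C_def by (simp only:) (simp add: field_simps)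
    qed
    also have "ennreal \<dots> = ennreal C * ennreal (1 / (sqrt (s ^ m) * s) * exp (- Q / (2 * s)))"
      using C0 s by (intro ennreal_mult) auto
    finally show "(\<integral>\<^sup>+ \<beta>. ennreal (case (\<beta>, s) of (\<beta>, s) \<Rightarrow> f \<beta> s) \<partial>lborel_vec p) =
        ennreal C * ennreal (1 / (sqrt (s ^ m) * s) * exp (- Q / (2 * s)))" by simp
  qed
  also have "\<dots> = (\<integral>\<^sup>+ s. ennreal C * (ennreal (1 / (sqrt (s ^ m) * s) * exp (- Q / (2 * s))) * indicator {0<..} s) \<partial>lborel)"
    by (subst nn_integral_restrict_space) (auto simp: mult.assoc)
  also have "\<dots> = ennreal C * scale_integral m Q"
    unfolding scale_integral_def by (rule nn_integral_cmult) measurable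
  finally show ?thesis
    using C0 by (simp only: enn2real_mult enn2real_ennreal C_def Q_def P_def M_def)
qed

section \<open>Linear algebra of the regression model\<close>

lemma scalar_prod_self_pos:
  fixes v :: "real vec"
  assumes "v \<in> carrier_vec n" "v \<noteq> 0\<^sub>v n" shows "0 < v \<bullet> v"
proof -
  have "\<exists>i<n. v $ i \<noteq> 0"
  proof (rule ccontr)
    assume "\<not> ?thesis"
    then have "v = 0\<^sub>v n" using assms(1) by (intro eq_vecI) auto
    then show False using assms(2) by contradiction
  qed
  then obtain i where i: "i < n" "v $ i \<noteq> 0" by blast
  have "v \<bullet> v = (\<Sum>j<n. v $ j * v $ j)" using assms by (simp add: scalar_prod_def lessThan_atLeast0)
  also have "0 < \<dots>" by (rule sum_pos2[of _ i]) (use i in \<open>auto simp: zero_less_mult_iff\<close>)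
  finally show ?thesis .
qed

lemma mat_eq_by_mult_vec:
  fixes A B :: "real mat"
  assumes A: "A \<in> carrier_mat n k" and B: "B \<in> carrier_mat n k"
    and eq: "\<And>x. x \<in> carrier_vec k \<Longrightarrow> A *\<^sub>v x = B *\<^sub>v x"
  shows "A = B"
proof (rule eq_matI)
  fix i j assume "i < dim_row B" "j < dim_col B"
  then have ij: "i < n" "j < k" using B by auto
  have "(A *\<^sub>v unit_vec k j) $ i = (B *\<^sub>v unit_vec k j) $ i" using eq[of "unit_vec k j"] by simp
  then show "A $$ (i, j) = B $$ (i, j)" using ij A B by simp
qed (use A B in auto)

lemma full_column_rank_injective:
  fixes A :: "real mat"
  assumes A: "A \<in> carrier_mat n k" and rank: "vec_space.rank n A = k"
    and v: "v \<in> carrier_vec k" and Av: "A *\<^sub>v v = 0\<^sub>v n"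
  shows "v = 0\<^sub>v k"
proof (rule ccontr)
  assume nz: "v \<noteq> 0\<^sub>v k"
  interpret vec_space "TYPE(real)" n .
  have dist: "distinct (cols A)"
  proof (rule ccontr)
    assume nd: "\<not> distinct (cols A)"
    obtain S where S: "maximal S (\<lambda>T. T \<subseteq> set (cols A) \<and> lin_indpt T)"
      using maximal_exists[of "(\<lambda>T. T \<subseteq> set (cols A) \<and> lin_indpt T)" "card (set (cols A))" "{}"]
      by (meson List.finite_set card_mono empty_iff empty_subsetI finite_lin_indpt2 rev_finite_subset)
    then have "card S \<le> card (set (cols A))" by (simp add: card_mono maximal_def)
    also have "\<dots> < length (cols A)"
      using nd card_length[of "cols A"] card_distinct[of "cols A"] by linarith
    also have "\<dots> = k" using A by simp
    finally show False using rank_card_indpt[OF A S] rank by simp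
  qed
  show False
    using lin_depI[OF A v nz Av dist] full_rank_lin_indpt[OF A rank dist] by contradiction
qed

lemma gram_positive_definite:
  assumes S: "positive_definite n S" and A: "A \<in> carrier_mat n k"
    and inj: "\<And>v. v \<in> carrier_vec k \<Longrightarrow> A *\<^sub>v v = 0\<^sub>v n \<Longrightarrow> v = 0\<^sub>v k"
  shows "positive_definite k (A\<^sup>T * S * A)"
  unfolding positive_definite_def
proof (intro conjI ballI impI)
  have Sc: "S \<in> carrier_mat n n" and Ssym: "S\<^sup>T = S" using S by (auto simp: positive_definite_def)
  have At: "A\<^sup>T \<in> carrier_mat k n" using A by simp
  show "A\<^sup>T * S * A \<in> carrier_mat k k" using A Sc by simp
  show "transpose_mat (A\<^sup>T * S * A) = A\<^sup>T * S * A"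
    using transpose_mult[OF mult_carrier_mat[OF At Sc] A] transpose_mult[OF At Sc] assoc_mult_mat[OF At Sc A] Ssym
    by simp
  fix v :: "real vec" assume v: "v \<in> carrier_vec k" "v \<noteq> 0\<^sub>v k"
  have "A *\<^sub>v v \<noteq> 0\<^sub>v n" using inj v by blast
  then have "0 < qform S (A *\<^sub>v v)" using S A v by (auto simp: positive_definite_def qform_def)
  then show "0 < v \<bullet> (A\<^sup>T * S * A *\<^sub>v v)"
    using qform_congruence[OF Sc A v(1)] by (simp add: qform_def)
qed

text \<open>A positive semidefinite form that vanishes at \<open>v\<close> satisfies \<open>A v = 0\<close>: otherwise it would take
  negative values on the line through \<open>v\<close> in the direction of \<open>A v\<close>.\<close>

lemma invertible_correlation_positive_definite:
  assumes "correlation_matrix n A" "invertible_mat A"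
  shows "positive_definite n A"
  unfolding positive_definite_def
proof (intro conjI ballI impI)
  show A: "A \<in> carrier_mat n n" and sym: "A\<^sup>T = A"
    using assms(1) by (auto simp: correlation_matrix_def)
  have psd: "0 \<le> qform A v" if "v \<in> carrier_vec n" for v
    using assms(1) that by (auto simp: correlation_matrix_def qform_def)
  fix v :: "real vec" assume v: "v \<in> carrier_vec n" "v \<noteq> 0\<^sub>v n"
  have "qform A v \<noteq> 0"
  proof
    assume q0: "qform A v = 0"
    define w where "w = A *\<^sub>v v"
    have w: "w \<in> carrier_vec n" using A v by (simp add: w_def)
    have "w \<noteq> 0\<^sub>v n"
    proof
      assume w0: "w = 0\<^sub>v n"
      have "\<exists>B. inverts_mat A B \<and> inverts_mat B A" using assms(2) by (auto simp: invertible_mat_def)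
      then obtain B where B: "A * B = 1\<^sub>m (dim_row A)" "B * A = 1\<^sub>m (dim_row B)" by (auto simp: inverts_mat_def)
      have "dim_col (A * B) = dim_row A" unfolding B(1) by simp
      moreover have "dim_col (B * A) = dim_row B" unfolding B(2) by simp
      ultimately have Bc: "B \<in> carrier_mat n n" using A by (intro carrier_matI) auto
      have "v = (B * A) *\<^sub>v v" using B(2) Bc v by simp
      also have "\<dots> = B *\<^sub>v w" unfolding w_def by (rule assoc_mult_mat_vec[OF Bc A v(1)])
      also have "\<dots> = 0\<^sub>v n" unfolding w0 using Bc by (intro eq_vecI) auto
      finally have "v = 0\<^sub>v n" .
      with v(2) show False by contradiction
    qed
    then have ww: "0 < w \<bullet> w" by (rule scalar_prod_self_pos[OF w])
    have key: "0 \<le> - 2 * t * (w \<bullet> w) + t\<^sup>2 * qform A w" for t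
    proof -
      have tw: "t \<cdot>\<^sub>v w \<in> carrier_vec n" using w by simp
      have "qform A (t \<cdot>\<^sub>v w) = t\<^sup>2 * qform A w"
        using w A by (simp add: qform_eq_sum[of A n] sum_distrib_left power2_eq_square mult_ac)
      moreover have "(t \<cdot>\<^sub>v w) \<bullet> (A *\<^sub>v v) = t * (w \<bullet> w)" using w by (simp flip: w_def)
      moreover have "0 \<le> qform A (v - t \<cdot>\<^sub>v w)" by (rule psd) (use v tw in simp)
      ultimately show ?thesis unfolding qform_diff[OF A sym v(1) tw] q0 by simp
    qed
    show False
    proof (cases "qform A w = 0")
      case True
      then show False using key[of 1] ww by simp
    next
      case False
      then have qw: "0 < qform A w" using psd[OF w] by simp
      have "- 2 * ((w \<bullet> w) / qform A w) * (w \<bullet> w) + ((w \<bullet> w) / qform A w)\<^sup>2 * qform A w = - ((w \<bullet> w)\<^sup>2 / qform A w)"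
        using qw by (simp add: field_simps power2_eq_square)
      then have "0 \<le> - ((w \<bullet> w)\<^sup>2 / qform A w)" using key[of "(w \<bullet> w) / qform A w"] by simp
      moreover have "0 < (w \<bullet> w)\<^sup>2 / qform A w" using ww qw by simp
      ultimately show False by simp
    qed
  qed
  then show "0 < v \<bullet> (A *\<^sub>v v)" using psd[OF v(1)] by (simp add: qform_def)
qed

lemma col_space_orthogonal:
  fixes H W :: "real mat"
  assumes H: "H \<in> carrier_mat n p" and W: "W \<in> carrier_mat n m"
    and orth: "vec_space.col_space n W = vec_module.orthogonal_complement n (vec_space.col_space n H)"
  shows "W\<^sup>T * H = 0\<^sub>m m p"
    and "\<And>u. u \<in> carrier_vec n \<Longrightarrow> H\<^sup>T *\<^sub>v u = 0\<^sub>v p \<Longrightarrow> \<exists>a\<in>carrier_vec m. u = W *\<^sub>v a"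
proof -
  interpret vec_space "TYPE(real)" n .
  have colW: "col_space W = {y \<in> carrier_vec n. \<exists>x\<in>carrier_vec m. W *\<^sub>v x = y}" using col_space_eq[OF W] W by simp
  have colH: "col_space H = {y \<in> carrier_vec n. \<exists>x\<in>carrier_vec p. H *\<^sub>v x = y}" using col_space_eq[OF H] H by simp
  show "W\<^sup>T * H = 0\<^sub>m m p"
  proof (rule eq_matI)
    fix i j assume "i < dim_row (0\<^sub>m m p :: real mat)" "j < dim_col (0\<^sub>m m p :: real mat)"
    then have ij: "i < m" "j < p" by auto
    have "col W i = W *\<^sub>v unit_vec m i" "col H j = H *\<^sub>v unit_vec p j"
      using ij W H by (auto intro!: eq_vecI)
    then have "col W i \<in> col_space W" "col H j \<in> col_space H"
      using W H ij unfolding colW colH by auto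
    then have "col W i \<bullet> col H j = 0" unfolding orth orthogonal_complement_def by blast
    then show "(W\<^sup>T * H) $$ (i, j) = 0\<^sub>m m p $$ (i, j)" using ij W H by simp
  qed (use W H in auto)
  fix u assume u: "u \<in> carrier_vec n" and Hu: "H\<^sup>T *\<^sub>v u = 0\<^sub>v p"
  have "u \<bullet> h = 0" if "h \<in> col_space H" for h
  proof -
    from that have "\<exists>x\<in>carrier_vec p. H *\<^sub>v x = h" unfolding colH by blast
    then obtain x where x: "x \<in> carrier_vec p" "h = H *\<^sub>v x" by blast
    have "u \<bullet> h = (H\<^sup>T *\<^sub>v u) \<bullet> x"
      unfolding x(2) by (rule transpose_vec_mult_scalar[OF H x(1) u, symmetric])
    also have "\<dots> = 0" unfolding Hu using x by simp
    finally show ?thesis .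
  qed
  then have "u \<in> col_space W" unfolding orth orthogonal_complement_def using u by blast
  then show "\<exists>a\<in>carrier_vec m. u = W *\<^sub>v a" unfolding colW by auto
qed

text \<open>Applied to \<open>x\<close>, the left-hand side gives a vector \<open>u\<close> with \<open>H\<^sup>T u = 0\<close>, hence \<open>u = W a\<close> for some \<open>a\<close>.
  As \<open>S u\<close> differs from \<open>x\<close> by a vector \<open>H b\<close> and \<open>W\<^sup>T H = 0\<close>, it follows that
  \<open>W\<^sup>T S W a = W\<^sup>T x\<close>, which determines \<open>a\<close>.\<close>

lemma kriging_projection_identity:
  assumes S: "positive_definite n S"
    and H: "H \<in> carrier_mat n p" and W: "W \<in> carrier_mat n m"
    and M: "positive_definite p (H\<^sup>T * minv S * H)"
    and G: "positive_definite m (W\<^sup>T * S * W)"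
    and orth: "vec_space.col_space n W = vec_module.orthogonal_complement n (vec_space.col_space n H)"
  shows "minv S - minv S * H * minv (H\<^sup>T * minv S * H) * H\<^sup>T * minv S =
     W * minv (W\<^sup>T * S * W) * W\<^sup>T" (is "?P = ?R")
proof -
  define M' where "M' = H\<^sup>T * minv S * H"
  define G' where "G' = W\<^sup>T * S * W"
  note Si = minv_positive_definite[OF S] and Mi = minv_positive_definite[OF M, folded M'_def] and Gi = minv_positive_definite[OF G, folded G'_def]
  have Sc: "S \<in> carrier_mat n n" using S by (simp add: positive_definite_def)
  have Ht: "H\<^sup>T \<in> carrier_mat p n" and Wt: "W\<^sup>T \<in> carrier_mat m n" using H W by auto
  have Mc: "M' \<in> carrier_mat p p" and Gc: "G' \<in> carrier_mat m m" using M G by (simp_all add: positive_definite_def M'_def G'_def)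
  note WH = col_space_orthogonal(1)[OF H W orth] and span = col_space_orthogonal(2)[OF H W orth]
  have X: "minv S * H * minv M' * H\<^sup>T * minv S \<in> carrier_mat n n" using Si H Mi by auto
  show ?thesis
    unfolding M'_def[symmetric] G'_def[symmetric]
  proof (rule mat_eq_by_mult_vec[of _ n n])
    show "minv S - minv S * H * minv M' * H\<^sup>T * minv S \<in> carrier_mat n n" by (rule minus_carrier_mat[OF X])
    show "W * minv G' * W\<^sup>T \<in> carrier_mat n n" using W Gi(3) by simp
    fix x :: "real vec" assume x: "x \<in> carrier_vec n"
    define s where "s = minv S *\<^sub>v x"
    define h where "h = H\<^sup>T *\<^sub>v s"
    define b where "b = minv M' *\<^sub>v h"
    define u where "u = minv S *\<^sub>v (x - H *\<^sub>v b)"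
    have s: "s \<in> carrier_vec n" using Si x by (simp add: s_def)
    have h: "h \<in> carrier_vec p" using Ht s by (simp add: h_def)
    have b: "b \<in> carrier_vec p" using Mi h by (simp add: b_def)
    have Hb: "H *\<^sub>v b \<in> carrier_vec n" using H b by simp
    have xHb: "x - H *\<^sub>v b \<in> carrier_vec n" using x Hb by simp
    have u: "u \<in> carrier_vec n" using Si xHb by (simp add: u_def)
    have Pu: "(minv S - minv S * H * minv M' * H\<^sup>T * minv S) *\<^sub>v x = u"
    proof -
      have 1: "minv S * H \<in> carrier_mat n p" "minv S * H * minv M' \<in> carrier_mat n p" "minv S * H * minv M' * H\<^sup>T \<in> carrier_mat n n"
        using Si H Mi by auto
      have "(minv S * H * minv M' * H\<^sup>T * minv S) *\<^sub>v x = minv S *\<^sub>v (H *\<^sub>v b)"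
        unfolding assoc_mult_mat_vec[OF 1(3) Si(3) x] s_def[symmetric] assoc_mult_mat_vec[OF 1(2) Ht s] h_def[symmetric]
          assoc_mult_mat_vec[OF 1(1) Mi(3) h] b_def[symmetric] assoc_mult_mat_vec[OF Si(3) H b] ..
      then show ?thesis
        unfolding minus_mult_distrib_mat_vec[OF Si(3) X x] u_def mult_minus_distrib_mat_vec[OF Si(3) x Hb] by simp
    qed
    have Sx: "minv S *\<^sub>v (H *\<^sub>v b) \<in> carrier_vec n" using Si Hb by simp
    have "H\<^sup>T *\<^sub>v u = 0\<^sub>v p"
    proof -
      have "H\<^sup>T *\<^sub>v (minv S *\<^sub>v (H *\<^sub>v b)) = M' *\<^sub>v b"
        unfolding M'_def using assoc_mult_mat_vec[OF mult_carrier_mat[OF Ht Si(3)] H b] assoc_mult_mat_vec[OF Ht Si(3) Hb] by simp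
      also have "\<dots> = h" unfolding b_def assoc_mult_mat_vec[OF Mc Mi(3) h, symmetric] Mi(1) using h by simp
      finally have 1: "H\<^sup>T *\<^sub>v (minv S *\<^sub>v (H *\<^sub>v b)) = h" .
      have "H\<^sup>T *\<^sub>v u = h - h"
        unfolding u_def mult_minus_distrib_mat_vec[OF Si(3) x Hb] s_def[symmetric]
          mult_minus_distrib_mat_vec[OF Ht s Sx] 1 h_def ..
      then show ?thesis using h by simp
    qed
    from span[OF u this] obtain a where a: "a \<in> carrier_vec m" "u = W *\<^sub>v a" by blast
    have Su: "S *\<^sub>v u = x - H *\<^sub>v b"
      unfolding u_def assoc_mult_mat_vec[OF Sc Si(3) xHb, symmetric] Si(1) using xHb by simp
    have "G' *\<^sub>v a = W\<^sup>T *\<^sub>v (S *\<^sub>v u)"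
      unfolding G'_def a(2) using assoc_mult_mat_vec[OF mult_carrier_mat[OF Wt Sc] W a(1)] assoc_mult_mat_vec[OF Wt Sc] W a by simp
    also have "\<dots> = W\<^sup>T *\<^sub>v x - W\<^sup>T *\<^sub>v (H *\<^sub>v b)"
      unfolding Su by (rule mult_minus_distrib_mat_vec[OF Wt x Hb])
    also have "W\<^sup>T *\<^sub>v (H *\<^sub>v b) = 0\<^sub>v m"
      unfolding assoc_mult_mat_vec[OF Wt H b, symmetric] WH using b by (intro eq_vecI) auto
    also have "W\<^sup>T *\<^sub>v x - 0\<^sub>v m = W\<^sup>T *\<^sub>v x" using Wt x by simp
    finally have Ga: "G' *\<^sub>v a = W\<^sup>T *\<^sub>v x" .
    have "a = minv G' *\<^sub>v (G' *\<^sub>v a)" unfolding assoc_mult_mat_vec[OF Gi(3) Gc a(1), symmetric] Gi(2) using a by simp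
    then have "u = W *\<^sub>v (minv G' *\<^sub>v (W\<^sup>T *\<^sub>v x))" using a Ga by simp
    also have "\<dots> = (W * minv G' * W\<^sup>T) *\<^sub>v x"
    proof -
      have "W\<^sup>T *\<^sub>v x \<in> carrier_vec m" using Wt x by simp
      then show ?thesis
        using assoc_mult_mat_vec[OF mult_carrier_mat[OF W Gi(3)] Wt x] assoc_mult_mat_vec[OF W Gi(3)] by simp
    qed
    finally show "(minv S - minv S * H * minv M' * H\<^sup>T * minv S) *\<^sub>v x = (W * minv G' * W\<^sup>T) *\<^sub>v x"
      unfolding Pu .
  qed
qed

section \<open>Differentiation of matrix-valued functions\<close>

definition has_mat_derivative :: "nat \<Rightarrow> nat \<Rightarrow> (real \<Rightarrow> real mat) \<Rightarrow> real mat \<Rightarrow> real \<Rightarrow> bool" where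
  "has_mat_derivative r c F F' \<theta> \<longleftrightarrow>
     (\<forall>i<r. \<forall>j<c. ((\<lambda>t. F t $$ (i, j)) has_real_derivative F' $$ (i, j)) (at \<theta>))"

lemma has_mat_derivative_mult:
  assumes I: "open I" "\<theta> \<in> I"
    and F: "\<And>t. t \<in> I \<Longrightarrow> F t \<in> carrier_mat r k" and G: "\<And>t. t \<in> I \<Longrightarrow> G t \<in> carrier_mat k c"
    and F': "F' \<in> carrier_mat r k" and G': "G' \<in> carrier_mat k c"
    and dF: "has_mat_derivative r k F F' \<theta>" and dG: "has_mat_derivative k c G G' \<theta>"
  shows "has_mat_derivative r c (\<lambda>t. F t * G t) (F' * G \<theta> + F \<theta> * G') \<theta>"
  unfolding has_mat_derivative_def
proof (intro allI impI)
  fix i j assume ij: "i < r" "j < c"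
  have "((\<lambda>t. \<Sum>l<k. F t $$ (i, l) * G t $$ (l, j)) has_real_derivative
      (\<Sum>l<k. F' $$ (i, l) * G \<theta> $$ (l, j) + G' $$ (l, j) * F \<theta> $$ (i, l))) (at \<theta>)"
    using dF dG ij by (intro DERIV_sum DERIV_mult) (auto simp: has_mat_derivative_def)
  moreover have "(\<Sum>l<k. F t $$ (i, l) * G t $$ (l, j)) = (F t * G t) $$ (i, j)" if "t \<in> I" for t
    using F[OF that] G[OF that] ij by (simp add: scalar_prod_def lessThan_atLeast0)
  moreover have "(\<Sum>l<k. F' $$ (i, l) * G \<theta> $$ (l, j) + G' $$ (l, j) * F \<theta> $$ (i, l)) = (F' * G \<theta> + F \<theta> * G') $$ (i, j)"
    using F[OF I(2)] G[OF I(2)] F' G' ij by (simp add: scalar_prod_def lessThan_atLeast0 sum.distrib mult.commute)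
  ultimately show "((\<lambda>t. (F t * G t) $$ (i, j)) has_real_derivative (F' * G \<theta> + F \<theta> * G') $$ (i, j)) (at \<theta>)"
    using has_field_derivative_transform_within_open[OF _ I, of "\<lambda>t. \<Sum>l<k. F t $$ (i, l) * G t $$ (l, j)"] by simp
qed

lemma has_mat_derivative_const: "A \<in> carrier_mat r c \<Longrightarrow> has_mat_derivative r c (\<lambda>_. A) (0\<^sub>m r c) \<theta>"
  by (simp add: has_mat_derivative_def)

lemma has_mat_derivative_congruence:
  assumes I: "open I" "\<theta> \<in> I" and F: "\<And>t. t \<in> I \<Longrightarrow> F t \<in> carrier_mat n n" and F': "F' \<in> carrier_mat n n"
    and dF: "has_mat_derivative n n F F' \<theta>" and A: "A \<in> carrier_mat n k"
  shows "has_mat_derivative k k (\<lambda>t. A\<^sup>T * F t * A) (A\<^sup>T * F' * A) \<theta>"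
proof -
  have At: "A\<^sup>T \<in> carrier_mat k n" using A by simp
  have 1: "has_mat_derivative k n (\<lambda>t. A\<^sup>T * F t) (A\<^sup>T * F') \<theta>"
    using has_mat_derivative_mult[OF I At F zero_carrier_mat F' has_mat_derivative_const[OF At] dF] F[OF I(2)] At F'
    by (simp add: left_mult_zero_mat[of _ n n] left_add_zero_mat[of _ k n])
  show ?thesis
    using has_mat_derivative_mult[OF I mult_carrier_mat[OF At F] A mult_carrier_mat[OF At F'] zero_carrier_mat 1 has_mat_derivative_const[OF A]]
      F[OF I(2)] At F' A by (simp add: right_mult_zero_mat[of _ k n] right_add_zero_mat[of _ k k])
qed

lemma differentiable_prod_real:
  fixes f :: "'a \<Rightarrow> real \<Rightarrow> real"
  assumes "finite A" "\<And>i. i \<in> A \<Longrightarrow> f i differentiable (at x)"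
  shows "(\<lambda>t. \<Prod>i\<in>A. f i t) differentiable (at x)"
  using assms by (induction A rule: finite_induct) (auto intro!: differentiable_mult)

lemma det_differentiable:
  fixes F :: "real \<Rightarrow> real mat"
  assumes I: "open I" "\<theta> \<in> I" and F: "\<And>t. t \<in> I \<Longrightarrow> F t \<in> carrier_mat n n"
    and d: "\<And>i j. i < n \<Longrightarrow> j < n \<Longrightarrow> (\<lambda>t. F t $$ (i, j)) differentiable (at \<theta>)"
  shows "(\<lambda>t. det (F t)) differentiable (at \<theta>)"
proof -
  let ?f = "\<lambda>t. \<Sum>q | q permutes {0..<n}. signof q * (\<Prod>i = 0..<n. F t $$ (i, q i))"
  have "?f differentiable (at \<theta>)"
  proof (rule differentiable_sum)
    show "finite {q. q permutes {0..<n}}" by (rule finite_permutations) simp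
    show "\<forall>q\<in>{q. q permutes {0..<n}}. (\<lambda>t. signof q * (\<Prod>i = 0..<n. F t $$ (i, q i))) differentiable (at \<theta>)"
    proof (intro ballI differentiable_mult differentiable_const differentiable_prod_real)
      fix q i assume "q \<in> {q. q permutes {0..<n}}" "i \<in> {0..<n}"
      then show "(\<lambda>t. F t $$ (i, q i)) differentiable (at \<theta>)"
        using d by (metis atLeastLessThan_iff le0 mem_Collect_eq permutes_in_image)
    qed simp
  qed
  then obtain D where "(?f has_real_derivative D) (at \<theta>)" by (auto simp: real_differentiable_def)
  moreover have "?f t = det (F t)" if "t \<in> I" for t
    using det_def'[OF F[OF that]] by simp
  ultimately have "((\<lambda>t. det (F t)) has_real_derivative D) (at \<theta>)"
    by (rule has_field_derivative_transform_within_open[OF _ I])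
  then show ?thesis by (auto simp: real_differentiable_def)
qed

lemma minv_eq_adjugate:
  assumes A: "A \<in> carrier_mat n n" and "det A \<noteq> 0"
  shows "minv A = (1 / det A) \<cdot>\<^sub>m adj_mat A"
proof (rule minv_unique[OF A])
  note adj = adj_mat[OF A]
  show "(1 / det A) \<cdot>\<^sub>m adj_mat A \<in> carrier_mat n n" using adj by simp
  have "A * ((1 / det A) \<cdot>\<^sub>m adj_mat A) = (1 / det A) \<cdot>\<^sub>m (det A \<cdot>\<^sub>m 1\<^sub>m n)"
    unfolding mult_smult_distrib[OF A adj(1)] adj(2) ..
  also have "\<dots> = 1\<^sub>m n" using assms by (intro eq_matI) auto
  finally show "A * ((1 / det A) \<cdot>\<^sub>m adj_mat A) = 1\<^sub>m n" .
qed

text \<open>By Cramer's rule the entries of the inverse are quotients of determinants.\<close>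

lemma minv_differentiable:
  fixes F :: "real \<Rightarrow> real mat"
  assumes I: "open I" "\<theta> \<in> I" and F: "\<And>t. t \<in> I \<Longrightarrow> F t \<in> carrier_mat n n"
    and det: "\<And>t. t \<in> I \<Longrightarrow> det (F t) \<noteq> 0"
    and d: "\<And>i j. i < n \<Longrightarrow> j < n \<Longrightarrow> (\<lambda>t. F t $$ (i, j)) differentiable (at \<theta>)"
    and ij: "i < n" "j < n"
  shows "(\<lambda>t. minv (F t) $$ (i, j)) differentiable (at \<theta>)"
proof -
  let ?f = "\<lambda>t. (1 / det (F t)) * ((- 1) ^ (j + i) * det (mat_delete (F t) j i))"
  have ddet: "(\<lambda>t. det (F t)) differentiable (at \<theta>)" by (rule det_differentiable[OF I F d])
  have "(\<lambda>t. det (mat_delete (F t) j i)) differentiable (at \<theta>)"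
  proof (rule det_differentiable[OF I])
    show "mat_delete (F t) j i \<in> carrier_mat (n - 1) (n - 1)" if "t \<in> I" for t
      by (rule mat_delete_carrier[OF F[OF that]])
    fix i' j' assume ij': "i' < n - 1" "j' < n - 1"
    define a b where "a = (if i' < j then i' else Suc i')" and "b = (if j' < i then j' else Suc j')"
    have ab: "a < n" "b < n" using ij' by (auto simp: a_def b_def)
    obtain D where "((\<lambda>t. F t $$ (a, b)) has_real_derivative D) (at \<theta>)"
      using d[OF ab] by (auto simp: real_differentiable_def)
    moreover have "F t $$ (a, b) = mat_delete (F t) j i $$ (i', j')" if "t \<in> I" for t
      using F[OF that] ij' by (simp add: mat_delete_def a_def b_def)
    ultimately have "((\<lambda>t. mat_delete (F t) j i $$ (i', j')) has_real_derivative D) (at \<theta>)"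
      by (rule has_field_derivative_transform_within_open[OF _ I])
    then show "(\<lambda>t. mat_delete (F t) j i $$ (i', j')) differentiable (at \<theta>)" by (auto simp: real_differentiable_def)
  qed
  then have "?f differentiable (at \<theta>)"
    using ddet det[OF I(2)] by (intro differentiable_mult differentiable_divide differentiable_const) auto
  then obtain D where "(?f has_real_derivative D) (at \<theta>)" by (auto simp: real_differentiable_def)
  moreover have "?f t = minv (F t) $$ (i, j)" if "t \<in> I" for t
    using minv_eq_adjugate[OF F det] that F[OF that] ij by (simp add: adj_mat_def cofactor_def)
  ultimately have "((\<lambda>t. minv (F t) $$ (i, j)) has_real_derivative D) (at \<theta>)"
    by (rule has_field_derivative_transform_within_open[OF _ I])
  then show ?thesis by (auto simp: real_differentiable_def)
qed

text \<open>Differentiate \<open>F\<^sup>-\<^sup>1 F = 1\<close> and solve for the derivative of \<open>F\<^sup>-\<^sup>1\<close>.\<close>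

lemma has_mat_derivative_minv:
  assumes I: "open I" "\<theta> \<in> I" and F: "\<And>t. t \<in> I \<Longrightarrow> F t \<in> carrier_mat n n"
    and det: "\<And>t. t \<in> I \<Longrightarrow> det (F t) \<noteq> 0"
    and F': "F' \<in> carrier_mat n n" and dF: "has_mat_derivative n n F F' \<theta>"
  shows "has_mat_derivative n n (\<lambda>t. minv (F t)) (- (minv (F \<theta>) * F' * minv (F \<theta>))) \<theta>"
proof -
  note inv = det_nonzero_imp_inverse[OF F det]
  define X' where "X' = mat n n (\<lambda>(i, j). deriv (\<lambda>t. minv (F t) $$ (i, j)) \<theta>)"
  have X': "X' \<in> carrier_mat n n" by (simp add: X'_def)
  have "(\<lambda>t. F t $$ (i, j)) differentiable (at \<theta>)" if "i < n" "j < n" for i j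
    using dF that by (auto simp: has_mat_derivative_def real_differentiable_def)
  from minv_differentiable[OF I F det this]
  have dX: "has_mat_derivative n n (\<lambda>t. minv (F t)) X' \<theta>"
    by (auto simp: has_mat_derivative_def X'_def DERIV_deriv_iff_real_differentiable)
  have Fc: "F \<theta> \<in> carrier_mat n n" and Xc: "minv (F \<theta>) \<in> carrier_mat n n" using F inv(3) I(2) by auto
  have XF: "has_mat_derivative n n (\<lambda>t. minv (F t) * F t) (X' * F \<theta> + minv (F \<theta>) * F') \<theta>"
    by (rule has_mat_derivative_mult[OF I inv(3) F X' F' dX dF])
  have zero: "X' * F \<theta> + minv (F \<theta>) * F' = 0\<^sub>m n n"
  proof (rule eq_matI)
    fix i j assume "i < dim_row (0\<^sub>m n n :: real mat)" "j < dim_col (0\<^sub>m n n :: real mat)"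
    then have ij: "i < n" "j < n" by auto
    have "((\<lambda>_. 1\<^sub>m n $$ (i, j)) has_real_derivative (X' * F \<theta> + minv (F \<theta>) * F') $$ (i, j)) (at \<theta>)"
    proof (rule has_field_derivative_transform_within_open[OF _ I])
      show "((\<lambda>t. (minv (F t) * F t) $$ (i, j)) has_real_derivative (X' * F \<theta> + minv (F \<theta>) * F') $$ (i, j)) (at \<theta>)"
        using XF ij unfolding has_mat_derivative_def by blast
      fix t assume "t \<in> I"
      then show "(minv (F t) * F t) $$ (i, j) = 1\<^sub>m n $$ (i, j)" by (simp only: inv(2))
    qed
    from DERIV_unique[OF this DERIV_const] show "(X' * F \<theta> + minv (F \<theta>) * F') $$ (i, j) = 0\<^sub>m n n $$ (i, j)"
      using ij by simp
  qed (use X' Fc Xc F' in auto)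
  have YFc: "minv (F \<theta>) * F' \<in> carrier_mat n n" using Xc F' by auto
  have "X' * F \<theta> = - (minv (F \<theta>) * F')"
  proof (rule eq_matI)
    fix i j assume "i < dim_row (- (minv (F \<theta>) * F'))" "j < dim_col (- (minv (F \<theta>) * F'))"
    then have ij: "i < n" "j < n" using Xc F' by auto
    have "(X' * F \<theta> + minv (F \<theta>) * F') $$ (i, j) = 0" using zero ij by simp
    moreover have "(X' * F \<theta> + minv (F \<theta>) * F') $$ (i, j) = (X' * F \<theta>) $$ (i, j) + (minv (F \<theta>) * F') $$ (i, j)"
      by (rule index_add_mat(1)) (use YFc ij in auto)
    moreover have "(- (minv (F \<theta>) * F')) $$ (i, j) = - ((minv (F \<theta>) * F') $$ (i, j))"
      by (rule index_uminus_mat(1)) (use YFc ij in auto)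
    ultimately show "(X' * F \<theta>) $$ (i, j) = (- (minv (F \<theta>) * F')) $$ (i, j)" by linarith
  qed (use X' Fc Xc F' in auto)
  then have "X' * F \<theta> * minv (F \<theta>) = - (minv (F \<theta>) * F') * minv (F \<theta>)" by (simp only:)
  also have "X' * F \<theta> * minv (F \<theta>) = X'"
    unfolding assoc_mult_mat[OF X' Fc Xc] inv(1)[OF I(2) I(2)] using X' by simp
  also have "- (minv (F \<theta>) * F') * minv (F \<theta>) = - (minv (F \<theta>) * F' * minv (F \<theta>))"
    by (rule uminus_mult_left_mat) (use YFc Xc in auto)
  finally show ?thesis using dX by simp
qed

lemma has_real_derivative_qform:
  assumes I: "open I" "\<theta> \<in> I" and F: "\<And>t. t \<in> I \<Longrightarrow> F t \<in> carrier_mat n n"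
    and F': "F' \<in> carrier_mat n n" and dF: "has_mat_derivative n n F F' \<theta>" and z: "z \<in> carrier_vec n"
  shows "((\<lambda>t. qform (F t) z) has_real_derivative qform F' z) (at \<theta>)"
proof (rule has_field_derivative_transform_within_open[OF _ I])
  show "((\<lambda>t. \<Sum>i<n. \<Sum>j<n. F t $$ (i, j) * (z $ i * z $ j)) has_real_derivative qform F' z) (at \<theta>)"
    unfolding qform_eq_sum[OF F' z]
    using dF by (intro DERIV_sum DERIV_cmult_right) (auto simp: has_mat_derivative_def)
  show "(\<Sum>i<n. \<Sum>j<n. F t $$ (i, j) * (z $ i * z $ j)) = qform (F t) z" if "t \<in> I" for t
    by (rule qform_eq_sum[OF F[OF that] z, symmetric])
qed

lemma mtrace_square_swap:
  assumes X: "X \<in> carrier_mat n k" and Y: "Y \<in> carrier_mat k n"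
  shows "mtrace (X * Y * (X * Y)) = mtrace (Y * X * (Y * X))"
proof -
  have YX: "Y * X \<in> carrier_mat k k" and YXY: "Y * (X * Y) \<in> carrier_mat k n" using X Y by auto
  have "X * Y * (X * Y) = X * (Y * (X * Y))" by (rule assoc_mult_mat[OF X Y mult_carrier_mat[OF X Y]])
  then have "mtrace (X * Y * (X * Y)) = mtrace (Y * (X * Y) * X)" using mtrace_mult_comm[OF X YXY] by simp
  also have "Y * (X * Y) * X = Y * X * (Y * X)"
    unfolding assoc_mult_mat[OF Y X Y, symmetric] by (rule assoc_mult_mat[OF YX Y X])
  finally show ?thesis .
qed

section \<open>The score and the reference prior\<close>

locale universal_kriging =
  fixes n p m :: nat and H W :: "real mat" and I :: "real set" and \<Sigma> :: "real \<Rightarrow> real mat"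
  assumes n_eq: "n = p + m" and m_pos: "0 < m"
    and H: "H \<in> carrier_mat n p" and rank_H: "vec_space.rank n H = p"
    and I: "open I"
    and \<Sigma>_correlation: "\<And>t. t \<in> I \<Longrightarrow> correlation_matrix n (\<Sigma> t)"
    and \<Sigma>_invertible: "\<And>t. t \<in> I \<Longrightarrow> invertible_mat (\<Sigma> t)"
    and \<Sigma>_differentiable: "mat_differentiable_on n \<Sigma> I"
    and W: "W \<in> carrier_mat n m" and rank_W: "vec_space.rank n W = m"
    and orth: "vec_space.col_space n W = vec_module.orthogonal_complement n (vec_space.col_space n H)"
begin

text \<open>\<open>G\<close> is the covariance matrix of \<open>W\<^sup>T y\<close> for unit variance and \<open>D\<close> its derivative; \<open>M\<close> is
  the precision matrix of the generalised least squares estimator of \<open>\<beta>\<close> for unit variance.\<close>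

definition "G t = W\<^sup>T * \<Sigma> t * W"
definition "M t = H\<^sup>T * minv (\<Sigma> t) * H"
definition "P t = W * minv (G t) * W\<^sup>T"
definition "D t = W\<^sup>T * mat_deriv n \<Sigma> t * W"

lemma W_transpose_carrier: "W\<^sup>T \<in> carrier_mat m n" using W by simp

lemma \<Sigma>_pd: "t \<in> I \<Longrightarrow> positive_definite n (\<Sigma> t)"
  using invertible_correlation_positive_definite \<Sigma>_correlation \<Sigma>_invertible by blast

lemma \<Sigma>_carrier: "t \<in> I \<Longrightarrow> \<Sigma> t \<in> carrier_mat n n"
  using \<Sigma>_pd by (auto simp: positive_definite_def)

lemma G_pd: "t \<in> I \<Longrightarrow> positive_definite m (G t)"
  unfolding G_def by (rule gram_positive_definite[OF \<Sigma>_pd W full_column_rank_injective[OF W rank_W]])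

lemma G_carrier: "t \<in> I \<Longrightarrow> G t \<in> carrier_mat m m"
  using G_pd by (auto simp: positive_definite_def)

lemma M_pd: "t \<in> I \<Longrightarrow> positive_definite p (M t)"
  unfolding M_def
  by (rule gram_positive_definite[OF minv_positive_definite(4)[OF \<Sigma>_pd] H full_column_rank_injective[OF H rank_H]])

lemma P_eq:
  assumes "t \<in> I"
  shows "minv (\<Sigma> t) - minv (\<Sigma> t) * H * minv (M t) * H\<^sup>T * minv (\<Sigma> t) = P t"
  unfolding P_def G_def M_def
  by (rule kriging_projection_identity[OF \<Sigma>_pd[OF assms] H W M_pd[OF assms, unfolded M_def] G_pd[OF assms, unfolded G_def] orth])

lemma mat_deriv_carrier: "mat_deriv n \<Sigma> t \<in> carrier_mat n n" by (simp add: mat_deriv_def)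

lemma D_carrier: "D t \<in> carrier_mat m m" using W mat_deriv_carrier[of t] by (simp add: D_def)

lemma \<Sigma>_derivative: "t \<in> I \<Longrightarrow> has_mat_derivative n n \<Sigma> (mat_deriv n \<Sigma> t) t"
  using \<Sigma>_differentiable
  by (auto simp: has_mat_derivative_def mat_deriv_def mat_differentiable_on_def DERIV_deriv_iff_real_differentiable)

lemma mat_deriv_symmetric:
  assumes t: "t \<in> I" shows "transpose_mat (mat_deriv n \<Sigma> t) = mat_deriv n \<Sigma> t"
proof (rule eq_matI)
  fix i j assume "i < dim_row (mat_deriv n \<Sigma> t)" "j < dim_col (mat_deriv n \<Sigma> t)"
  then have ij: "i < n" "j < n" by (auto simp: mat_deriv_def)
  have "\<forall>\<^sub>F u in nhds t. u \<in> I" using I t by (rule eventually_nhds_in_open)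
  then have "\<forall>\<^sub>F u in nhds t. \<Sigma> u $$ (j, i) = \<Sigma> u $$ (i, j)"
  proof eventually_elim
    fix u assume "u \<in> I"
    then have "transpose_mat (\<Sigma> u) = \<Sigma> u" "\<Sigma> u \<in> carrier_mat n n" using \<Sigma>_pd by (auto simp: positive_definite_def)
    then show "\<Sigma> u $$ (j, i) = \<Sigma> u $$ (i, j)" using ij by (metis index_transpose_mat(1) carrier_matD)
  qed
  then have "deriv (\<lambda>u. \<Sigma> u $$ (j, i)) t = deriv (\<lambda>u. \<Sigma> u $$ (i, j)) t" by (rule deriv_cong_ev) simp
  then show "transpose_mat (mat_deriv n \<Sigma> t) $$ (i, j) = mat_deriv n \<Sigma> t $$ (i, j)"
    using ij by (simp add: mat_deriv_def)
qed (auto simp: mat_deriv_def)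

lemma G_derivative: "t \<in> I \<Longrightarrow> has_mat_derivative m m G (D t) t"
  unfolding G_def[abs_def] D_def
  by (rule has_mat_derivative_congruence[OF I _ \<Sigma>_carrier mat_deriv_carrier \<Sigma>_derivative W])

lemma minv_G_derivative:
  "t \<in> I \<Longrightarrow> has_mat_derivative m m (\<lambda>u. minv (G u)) (- (minv (G t) * D t * minv (G t))) t"
  by (rule has_mat_derivative_minv[OF I _ G_carrier positive_definite_det_nonzero[OF G_pd] D_carrier G_derivative])

text \<open>The part of the logarithm of the integrated likelihood that does not depend on \<open>y\<close>; its derivative
  shifts the score by a constant.\<close>

definition "log_factor t = (real p * ln (2 * pi) - ln (det (M t)) - real n * ln (2 * pi) - ln (det (\<Sigma> t))) / 2
   + ln (enn2real (scale_integral m 1))"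

lemma det_pos: "t \<in> I \<Longrightarrow> 0 < det (M t)" "t \<in> I \<Longrightarrow> 0 < det (\<Sigma> t)"
  using gaussian_total(2)[OF M_pd minv_positive_definite(3)[OF M_pd] minv_positive_definite(2)[OF M_pd]]
    gaussian_total(2)[OF \<Sigma>_pd minv_positive_definite(3)[OF \<Sigma>_pd] minv_positive_definite(2)[OF \<Sigma>_pd]]
  by blast+

lemma log_factor_differentiable:
  assumes t: "t \<in> I" shows "log_factor differentiable (at t)"
proof -
  have dS: "has_mat_derivative n n \<Sigma> (mat_deriv n \<Sigma> t) t" by (rule \<Sigma>_derivative[OF t])
  have dinv: "has_mat_derivative n n (\<lambda>u. minv (\<Sigma> u)) (- (minv (\<Sigma> t) * mat_deriv n \<Sigma> t * minv (\<Sigma> t))) t"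
    by (rule has_mat_derivative_minv[OF I t \<Sigma>_carrier positive_definite_det_nonzero[OF \<Sigma>_pd] mat_deriv_carrier dS])
  have inv: "minv (\<Sigma> u) \<in> carrier_mat n n" if "u \<in> I" for u using minv_positive_definite(3)[OF \<Sigma>_pd[OF that]] .
  have c: "- (minv (\<Sigma> t) * mat_deriv n \<Sigma> t * minv (\<Sigma> t)) \<in> carrier_mat n n" using inv[OF t] mat_deriv_carrier[of t] by simp
  have dM: "has_mat_derivative p p M (H\<^sup>T * - (minv (\<Sigma> t) * mat_deriv n \<Sigma> t * minv (\<Sigma> t)) * H) t"
    unfolding M_def[abs_def] by (rule has_mat_derivative_congruence[OF I t inv c dinv H])
  have Mc: "M u \<in> carrier_mat p p" if "u \<in> I" for u using M_pd[OF that] by (simp add: positive_definite_def)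
  have "(\<lambda>u. det (M u)) differentiable (at t)"
    by (rule det_differentiable[OF I t Mc]) (use dM in \<open>auto simp: has_mat_derivative_def real_differentiable_def\<close>)
  moreover have "(\<lambda>u. det (\<Sigma> u)) differentiable (at t)"
    by (rule det_differentiable[OF I t \<Sigma>_carrier]) (use dS in \<open>auto simp: has_mat_derivative_def real_differentiable_def\<close>)
  ultimately obtain a b where ab: "((\<lambda>u. det (M u)) has_real_derivative a) (at t)" "((\<lambda>u. det (\<Sigma> u)) has_real_derivative b) (at t)"
    by (auto simp: real_differentiable_def)
  have "(\<lambda>u. ln (det (M u))) differentiable (at t)" "(\<lambda>u. ln (det (\<Sigma> u))) differentiable (at t)"
    using DERIV_chain2[OF DERIV_ln_divide[OF det_pos(1)[OF t]] ab(1)] DERIV_chain2[OF DERIV_ln_divide[OF det_pos(2)[OF t]] ab(2)]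
    unfolding real_differentiable_def by blast+
  then show ?thesis
    unfolding log_factor_def[abs_def]
    by (intro differentiable_add differentiable_divide differentiable_diff differentiable_const) auto
qed

lemma qform_P:
  assumes "t \<in> I" "y \<in> carrier_vec n" shows "qform (P t) y = qform (minv (G t)) (W\<^sup>T *\<^sub>v y)"
  using qform_congruence[OF minv_positive_definite(3)[OF G_pd[OF assms(1)]] W_transpose_carrier assms(2)] by (simp add: P_def)

lemma qform_P_pos:
  assumes "t \<in> I" "y \<in> carrier_vec n" "W\<^sup>T *\<^sub>v y \<noteq> 0\<^sub>v m" shows "0 < qform (P t) y"
proof -
  have "W\<^sup>T *\<^sub>v y \<in> carrier_vec m" by (rule mult_mat_vec_carrier[OF W_transpose_carrier assms(2)])
  with minv_positive_definite(4)[OF G_pd[OF assms(1)]] assms(3)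
  show ?thesis unfolding qform_P[OF assms(1,2)] unfolding qform_def positive_definite_def by blast
qed

lemma qform_P_zero:
  assumes "t \<in> I" "y \<in> carrier_vec n" "W\<^sup>T *\<^sub>v y = 0\<^sub>v m" shows "qform (P t) y = 0"
  unfolding qform_P[OF assms(1,2)] assms(3) unfolding qform_def
  by (rule scalar_prod_left_zero[OF mult_mat_vec_carrier[OF minv_positive_definite(3)[OF G_pd[OF assms(1)]] zero_carrier_vec]])

definition "factor t = sqrt ((2 * pi) ^ p / det (M t)) / sqrt ((2 * pi) ^ n * det (\<Sigma> t))"

lemma integrated_likelihood_eq:
  assumes t: "t \<in> I" and y: "y \<in> carrier_vec n"
  shows "integrated_likelihood n p H (\<Sigma> t) y =
     factor t * enn2real (scale_integral m (qform (P t) y))"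
  unfolding integrated_likelihood_closed_form[OF \<Sigma>_pd[OF t] H M_pd[OF t, unfolded M_def] n_eq y, folded M_def] P_eq[OF t] factor_def ..

lemma log_integrated_likelihood:
  assumes t: "t \<in> I" and y: "y \<in> carrier_vec n" and Wy: "W\<^sup>T *\<^sub>v y \<noteq> 0\<^sub>v m"
  shows "ln (integrated_likelihood n p H (\<Sigma> t) y) = log_factor t - real m / 2 * ln (qform (minv (G t)) (W\<^sup>T *\<^sub>v y))"
proof -
  define Q where "Q = qform (P t) y"
  define \<kappa> where "\<kappa> = enn2real (scale_integral m 1)"
  have Q: "0 < Q" unfolding Q_def by (rule qform_P_pos[OF t y Wy])
  have \<kappa>: "0 < \<kappa>" unfolding \<kappa>_def by (rule enn2real_scale_integral(1)[OF m_pos])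
  have sc: "enn2real (scale_integral m Q) = \<kappa> / sqrt (Q ^ m)"
    unfolding \<kappa>_def by (rule enn2real_scale_integral(2)[OF m_pos Q])
  have ln_sqrt_pow: "ln (sqrt (x ^ k)) = real k * ln x / 2" if "0 < x" for x :: real and k
    using that by (simp add: ln_sqrt ln_realpow)
  have ln_quot: "ln (a / b * (c / d)) = (ln a - ln b) + (ln c - ln d)" if "0 < a" "0 < b" "0 < c" "0 < d" for a b c d :: real
    using that by (simp add: ln_mult_pos ln_div)
  have ln_pow_div: "ln (x ^ k / d) = real k * ln x - ln d" and ln_pow_mult: "ln (x ^ k * d) = real k * ln x + ln d"
    if "0 < x" "0 < d" for x d :: real and k
    using that by (simp_all add: ln_div ln_mult_pos ln_realpow)
  have pi: "0 < 2 * pi" by simp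
  have a: "0 < (2 * pi) ^ p / det (M t)" and b: "0 < (2 * pi) ^ n * det (\<Sigma> t)" using det_pos[OF t] by auto
  have "ln (integrated_likelihood n p H (\<Sigma> t) y) =
     (ln (sqrt ((2 * pi) ^ p / det (M t))) - ln (sqrt ((2 * pi) ^ n * det (\<Sigma> t)))) + (ln \<kappa> - ln (sqrt (Q ^ m)))"
    unfolding integrated_likelihood_eq[OF t y] factor_def Q_def[symmetric] sc
    by (rule ln_quot) (use a b Q \<kappa> in simp_all)
  also have "ln (sqrt ((2 * pi) ^ p / det (M t))) = (real p * ln (2 * pi) - ln (det (M t))) / 2"
    unfolding ln_sqrt[OF less_imp_le[OF a]] ln_pow_div[OF pi det_pos(1)[OF t]] ..
  also have "ln (sqrt ((2 * pi) ^ n * det (\<Sigma> t))) = (real n * ln (2 * pi) + ln (det (\<Sigma> t))) / 2"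
    unfolding ln_sqrt[OF less_imp_le[OF b]] ln_pow_mult[OF pi det_pos(2)[OF t]] ..
  also have "ln (sqrt (Q ^ m)) = real m / 2 * ln Q" using ln_sqrt_pow[OF Q, of m] by simp
  finally show ?thesis unfolding Q_def qform_P[OF t y] by (simp add: log_factor_def \<kappa>_def field_simps)
qed

text \<open>Inner dimensions do not occur in a product of matrices, so rewriting with associativity needs
  them as explicit instances.\<close>

lemmas mult_assoc =
  assoc_mult_mat[of _ n m _ m _ n] assoc_mult_mat[of _ n m _ n _ n] assoc_mult_mat[of _ n n _ m _ n]
  assoc_mult_mat[of _ m n _ n _ n] assoc_mult_mat[of _ m n _ n _ m] assoc_mult_mat[of _ m n _ m _ m]
  assoc_mult_mat[of _ m n _ m _ n] assoc_mult_mat[of _ m m _ m _ m] assoc_mult_mat[of _ m m _ m _ n]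
  assoc_mult_mat[of _ m m _ n _ n] assoc_mult_mat[of _ m m _ n _ m]

definition "B t = P t * mat_deriv n \<Sigma> t * P t"

lemma B_eq: "t \<in> I \<Longrightarrow> B t = W * (minv (G t) * D t * minv (G t)) * W\<^sup>T"
proof -
  assume t: "t \<in> I"
  note Gi = minv_positive_definite(3)[OF G_pd[OF t]]
  show ?thesis unfolding B_def P_def D_def using W W_transpose_carrier Gi mat_deriv_carrier[of t] by (simp add: mult_assoc)
qed

lemma projection_and_traces:
  assumes t: "t \<in> I"
  shows "mtrace (B t * \<Sigma> t) = mtrace (D t * minv (G t))"
    "mtrace (B t * \<Sigma> t * (B t * \<Sigma> t)) = mtrace (D t * minv (G t) * (D t * minv (G t)))"
    "mtrace (P t * \<Sigma> t) = real m"
    "P t * \<Sigma> t * P t = P t"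
proof -
  note Gi = minv_positive_definite[OF G_pd[OF t]]
  note S = \<Sigma>_carrier[OF t] and Gc' = G_carrier[OF t] and Dc' = D_carrier[of t]
  define Y where "Y = D t * minv (G t) * W\<^sup>T * \<Sigma> t"
  have X: "W * minv (G t) \<in> carrier_mat n m" using W Gi by simp
  have Y: "Y \<in> carrier_mat m n" unfolding Y_def by (rule mult_carrier_mat[OF mult_carrier_mat[OF mult_carrier_mat[OF Dc' Gi(3)] W_transpose_carrier] S])
  have BS: "B t * \<Sigma> t = (W * minv (G t)) * Y"
    unfolding B_eq[OF t] Y_def using W W_transpose_carrier Gi(3) Dc' S by (simp add: mult_assoc)
  have "Y * (W * minv (G t)) = D t * minv (G t) * (W\<^sup>T * \<Sigma> t * W) * minv (G t)"
    unfolding Y_def using W W_transpose_carrier Gi(3) Dc' S by (simp add: mult_assoc)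
  also have "\<dots> = D t * (minv (G t) * G t) * minv (G t)"
    unfolding G_def[symmetric] using Gi(3) Dc' Gc' by (simp add: mult_assoc)
  also have "\<dots> = D t * minv (G t)" unfolding Gi(2) using Dc' by simp
  finally have YX: "Y * (W * minv (G t)) = D t * minv (G t)" .
  show "mtrace (B t * \<Sigma> t) = mtrace (D t * minv (G t))"
    unfolding BS mtrace_mult_comm[OF X Y] YX ..
  show "mtrace (B t * \<Sigma> t * (B t * \<Sigma> t)) = mtrace (D t * minv (G t) * (D t * minv (G t)))"
    unfolding BS mtrace_square_swap[OF X Y] YX ..
  have WS: "W\<^sup>T * \<Sigma> t \<in> carrier_mat m n" using W_transpose_carrier S by simp
  have "P t * \<Sigma> t = (W * minv (G t)) * (W\<^sup>T * \<Sigma> t)"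
    unfolding P_def using W W_transpose_carrier Gi(3) S by (simp add: mult_assoc)
  moreover have "(W\<^sup>T * \<Sigma> t) * (W * minv (G t)) = 1\<^sub>m m"
  proof -
    have "(W\<^sup>T * \<Sigma> t) * (W * minv (G t)) = G t * minv (G t)"
      unfolding G_def using W W_transpose_carrier Gi(3)[unfolded G_def] S by (simp add: mult_assoc)
    then show ?thesis using Gi(1) by simp
  qed
  ultimately show "mtrace (P t * \<Sigma> t) = real m"
    using mtrace_mult_comm[OF X WS] by (simp add: mtrace_def)
  have "P t * \<Sigma> t * P t = W * (minv (G t) * (W\<^sup>T * \<Sigma> t * W)) * minv (G t) * W\<^sup>T"
    unfolding P_def using W W_transpose_carrier Gi(3) S by (simp add: mult_assoc)
  also have "\<dots> = P t" unfolding G_def[symmetric] Gi(2) P_def using W by simp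
  finally show "P t * \<Sigma> t * P t = P t" .
qed

lemma B_carrier: "t \<in> I \<Longrightarrow> B t \<in> carrier_mat n n" and P_carrier: "t \<in> I \<Longrightarrow> P t \<in> carrier_mat n n"
proof -
  assume t: "t \<in> I"
  show P_carrier: "P t \<in> carrier_mat n n"
    unfolding P_def by (rule mult_carrier_mat[OF mult_carrier_mat[OF W minv_positive_definite(3)[OF G_pd[OF t]]] W_transpose_carrier])
  show "B t \<in> carrier_mat n n"
    unfolding B_def by (rule mult_carrier_mat[OF mult_carrier_mat[OF P_carrier mat_deriv_carrier] P_carrier])
qed

lemma P_symmetric:
  assumes t: "t \<in> I" shows "transpose_mat (P t) = P t"
proof -
  note Gi = minv_positive_definite(3,4)[OF G_pd[OF t]]
  have Gis: "transpose_mat (minv (G t)) = minv (G t)" using Gi(2) by (simp add: positive_definite_def)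
  have WG: "W * minv (G t) \<in> carrier_mat n m" by (rule mult_carrier_mat[OF W Gi(1)])
  show ?thesis
    unfolding P_def transpose_mult[OF WG W_transpose_carrier] transpose_mult[OF W Gi(1)] Gis transpose_transpose
    by (rule assoc_mult_mat[OF W Gi(1) W_transpose_carrier, symmetric])
qed

lemma B_symmetric:
  assumes t: "t \<in> I" shows "transpose_mat (B t) = B t"
  unfolding B_def transpose_mult[OF mult_carrier_mat[OF P_carrier[OF t] mat_deriv_carrier] P_carrier[OF t]] transpose_mult[OF P_carrier[OF t] mat_deriv_carrier]
    P_symmetric[OF t] mat_deriv_symmetric[OF t]
  by (rule assoc_mult_mat[OF P_carrier[OF t] mat_deriv_carrier P_carrier[OF t], symmetric])

lemma qform_B:
  assumes t: "t \<in> I" and y: "y \<in> carrier_vec n"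
  shows "qform (B t) y = qform (minv (G t) * D t * minv (G t)) (W\<^sup>T *\<^sub>v y)"
proof -
  note Gi = minv_positive_definite(3)[OF G_pd[OF t]]
  show ?thesis
    using qform_congruence[OF mult_carrier_mat[OF mult_carrier_mat[OF Gi D_carrier] Gi] W_transpose_carrier y] by (simp add: B_eq[OF t])
qed

text \<open>Only the logarithm of \<open>z\<^sup>T G\<^sup>-\<^sup>1 z\<close>, where \<open>z = W\<^sup>T y\<close>, depends on \<open>y\<close>.\<close>

lemma score_eq:
  assumes t: "t \<in> I" and y: "y \<in> carrier_vec n" and Wy: "W\<^sup>T *\<^sub>v y \<noteq> 0\<^sub>v m"
  shows "score n p H \<Sigma> t y = deriv log_factor t + real m / 2 * (qform (B t) y / qform (P t) y)"
proof -
  define z where "z = W\<^sup>T *\<^sub>v y"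
  have z: "z \<in> carrier_vec m" unfolding z_def by (rule mult_mat_vec_carrier[OF W_transpose_carrier y])
  note Gi = minv_positive_definite(3)[OF G_pd]
  have GDG: "minv (G t) * D t * minv (G t) \<in> carrier_mat m m"
    by (rule mult_carrier_mat[OF mult_carrier_mat[OF Gi[OF t] D_carrier] Gi[OF t]])
  have "((\<lambda>u. qform (minv (G u)) z) has_real_derivative qform (- (minv (G t) * D t * minv (G t))) z) (at t)"
    by (rule has_real_derivative_qform[OF I t Gi _ minv_G_derivative[OF t] z]) (use GDG in auto)
  also have "- (minv (G t) * D t * minv (G t)) = (- 1) \<cdot>\<^sub>m (minv (G t) * D t * minv (G t))"
    by (rule eq_matI) auto
  also have "qform \<dots> z = - qform (B t) y"
    unfolding qform_smult[OF GDG z] unfolding qform_B[OF t y] z_def by simp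
  finally have dq: "((\<lambda>u. qform (minv (G u)) z) has_real_derivative - qform (B t) y) (at t)" .
  have q: "qform (minv (G t)) z = qform (P t) y" using qform_P[OF t y] by (simp add: z_def)
  have pos: "0 < qform (minv (G t)) z" unfolding q by (rule qform_P_pos[OF t y Wy])
  have dlog: "(log_factor has_real_derivative deriv log_factor t) (at t)"
    using log_factor_differentiable[OF t] by (simp add: DERIV_deriv_iff_real_differentiable)
  have "((\<lambda>u. log_factor u - real m / 2 * ln (qform (minv (G u)) z)) has_real_derivative
      (deriv log_factor t - real m / 2 * (1 / qform (minv (G t)) z * - qform (B t) y))) (at t)"
    by (rule DERIV_diff[OF dlog DERIV_cmult[OF DERIV_chain2[OF DERIV_ln_divide[OF pos] dq]]])
  then have "((\<lambda>u. ln (integrated_likelihood n p H (\<Sigma> u) y)) has_real_derivative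
      (deriv log_factor t - real m / 2 * (1 / qform (minv (G t)) z * - qform (B t) y))) (at t)"
    by (rule has_field_derivative_transform_within_open[OF _ I t])
      (simp add: log_integrated_likelihood[OF _ y Wy] z_def)
  from DERIV_imp_deriv[OF this] show ?thesis by (simp add: score_def q)
qed

text \<open>The column space of \<open>H\<close> is a null set, but the variance is defined by Bochner integrals, for
  which the score must be measurable on this set as well. It is, because it does not depend on \<open>y\<close> there.\<close>

lemma score_degenerate:
  assumes t: "t \<in> I" and y: "y \<in> carrier_vec n" and Wy: "W\<^sup>T *\<^sub>v y = 0\<^sub>v m"
  shows "score n p H \<Sigma> t y = deriv (\<lambda>u. ln (factor u * enn2real (scale_integral m 0))) t"
  unfolding score_def
proof (rule deriv_cong_ev)
  have "\<forall>\<^sub>F u in nhds t. u \<in> I" using I t by (rule eventually_nhds_in_open)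
  then show "\<forall>\<^sub>F u in nhds t. ln (integrated_likelihood n p H (\<Sigma> u) y) =
      ln (factor u * enn2real (scale_integral m 0))"
    by eventually_elim (simp only: integrated_likelihood_eq y qform_P_zero[OF _ y Wy])
qed simp

text \<open>Since \<open>W\<^sup>T H = 0\<close>, the quadratic forms of \<open>P\<close> and \<open>B\<close> take the same values at \<open>y\<close> and at
  \<open>y - H \<beta>\<close>. The factor \<open>s\<close> of the covariance matrix is compensated by \<open>1 / s\<close> in \<open>R\<close> and \<open>B'\<close>.\<close>

lemma variance_score:
  assumes t: "t \<in> I" and \<beta>: "\<beta> \<in> carrier_vec p" and s: "0 < s"
  shows "prob_space.variance (mvn n (H *\<^sub>v \<beta>) (s \<cdot>\<^sub>m \<Sigma> t)) (score n p H \<Sigma> t) =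
    (real m / 2)\<^sup>2 * (2 / (real m * (real m + 2)) *
      (mtrace (D t * minv (G t) * (D t * minv (G t))) - (mtrace (D t * minv (G t)))\<^sup>2 / real m))"
proof -
  note Pc' = P_carrier[OF t] and Bc' = B_carrier[OF t] and S = \<Sigma>_carrier[OF t] and tr = projection_and_traces[OF t]
  define \<mu> where "\<mu> = H *\<^sub>v \<beta>"
  have \<mu>: "\<mu> \<in> carrier_vec n" using H \<beta> by (simp add: \<mu>_def)
  have W\<mu>: "W\<^sup>T *\<^sub>v \<mu> = 0\<^sub>v m"
    unfolding \<mu>_def assoc_mult_mat_vec[OF W_transpose_carrier H \<beta>, symmetric] col_space_orthogonal(1)[OF H W orth]
    using \<beta> by (intro eq_vecI) auto
  define R where "R = (1 / s) \<cdot>\<^sub>m P t"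
  define B' where "B' = (1 / s) \<cdot>\<^sub>m B t"
  define V where "V = s \<cdot>\<^sub>m \<Sigma> t"
  have smult_cancel: "((1 / s) \<cdot>\<^sub>m X) * (s \<cdot>\<^sub>m Y) = X * Y"
    if X: "X \<in> carrier_mat n n" and Y: "Y \<in> carrier_mat n n" for X Y :: "real mat"
  proof -
    have sY: "s \<cdot>\<^sub>m Y \<in> carrier_mat n n" using Y by simp
    have "((1 / s) \<cdot>\<^sub>m X) * (s \<cdot>\<^sub>m Y) = (1 / s) \<cdot>\<^sub>m (s \<cdot>\<^sub>m (X * Y))"
      unfolding mult_smult_assoc_mat[OF X sY] mult_smult_distrib[OF X Y] ..
    also have "\<dots> = X * Y" using s by (intro eq_matI) auto
    finally show ?thesis .
  qed
  have smult_transpose: "transpose_mat (c \<cdot>\<^sub>m X) = c \<cdot>\<^sub>m X\<^sup>T" for c and X :: "real mat"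
    by (rule eq_matI) auto
  have RV: "R * V = P t * \<Sigma> t" unfolding R_def V_def by (rule smult_cancel[OF Pc' S])
  have BV: "B' * V = B t * \<Sigma> t" unfolding B'_def V_def by (rule smult_cancel[OF Bc' S])
  have PS: "P t * \<Sigma> t \<in> carrier_mat n n" and BS: "B t * \<Sigma> t \<in> carrier_mat n n" using Pc' Bc' S by auto
  have V: "positive_definite n V" unfolding V_def by (rule positive_definite_smult[OF \<Sigma>_pd[OF t] s])
  have R: "R \<in> carrier_mat n n" "R\<^sup>T = R"
    unfolding R_def smult_transpose P_symmetric[OF t] using Pc' by auto
  have RVR: "R * V * R = R"
    unfolding RV unfolding R_def mult_smult_distrib[OF PS Pc'] tr(4) ..
  have B': "B' \<in> carrier_mat n n" "B'\<^sup>T = B'"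
    unfolding B'_def smult_transpose B_symmetric[OF t] using Bc' by auto
  have BSP: "B t * \<Sigma> t * P t = B t"
  proof -
    have PD: "P t * mat_deriv n \<Sigma> t \<in> carrier_mat n n" by (rule mult_carrier_mat[OF Pc' mat_deriv_carrier])
    have "B t * \<Sigma> t * P t = P t * mat_deriv n \<Sigma> t * (P t * \<Sigma> t * P t)"
      unfolding B_def assoc_mult_mat[OF PD Pc' S] assoc_mult_mat[OF PD PS Pc'] ..
    then show ?thesis unfolding tr(4) B_def .
  qed
  have BVR: "B' * V * R = B'"
    unfolding BV unfolding R_def mult_smult_distrib[OF BS Pc'] BSP B'_def ..
  define c where "c = deriv (\<lambda>u. ln (factor u * enn2real (scale_integral m 0))) t"
  have zero_iff: "qform (P t) y = 0 \<longleftrightarrow> W\<^sup>T *\<^sub>v y = 0\<^sub>v m" if "y \<in> carrier_vec n" for y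
    using qform_P_pos[OF t that] qform_P_zero[OF t that] by (metis less_irrefl)
  have score_cases: "score n p H \<Sigma> t y = (if qform (P t) y = 0 then c
       else deriv log_factor t + real m / 2 * (qform (B t) y / qform (P t) y))" if "y \<in> carrier_vec n" for y
    using score_eq[OF t that] score_degenerate[OF t that] zero_iff[OF that] unfolding c_def by presburger
  have meas: "score n p H \<Sigma> t \<in> borel_measurable (lborel_vec n)"
  proof -
    note [measurable] = measurable_qform_id[OF Pc'] measurable_qform_id[OF Bc']
    have "(\<lambda>y. if qform (P t) y = 0 then c else deriv log_factor t + real m / 2 * (qform (B t) y / qform (P t) y))
       \<in> borel_measurable (lborel_vec n)" by measurable
    then show ?thesis
      by (subst measurable_cong[where g = "\<lambda>y. if qform (P t) y = 0 then c else deriv log_factor t + real m / 2 * (qform (B t) y / qform (P t) y)"])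
        (simp_all only: space_lborel_vec score_cases)
  qed
  have P_nz: "P t \<noteq> 0\<^sub>m n n"
  proof
    assume "P t = 0\<^sub>m n n"
    then have "mtrace (P t * \<Sigma> t) = 0" using S by (simp add: mtrace_def)
    then show False using tr(3) m_pos by simp
  qed
  have "AE y in lborel_vec n. score n p H \<Sigma> t y = deriv log_factor t + real m / 2 * (qform B' (y - \<mu>) / qform R (y - \<mu>))"
    using AE_qform_projection_pos[OF \<Sigma>_pd[OF t] Pc' P_symmetric[OF t] tr(4) P_nz]
  proof (rule AE_mp, intro AE_I2 impI)
    fix y assume "y \<in> space (lborel_vec n)" and pos: "0 < qform (P t) y"
    then have y: "y \<in> carrier_vec n" by (simp add: space_lborel_vec)
    have y\<mu>: "y - \<mu> \<in> carrier_vec n" using y \<mu> by simp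
    have Wy: "W\<^sup>T *\<^sub>v (y - \<mu>) = W\<^sup>T *\<^sub>v y"
      unfolding mult_minus_distrib_mat_vec[OF W_transpose_carrier y \<mu>] W\<mu> using mult_mat_vec_carrier[OF W_transpose_carrier y] by simp
    have "qform R (y - \<mu>) = 1 / s * qform (P t) y" "qform B' (y - \<mu>) = 1 / s * qform (B t) y"
      unfolding R_def B'_def qform_smult[OF Pc' y\<mu>] qform_smult[OF Bc' y\<mu>]
        qform_P[OF t y\<mu>] qform_P[OF t y] qform_B[OF t y\<mu>] qform_B[OF t y] Wy by simp_all
    then have "qform B' (y - \<mu>) / qform R (y - \<mu>) = qform (B t) y / qform (P t) y" using s by simp
    then show "score n p H \<Sigma> t y = deriv log_factor t + real m / 2 * (qform B' (y - \<mu>) / qform R (y - \<mu>))"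
      using score_cases[OF y] pos by simp
  qed
  from gaussian_ratio_variance[OF V \<mu> R RVR B' BVR _ _ meas this, of "real m"] m_pos
  show ?thesis unfolding RV BV tr V_def[symmetric] \<mu>_def[symmetric] by simp
qed

lemma reference_prior_eq:
  assumes t: "t \<in> I" and \<beta>: "\<beta> \<in> carrier_vec p" and s: "0 < s"
  shows "reference_prior n p H \<Sigma> \<beta> s t = sqrt (real m / (2 * (real m + 2))) * prior_expr n p (D t * minv (G t))"
proof -
  have "(a / 2)\<^sup>2 * (2 / (a * k) * x) = a / (2 * k) * x" if "a \<noteq> 0" for a k x :: real
    using that by (simp add: power2_eq_square)
  then have factor: "(real m / 2)\<^sup>2 * (2 / (real m * (real m + 2)) * x) = real m / (2 * (real m + 2)) * x" for x
    using m_pos by simp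
  have np: "n - p = m" using n_eq by simp
  show ?thesis
    unfolding reference_prior_def variance_score[OF t \<beta> s] prior_expr_def factor real_sqrt_mult np
    by (simp only: times_divide_eq_left mult_1_left)
qed

lemma prior_W_eq: "prior_W n p W \<Sigma> t = prior_expr n p (D t * minv (G t))"
  by (simp add: prior_W_def D_def G_def)

text \<open>The matrix in \<open>prior_Q\<close> is \<open>\<Sigma>' P\<close>, and moving its last factor \<open>W\<^sup>T\<close> to the front turns it into \<open>D G\<^sup>-\<^sup>1\<close>.\<close>

lemma prior_Q_eq:
  assumes t: "t \<in> I"
  shows "prior_Q n p H \<Sigma> t = prior_expr n p (D t * minv (G t))"
proof -
  note Si = minv_positive_definite(3)[OF \<Sigma>_pd[OF t]] and Gi = minv_positive_definite(3)[OF G_pd[OF t]]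
    and Mi = minv_positive_definite(3)[OF M_pd[OF t]]
  have Ht: "H\<^sup>T \<in> carrier_mat p n" using H by simp
  have HM: "H * minv (M t) \<in> carrier_mat n p" by (rule mult_carrier_mat[OF H Mi])
  have HMH: "H * minv (M t) * H\<^sup>T \<in> carrier_mat n n" by (rule mult_carrier_mat[OF HM Ht])
  have HMHS: "H * minv (M t) * H\<^sup>T * minv (\<Sigma> t) \<in> carrier_mat n n" by (rule mult_carrier_mat[OF HMH Si])
  have "minv (\<Sigma> t) * Q_mat n H (\<Sigma> t) = minv (\<Sigma> t) * 1\<^sub>m n - minv (\<Sigma> t) * (H * minv (M t) * H\<^sup>T * minv (\<Sigma> t))"
    unfolding Q_mat_def M_def[symmetric] by (rule mult_minus_distrib_mat[OF Si one_carrier_mat HMHS])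
  also have "\<dots> = P t"
    unfolding P_eq[OF t, symmetric] assoc_mult_mat[OF Si HMH Si, symmetric] assoc_mult_mat[OF Si HM Ht, symmetric]
      assoc_mult_mat[OF Si H Mi, symmetric] right_mult_one_mat[OF Si] ..
  finally have SQ: "minv (\<Sigma> t) * Q_mat n H (\<Sigma> t) = P t" .
  have Qc: "Q_mat n H (\<Sigma> t) \<in> carrier_mat n n"
    unfolding Q_mat_def M_def[symmetric] by (rule minus_carrier_mat[OF HMHS])
  have WG: "W * minv (G t) \<in> carrier_mat n m" by (rule mult_carrier_mat[OF W Gi])
  define X where "X = mat_deriv n \<Sigma> t * (W * minv (G t))"
  have X: "X \<in> carrier_mat n m" unfolding X_def by (rule mult_carrier_mat[OF mat_deriv_carrier WG])
  have N: "mat_deriv n \<Sigma> t * minv (\<Sigma> t) * Q_mat n H (\<Sigma> t) = X * W\<^sup>T"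
    unfolding assoc_mult_mat[OF mat_deriv_carrier Si Qc] SQ X_def P_def by (rule assoc_mult_mat[OF mat_deriv_carrier WG W_transpose_carrier, symmetric])
  have WX: "W\<^sup>T * X = D t * minv (G t)"
    unfolding X_def D_def assoc_mult_mat[OF W_transpose_carrier mat_deriv_carrier WG, symmetric]
    by (rule assoc_mult_mat[OF mult_carrier_mat[OF W_transpose_carrier mat_deriv_carrier] W Gi, symmetric])
  show ?thesis
    unfolding prior_Q_def prior_expr_def N mtrace_square_swap[OF X W_transpose_carrier] mtrace_mult_comm[OF X W_transpose_carrier] WX ..
qed

end

theorem proposition5:
  fixes n p :: nat
    and H W :: "real mat"
    and I :: "real set"
    and \<Sigma> :: "real \<Rightarrow> real mat"
  assumes "p < n"
    and "H \<in> carrier_mat n p" and "vec_space.rank n H = p"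
    and "open I" and "is_interval I"
    and "\<forall>\<theta>\<in>I. correlation_matrix n (\<Sigma> \<theta>) \<and> invertible_mat (\<Sigma> \<theta>)"
    and "mat_differentiable_on n \<Sigma> I"
    and "W \<in> carrier_mat n (n - p)" and "vec_space.rank n W = n - p"
    and "vec_space.col_space n W =
           vec_module.orthogonal_complement n (vec_space.col_space n H)"
  shows "(\<exists>c>0. \<forall>\<beta>\<in>carrier_vec p. \<forall>s>0. \<forall>\<theta>\<in>I.
             reference_prior n p H \<Sigma> \<beta> s \<theta> = c * prior_Q n p H \<Sigma> \<theta>) \<and>
         (\<exists>c>0. \<forall>\<beta>\<in>carrier_vec p. \<forall>s>0. \<forall>\<theta>\<in>I.
             reference_prior n p H \<Sigma> \<beta> s \<theta> = c * prior_W n p W \<Sigma> \<theta>)"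
proof -
  interpret universal_kriging n p "n - p" H W I \<Sigma>
    using assms by unfold_locales auto
  define c where "c = sqrt (real (n - p) / (2 * (real (n - p) + 2)))"
  have "0 < c" using assms(1) by (simp add: c_def)
  moreover have "\<forall>\<beta>\<in>carrier_vec p. \<forall>s>0. \<forall>\<theta>\<in>I. reference_prior n p H \<Sigma> \<beta> s \<theta> = c * prior_Q n p H \<Sigma> \<theta>"
    using reference_prior_eq prior_Q_eq by (simp add: c_def)
  moreover have "\<forall>\<beta>\<in>carrier_vec p. \<forall>s>0. \<forall>\<theta>\<in>I. reference_prior n p H \<Sigma> \<beta> s \<theta> = c * prior_W n p W \<Sigma> \<theta>"
    using reference_prior_eq prior_W_eq by (simp add: c_def)
  ultimately show ?thesis by blast
qed

end
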